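(* Let $G$ be an amenable group and let $A,B\subset G$ be subsets with $\sigma^R(A)>0$ and $\sigma^R(B)>0$. Then the sumset $AB=\{ab:a\in A,\ b\in B\}$ is piecewise Bohr. Consequently, some Bohr open neighborhood $U\subset G$ of the unit $1_G$ is finitely embeddable in $AB$.
   Context: A group $G$ is amenable if it admits a left-invariant finitely additive probability measure defined on all subsets of $G$. For $A\subset G$, $\sigma^R(A)=\inf_{F}\sup_{y\in G}\frac{|F\cap Ay|}{|F|}$, where $F$ runs over all non-empty finite subsets of $G$. The Bohr topology on a group $G$ is the smallest topology on $G$ for which the canonical homomorphism $\eta:G\to bG$ is continuous, where $(bG,\eta)$ is the Bohr compactification of $G$: $bG$ is a compact Hausdorff topological group and $\eta:G\to bG$ is a homomorphism such that every homomorphism $f:G\to K$ to a compact Hausdorff topological group factors as $f=\bar f\circ\eta$ for a unique continuous homomorphism $\bar f:bG\to K$. A subset of $G$ is Bohr open if it is open in the Bohr topology. A set $T\subset G$ is thick if for every finite $F\subset G$ there is $y\in G$ with $Fy\subset T$. A set $C\subset G$ is piecewise Bohr if it contains $U\cap T$ for some non-empty Bohr open set $U\subset G$ and some thick set $T\subset G$. A set $C\subset G$ is finitely embeddable in a set $D\subset G$ if for every finite set $F\subset C$ there is $x\in G$ with $Fx\subset D$. *)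

theory Defs
  imports "HOL-Analysis.Analysis" "HOL-Algebra.Coset"
begin

definition amenable_group :: "('a, 'm) monoid_scheme \<Rightarrow> bool" where
  "amenable_group G \<longleftrightarrow> group G \<and>
     (\<exists>\<mu> :: 'a set \<Rightarrow> real.
        (\<forall>S. S \<subseteq> carrier G \<longrightarrow> \<mu> S \<ge> 0) \<and>
        \<mu> (carrier G) = 1 \<and>
        (\<forall>S S'. S \<subseteq> carrier G \<longrightarrow> S' \<subseteq> carrier G \<longrightarrow> S \<inter> S' = {} \<longrightarrow>
           \<mu> (S \<union> S') = \<mu> S + \<mu> S') \<and>
        (\<forall>g S. g \<in> carrier G \<longrightarrow> S \<subseteq> carrier G \<longrightarrow> \<mu> (g <#\<^bsub>G\<^esub> S) = \<mu> S))"

text \<open>All quotients below lie in the interval from 0 to 1 and both index sets are non-empty, so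
  the conditionally complete infimum and supremum of the reals are the intended ones.\<close>

definition sigma_R :: "('a, 'm) monoid_scheme \<Rightarrow> 'a set \<Rightarrow> real" where
  "sigma_R G A =
     (INF F \<in> {F. finite F \<and> F \<noteq> {} \<and> F \<subseteq> carrier G}.
        SUP y \<in> carrier G. real (card (F \<inter> (A #>\<^bsub>G\<^esub> y))) / real (card F))"

definition compact_Hausdorff_group :: "('b, 'n) monoid_scheme \<Rightarrow> 'b topology \<Rightarrow> bool" where
  "compact_Hausdorff_group K TK \<longleftrightarrow>
     group K \<and> topspace TK = carrier K \<and>
     continuous_map (prod_topology TK TK) TK (\<lambda>(x, y). x \<otimes>\<^bsub>K\<^esub> y) \<and>
     continuous_map TK TK (\<lambda>x. inv\<^bsub>K\<^esub> x) \<and>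
     compact_space TK \<and> Hausdorff_space TK"

text \<open>HOL cannot quantify over all types inside a formula, so the test groups \<open>K\<close> of the
  universal property live on the type \<open>('a + nat) set set\<close>, where \<open>'a\<close> is the element type of
  \<open>G\<close>. This does not weaken the universal property:

  \<^item> Existence of the extension for all compact Hausdorff groups follows from its existence for
    closures of homomorphic images of \<open>G\<close>. A Hausdorff space with a dense image of \<open>G\<close> has at
    most as many points as there are sets of subsets of \<open>G\<close>, so these closures have copies on the
    test type.

  \<^item> Uniqueness for all compact Hausdorff groups follows if the image of \<open>\<eta>\<close> is dense in \<open>bG\<close>.
    The summand \<open>nat\<close> makes the test type large enough for all unitary groups U(n), also for
    finite \<open>'a\<close>. If the closure \<open>H\<close> of the image were proper, some nontrivial irreducible unitary
    representation of \<open>bG\<close> would have a nonzero \<open>H\<close>-fixed vector (Peter-Weyl). It and either the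
    trivial representation or a conjugate of it would be two different extensions to U(n) of the
    same homomorphism on \<open>G\<close>.

  The extension is unique as a function on \<open>carrier bG\<close>; \<open>extensional\<close> fixes its irrelevant
  values elsewhere. A Bohr compactification of \<open>G\<close> exists in particular with \<open>bG\<close> on the test
  type itself.\<close>

definition Bohr_compactification ::
  "('a, 'm) monoid_scheme \<Rightarrow> ('b, 'n) monoid_scheme \<Rightarrow> 'b topology \<Rightarrow> ('a \<Rightarrow> 'b) \<Rightarrow> bool" where
  "Bohr_compactification G bG T \<eta> \<longleftrightarrow>
     compact_Hausdorff_group bG T \<and> \<eta> \<in> hom G bG \<and>
     (\<forall>(K :: ('a + nat) set set monoid) TK f.
        compact_Hausdorff_group K TK \<and> f \<in> hom G K \<longrightarrow>
        (\<exists>!h. h \<in> hom bG K \<and> h \<in> extensional (carrier bG) \<and> continuous_map T TK h \<and>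
              (\<forall>x \<in> carrier G. h (\<eta> x) = f x)))"

definition Bohr_topology ::
  "('a, 'm) monoid_scheme \<Rightarrow> 'b topology \<Rightarrow> ('a \<Rightarrow> 'b) \<Rightarrow> 'a topology" where
  "Bohr_topology G T \<eta> = pullback_topology (carrier G) \<eta> T"

lemma Bohr_topology_smallest:
  assumes "Bohr_compactification G bG T \<eta>"
  shows "topspace (Bohr_topology G T \<eta>) = carrier G"
    and "continuous_map (Bohr_topology G T \<eta>) T \<eta>"
    and "\<lbrakk>topspace X = carrier G; continuous_map X T \<eta>; openin (Bohr_topology G T \<eta>) U\<rbrakk>
           \<Longrightarrow> openin X U"
proof -
  have \<eta>: "\<eta> x \<in> topspace T" if "x \<in> carrier G" for x
    using assms that
    by (auto simp: Bohr_compactification_def compact_Hausdorff_group_def hom_def)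
  show top: "topspace (Bohr_topology G T \<eta>) = carrier G"
    using \<eta> by (auto simp: Bohr_topology_def topspace_pullback_topology)
  show "continuous_map (Bohr_topology G T \<eta>) T \<eta>"
    using \<eta> top unfolding continuous_map_def Bohr_topology_def openin_pullback_topology
    by fastforce
  show "openin X U" if "topspace X = carrier G" "continuous_map X T \<eta>"
    "openin (Bohr_topology G T \<eta>) U"
  proof -
    from that(3) obtain V where V: "openin T V" "U = \<eta> -` V \<inter> carrier G"
      by (auto simp: Bohr_topology_def openin_pullback_topology)
    have "openin X {x \<in> topspace X. \<eta> x \<in> V}"
      using that(2) V(1) by (rule openin_continuous_map_preimage)
    moreover have "{x \<in> topspace X. \<eta> x \<in> V} = U"
      using V(2) that(1) by auto
    ultimately show ?thesis by simp
  qed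
qed

definition thick :: "('a, 'm) monoid_scheme \<Rightarrow> 'a set \<Rightarrow> bool" where
  "thick G S \<longleftrightarrow> S \<subseteq> carrier G \<and>
     (\<forall>F. finite F \<and> F \<subseteq> carrier G \<longrightarrow> (\<exists>y \<in> carrier G. F #>\<^bsub>G\<^esub> y \<subseteq> S))"

definition piecewise_Bohr ::
  "('a, 'm) monoid_scheme \<Rightarrow> 'b topology \<Rightarrow> ('a \<Rightarrow> 'b) \<Rightarrow> 'a set \<Rightarrow> bool" where
  "piecewise_Bohr G T \<eta> C \<longleftrightarrow> C \<subseteq> carrier G \<and>
     (\<exists>U S. openin (Bohr_topology G T \<eta>) U \<and> U \<noteq> {} \<and> thick G S \<and> U \<inter> S \<subseteq> C)"

definition finitely_embeddable ::
  "('a, 'm) monoid_scheme \<Rightarrow> 'a set \<Rightarrow> 'a set \<Rightarrow> bool" where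
  "finitely_embeddable G C D \<longleftrightarrow> C \<subseteq> carrier G \<and> D \<subseteq> carrier G \<and>
     (\<forall>F. finite F \<and> F \<subseteq> C \<longrightarrow> (\<exists>x \<in> carrier G. F #>\<^bsub>G\<^esub> x \<subseteq> D))"

end

theory Submission
  imports Defs
begin

text \<open>Positive upper density gives left invariant means \<open>\<mu>\<close>, \<open>\<nu>\<close> with \<open>\<mu>(A) > 0\<close> and
  \<open>\<nu>(B) > 0\<close> (Folner sets and a compactness argument). The functional
  \<open>\<lambda>(g) = \<mu>\<^sub>t (1\<^sub>A(t) \<nu>\<^sub>z (1\<^sub>B(t\<^sup>-\<^sup>1 z) g(z)))\<close> is positive, satisfies \<open>\<lambda> \<le> \<nu>\<close> and is
  concentrated on \<open>AB\<close>. It is almost invariant under a Bohr neighbourhood of the unit in the uniform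
  sense \<open>\<bar>\<lambda>(g(x \<cdot>)) - \<lambda>(g)\<bar> \<le> \<epsilon> \<nu>(\<bar>g\<bar>)\<close>: in \<open>L\<^sup>2(\<mu>)\<close> write \<open>1\<^sub>A = h + w\<close> with \<open>h\<close> almost periodic and
  \<open>w\<close> weakly mixing; van der Corput's trick shows that \<open>w\<close> contributes nothing, and \<open>h\<close> moves little in
  \<open>L\<^sup>1(\<mu>)\<close>. Since \<open>L\<^sup>2(\<mu>)\<close> is not complete, \<open>h\<close> is only approximated, by minimising the distance of
  \<open>1\<^sub>A\<close> to functions that move little under a precompact bi-invariant pseudometric \<open>D\<close> on \<open>G\<close>. The
  completion of \<open>(G, D)\<close> is a compact group, hence \<open>D\<close>-balls are Bohr open. If \<open>\<epsilon> < \<lambda>(1)\<close> then every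
  finite subset of the neighbourhood has a right translate inside \<open>AB\<close>.\<close>

section \<open>Means and their inner products\<close>

text \<open>The error in the almost invariance must be proportional to \<open>\<nu>\<close> of
  \<open>\<bar>g\<bar>\<close> and not to the sup norm of g: it is finally applied to the pieces of
  a partition of G, whose \<open>\<nu>\<close>-masses add up to 1 however many pieces there are, so
  the errors add up to at most \<open>\<epsilon>\<close>. The obstacle is a clash of quantifiers.
  The neighbourhood has to be chosen before g, but how close to weakly mixing the remainder must be
  depends on g. The quantitative uniqueness of a nearest point (parallelogram law) resolves it: any
  two near-minimisers are close in norm, so a fixed one may be exchanged for one adapted to g, at a
  cost proportional to \<open>\<nu>(\<bar>g\<bar>)\<close>. Left translation of functions yields
  pseudometrics that are only left invariant. Right invariance is what makes multiplication extend
  to the completion; it is obtained from a supremum over right translates.\<close>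

definition bfun :: "'x set \<Rightarrow> ('x \<Rightarrow> real) \<Rightarrow> bool" where
  "bfun S u \<longleftrightarrow> (\<exists>C. \<forall>x\<in>S. \<bar>u x\<bar> \<le> C)"

named_theorems bfun_intros

lemma bfunI: "(\<And>x. x \<in> S \<Longrightarrow> \<bar>u x\<bar> \<le> C) \<Longrightarrow> bfun S u"
  unfolding bfun_def by blast

lemma bfunE:
  assumes "bfun S u"
  obtains C where "C > 0" "\<And>x. x \<in> S \<Longrightarrow> \<bar>u x\<bar> \<le> C"
proof -
  obtain C where C: "\<And>x. x \<in> S \<Longrightarrow> \<bar>u x\<bar> \<le> C"
    using assms unfolding bfun_def by blast
  have "max C 1 > 0" "\<And>x. x \<in> S \<Longrightarrow> \<bar>u x\<bar> \<le> max C 1"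
    using C by (auto simp: le_max_iff_disj)
  then show ?thesis
    using that by blast
qed

lemma bfun_const [bfun_intros, simp]: "bfun S (\<lambda>_. c)"
  by (rule bfunI[of _ _ "\<bar>c\<bar>"]) simp

lemma bfun_add [bfun_intros]: "bfun S u \<Longrightarrow> bfun S v \<Longrightarrow> bfun S (\<lambda>x. u x + v x)"
  by (elim bfunE) (rule bfunI, rule order.trans[OF abs_triangle_ineq add_mono])

lemma bfun_mult [bfun_intros]: "bfun S u \<Longrightarrow> bfun S v \<Longrightarrow> bfun S (\<lambda>x. u x * v x)"
  by (elim bfunE) (rule bfunI, simp add: abs_mult, rule mult_mono, auto)

lemma bfun_minus [bfun_intros]: "bfun S u \<Longrightarrow> bfun S (\<lambda>x. - u x)"
  by (auto simp: bfun_def)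

lemma bfun_diff [bfun_intros]: "bfun S u \<Longrightarrow> bfun S v \<Longrightarrow> bfun S (\<lambda>x. u x - v x)"
  using bfun_add[OF _ bfun_minus] by fastforce

lemma bfun_abs [bfun_intros]: "bfun S u \<Longrightarrow> bfun S (\<lambda>x. \<bar>u x\<bar>)"
  by (auto simp: bfun_def)

lemma bfun_power [bfun_intros]: "bfun S u \<Longrightarrow> bfun S (\<lambda>x. u x ^ n)"
  by (induction n) (auto intro: bfun_intros)

lemma bfun_sum [bfun_intros]:
  "(\<And>i. i \<in> I \<Longrightarrow> bfun S (u i)) \<Longrightarrow> bfun S (\<lambda>x. \<Sum>i\<in>I. u i x)"
  by (induction I rule: infinite_finite_induct) (auto intro: bfun_intros)

lemma bfun_indicator [bfun_intros]: "bfun S (indicator A)"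
  by (rule bfunI[of _ _ 1]) (simp add: indicator_def)

lemma bfun_comp: "bfun S u \<Longrightarrow> (\<And>x. x \<in> T \<Longrightarrow> f x \<in> S) \<Longrightarrow> bfun T (\<lambda>x. u (f x))"
  by (auto simp: bfun_def)

text \<open>A finitely additive probability integral. \<open>M\<close> is defined on all functions
  of the type, but the axioms constrain it only on functions bounded on \<open>S\<close>; the lemma
  \<open>cong\<close> shows that values outside \<open>S\<close> do not matter there.\<close>

locale mean =
  fixes S :: "'x set" and M :: "('x \<Rightarrow> real) \<Rightarrow> real"
  assumes add: "bfun S u \<Longrightarrow> bfun S v \<Longrightarrow> M (\<lambda>x. u x + v x) = M u + M v"
    and scale: "bfun S u \<Longrightarrow> M (\<lambda>x. c * u x) = c * M u"
    and nonneg: "bfun S u \<Longrightarrow> (\<And>x. x \<in> S \<Longrightarrow> u x \<ge> 0) \<Longrightarrow> M u \<ge> 0"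
    and one: "M (\<lambda>_. 1) = 1"
begin

lemma const [simp]: "M (\<lambda>_. c) = c"
  using scale[of "\<lambda>_. 1" c] one by simp

lemma minus: "bfun S u \<Longrightarrow> M (\<lambda>x. - u x) = - M u"
  using scale[of u "- 1"] by simp

lemma diff: "bfun S u \<Longrightarrow> bfun S v \<Longrightarrow> M (\<lambda>x. u x - v x) = M u - M v"
  using add[of u "\<lambda>x. - v x"] by (simp add: minus bfun_intros)

lemma mono:
  assumes "bfun S u" "bfun S v" "\<And>x. x \<in> S \<Longrightarrow> u x \<le> v x"
  shows "M u \<le> M v"
proof -
  have "M (\<lambda>x. v x - u x) \<ge> 0"
    using assms by (intro nonneg bfun_intros) auto
  then show ?thesis
    using assms by (simp add: diff)
qed

lemma cong:
  assumes "bfun S u" "\<And>x. x \<in> S \<Longrightarrow> u x = v x"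
  shows "M u = M v"
proof -
  have "bfun S v"
    using assms by (auto simp: bfun_def)
  then show ?thesis
    using assms by (intro antisym mono) auto
qed

lemma abs_le:
  assumes "bfun S u"
  shows "\<bar>M u\<bar> \<le> M (\<lambda>x. \<bar>u x\<bar>)"
proof -
  have "M u \<le> M (\<lambda>x. \<bar>u x\<bar>)" "M (\<lambda>x. - u x) \<le> M (\<lambda>x. \<bar>u x\<bar>)"
    using assms by (auto intro!: mono bfun_intros)
  then show ?thesis
    using minus[OF assms] by linarith
qed

lemma le_const: "bfun S u \<Longrightarrow> (\<And>x. x \<in> S \<Longrightarrow> u x \<le> c) \<Longrightarrow> M u \<le> c"
  using mono[of u "\<lambda>_. c"] by simp

lemma ge_const: "bfun S u \<Longrightarrow> (\<And>x. x \<in> S \<Longrightarrow> c \<le> u x) \<Longrightarrow> c \<le> M u"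
  using mono[of "\<lambda>_. c" u] by simp

lemma abs_le_const:
  assumes "\<And>x. x \<in> S \<Longrightarrow> \<bar>u x\<bar> \<le> c"
  shows "\<bar>M u\<bar> \<le> c"
proof -
  have b: "bfun S u"
    using assms by (rule bfunI)
  have "M u \<le> c" "- c \<le> M u"
    using assms b by (auto intro!: le_const ge_const simp: abs_le_iff) (metis abs_le_iff minus_le_iff)
  then show ?thesis
    by linarith
qed

lemma ex_le:
  assumes "bfun S u" "M u < c"
  shows "\<exists>x\<in>S. u x < c"
  using ge_const[OF assms(1), of c] assms(2) by force

lemma sum:
  assumes "\<And>i. i \<in> I \<Longrightarrow> bfun S (u i)"
  shows "M (\<lambda>x. \<Sum>i\<in>I. u i x) = (\<Sum>i\<in>I. M (u i))"
  using assms by (induction I rule: infinite_finite_induct) (auto simp: add bfun_intros)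

section \<open>The semi-inner product of a mean and its seminorm\<close>

definition ip :: "('x \<Rightarrow> real) \<Rightarrow> ('x \<Rightarrow> real) \<Rightarrow> real" where
  "ip u v = M (\<lambda>x. u x * v x)"

definition nrm :: "('x \<Rightarrow> real) \<Rightarrow> real" where
  "nrm u = sqrt (ip u u)"

lemma ip_commute: "ip u v = ip v u"
  by (simp add: ip_def mult.commute)

lemma ip_add_left: "bfun S u \<Longrightarrow> bfun S v \<Longrightarrow> bfun S w \<Longrightarrow> ip (\<lambda>x. u x + v x) w = ip u w + ip v w"
  unfolding ip_def by (simp add: distrib_right add bfun_intros)

lemma ip_diff_left: "bfun S u \<Longrightarrow> bfun S v \<Longrightarrow> bfun S w \<Longrightarrow> ip (\<lambda>x. u x - v x) w = ip u w - ip v w"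
  unfolding ip_def by (simp add: left_diff_distrib diff bfun_intros)

lemma ip_scale_left: "bfun S u \<Longrightarrow> bfun S w \<Longrightarrow> ip (\<lambda>x. c * u x) w = c * ip u w"
  unfolding ip_def by (simp add: mult.assoc scale bfun_intros)

lemma ip_minus_left: "bfun S u \<Longrightarrow> bfun S w \<Longrightarrow> ip (\<lambda>x. - u x) w = - ip u w"
  unfolding ip_def by (simp add: minus bfun_intros)

lemma ip_sum_left:
  "(\<And>i. i \<in> I \<Longrightarrow> bfun S (u i)) \<Longrightarrow> bfun S w \<Longrightarrow> ip (\<lambda>x. \<Sum>i\<in>I. u i x) w = (\<Sum>i\<in>I. ip (u i) w)"
  unfolding ip_def by (simp add: sum_distrib_right sum bfun_intros)

lemma ip_add_right: "bfun S u \<Longrightarrow> bfun S v \<Longrightarrow> bfun S w \<Longrightarrow> ip w (\<lambda>x. u x + v x) = ip w u + ip w v"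
  using ip_add_left ip_commute by metis

lemma ip_diff_right: "bfun S u \<Longrightarrow> bfun S v \<Longrightarrow> bfun S w \<Longrightarrow> ip w (\<lambda>x. u x - v x) = ip w u - ip w v"
  using ip_diff_left ip_commute by metis

lemma ip_scale_right: "bfun S u \<Longrightarrow> bfun S w \<Longrightarrow> ip w (\<lambda>x. c * u x) = c * ip w u"
  using ip_scale_left ip_commute by metis

lemma ip_sum_right:
  "(\<And>i. i \<in> I \<Longrightarrow> bfun S (u i)) \<Longrightarrow> bfun S w \<Longrightarrow> ip w (\<lambda>x. \<Sum>i\<in>I. u i x) = (\<Sum>i\<in>I. ip w (u i))"
  unfolding ip_def by (simp add: sum_distrib_left sum bfun_intros)

lemmas ip_simps = ip_add_left ip_add_right ip_diff_left ip_diff_right ip_scale_left ip_scale_right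

lemma ip_self_nonneg: "bfun S u \<Longrightarrow> ip u u \<ge> 0"
  unfolding ip_def by (intro nonneg bfun_intros) auto

lemma ip_bound:
  assumes "\<And>x. x \<in> S \<Longrightarrow> \<bar>u x\<bar> \<le> a" "\<And>x. x \<in> S \<Longrightarrow> \<bar>v x\<bar> \<le> b" "a \<ge> 0"
  shows "\<bar>ip u v\<bar> \<le> a * b"
  unfolding ip_def using assms by (intro abs_le_const) (simp add: abs_mult mult_mono)

lemma ip_mono_abs:
  assumes "bfun S u" "bfun S v" "\<And>x. x \<in> S \<Longrightarrow> \<bar>v x\<bar> \<le> c"
  shows "\<bar>ip u v\<bar> \<le> M (\<lambda>x. \<bar>u x\<bar>) * c"
proof -
  have "\<bar>ip u v\<bar> \<le> M (\<lambda>x. \<bar>u x * v x\<bar>)"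
    unfolding ip_def using assms by (intro abs_le bfun_intros)
  also have "\<dots> \<le> M (\<lambda>x. c * \<bar>u x\<bar>)"
    using assms by (intro mono bfun_intros) (auto simp: abs_mult mult.commute[of c] intro!: mult_left_mono)
  finally show ?thesis
    using assms by (simp add: scale bfun_intros mult.commute)
qed

lemma nrm_nonneg [simp]: "bfun S u \<Longrightarrow> nrm u \<ge> 0"
  by (simp add: nrm_def ip_self_nonneg)

lemma nrm_sq: "bfun S u \<Longrightarrow> (nrm u)\<^sup>2 = ip u u"
  by (simp add: nrm_def ip_self_nonneg)

lemma cauchy_schwarz_sq:
  assumes "bfun S u" "bfun S v"
  shows "(ip u v)\<^sup>2 \<le> ip u u * ip v v"
proof -
  have q: "ip u u - 2 * t * ip u v + t\<^sup>2 * ip v v \<ge> 0" for t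
  proof -
    have "0 \<le> ip (\<lambda>x. u x - t * v x) (\<lambda>x. u x - t * v x)"
      using assms by (intro ip_self_nonneg bfun_intros)
    also have "\<dots> = ip u u - 2 * t * ip u v + t\<^sup>2 * ip v v"
      using assms
      by (simp add: ip_diff_left ip_diff_right ip_scale_left ip_scale_right bfun_intros
          ip_commute[of v u] power2_eq_square algebra_simps)
    finally show ?thesis .
  qed
  show ?thesis
  proof (cases "ip v v = 0")
    case True
    \<comment> \<open>The form is only semidefinite, so this case does occur for nonzero v. The
      expression \<open>q\<close> is then linear in t, and the chosen t makes it equal to
      -1.\<close>
    have "ip u v = 0"
    proof (rule ccontr)
      assume "ip u v \<noteq> 0"
      then show False
        using q[of "(ip u u + 1) / (2 * ip u v)"] True by (simp add: field_simps)
    qed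
    then show ?thesis
      using True by simp
  next
    case False
    then have pos: "ip v v > 0"
      using ip_self_nonneg[OF assms(2)] by simp
    have "ip u u - (ip u v)\<^sup>2 / ip v v \<ge> 0"
      using q[of "ip u v / ip v v"] pos by (simp add: power2_eq_square field_simps)
    then show ?thesis
      using pos by (simp add: field_simps)
  qed
qed

lemma cauchy_schwarz: "bfun S u \<Longrightarrow> bfun S v \<Longrightarrow> \<bar>ip u v\<bar> \<le> nrm u * nrm v"
  using cauchy_schwarz_sq[of u v] unfolding nrm_def
  by (metis real_sqrt_abs real_sqrt_le_mono real_sqrt_mult)

lemma nrm_triangle:
  assumes "bfun S u" "bfun S v"
  shows "nrm (\<lambda>x. u x + v x) \<le> nrm u + nrm v"
proof (rule power2_le_imp_le)
  have "(nrm (\<lambda>x. u x + v x))\<^sup>2 = (nrm u)\<^sup>2 + 2 * ip u v + (nrm v)\<^sup>2"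
    using assms by (simp add: nrm_sq ip_simps bfun_intros ip_commute[of v u])
  also have "\<dots> \<le> (nrm u + nrm v)\<^sup>2"
    using cauchy_schwarz[OF assms] by (simp add: power2_sum)
  finally show "(nrm (\<lambda>x. u x + v x))\<^sup>2 \<le> (nrm u + nrm v)\<^sup>2" .
qed (use assms in auto)

lemma nrm_scale: "bfun S u \<Longrightarrow> nrm (\<lambda>x. c * u x) = \<bar>c\<bar> * nrm u"
  unfolding nrm_def by (simp add: ip_simps bfun_intros real_sqrt_mult real_sqrt_abs2 flip: mult.assoc)

lemma mean_abs_le_nrm:
  assumes "bfun S u"
  shows "M (\<lambda>x. \<bar>u x\<bar>) \<le> nrm u"
proof -
  have "\<bar>ip (\<lambda>x. \<bar>u x\<bar>) (\<lambda>_. 1)\<bar> \<le> nrm (\<lambda>x. \<bar>u x\<bar>) * nrm (\<lambda>_. 1)"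
    using assms by (intro cauchy_schwarz bfun_intros)
  then show ?thesis
    by (simp add: ip_def nrm_def)
qed

text \<open>Pair b with \<open>s\<close>, the combination of the \<open>e i\<close> with
  coefficients \<open>q i = ip (e i) b\<close>. Then \<open>ip s b\<close> is the sum Q to be
  bounded, expanding \<open>ip s s\<close> gives at most Q times the factor on the right, and
  Cauchy-Schwarz lets one factor Q cancel.\<close>

lemma almost_bessel:
  fixes R \<rho> :: real
  assumes "finite I" "\<And>i. i \<in> I \<Longrightarrow> bfun S (e i)" "bfun S b"
    and diag: "\<And>i. i \<in> I \<Longrightarrow> ip (e i) (e i) \<le> R"
    and off: "\<And>i j. i \<in> I \<Longrightarrow> j \<in> I \<Longrightarrow> i \<noteq> j \<Longrightarrow> \<bar>ip (e i) (e j)\<bar> \<le> \<rho>"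
    and "R \<ge> 0" "\<rho> \<ge> 0"
  shows "(\<Sum>i\<in>I. (ip (e i) b)\<^sup>2) \<le> ip b b * (R + card I * \<rho>)"
proof -
  define q where "q i = ip (e i) b" for i
  define Q where "Q = (\<Sum>i\<in>I. (q i)\<^sup>2)"
  define s where "s = (\<lambda>x. \<Sum>i\<in>I. q i * e i x)"
  have bs: "bfun S s"
    unfolding s_def using assms by (intro bfun_intros) auto
  have "ip s b = Q"
    unfolding s_def Q_def using assms
    by (simp add: ip_sum_left bfun_intros ip_scale_left q_def power2_eq_square)
  have qq: "\<bar>q i * q j\<bar> \<le> ((q i)\<^sup>2 + (q j)\<^sup>2) / 2" for i j
    using sum_squares_ge_zero[of "\<bar>q i\<bar> - \<bar>q j\<bar>" 0]
    by (simp add: abs_mult power2_eq_square algebra_simps)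
  have "ip s s = (\<Sum>i\<in>I. \<Sum>j\<in>I. q i * q j * ip (e i) (e j))"
  proof -
    have "ip s s = (\<Sum>i\<in>I. q i * ip (e i) s)"
      using assms bs ip_sum_left[of I "\<lambda>i x. q i * e i x" s]
      by (simp add: ip_scale_left bfun_intros flip: s_def)
    also have "\<dots> = (\<Sum>i\<in>I. q i * (\<Sum>j\<in>I. q j * ip (e i) (e j)))"
      unfolding s_def using assms
      by (intro sum.cong refl) (simp add: ip_sum_right ip_scale_right bfun_intros)
    finally show ?thesis
      by (simp add: sum_distrib_left mult.assoc)
  qed
  \<comment> \<open>The \<open>\<rho>\<close> term is kept on the diagonal too, so that the double
    sum evaluates to \<open>card I * \<rho> * Q\<close> without excluding i = j.\<close>
  also have "\<dots> \<le> (\<Sum>i\<in>I. \<Sum>j\<in>I. (if i = j then R * (q i)\<^sup>2 else 0) + ((q i)\<^sup>2 + (q j)\<^sup>2) / 2 * \<rho>)"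
  proof (intro sum_mono)
    fix i j assume ij: "i \<in> I" "j \<in> I"
    show "q i * q j * ip (e i) (e j) \<le> (if i = j then R * (q i)\<^sup>2 else 0) + ((q i)\<^sup>2 + (q j)\<^sup>2) / 2 * \<rho>"
    proof (cases "i = j")
      case True
      then show ?thesis
        using diag[OF ij(1)] \<open>\<rho> \<ge> 0\<close> mult_left_mono[OF diag[OF ij(1)], of "(q i)\<^sup>2"]
        by (simp add: power2_eq_square mult.commute add_increasing2)
    next
      case False
      have "q i * q j * ip (e i) (e j) \<le> \<bar>q i * q j\<bar> * \<bar>ip (e i) (e j)\<bar>"
        by (metis abs_ge_self abs_mult)
      also have "\<dots> \<le> ((q i)\<^sup>2 + (q j)\<^sup>2) / 2 * \<rho>"
        using qq off[OF ij False] by (intro mult_mono) auto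
      finally show ?thesis
        using False by simp
    qed
  qed
  also have "\<dots> = R * Q + card I * \<rho> * Q"
    using \<open>finite I\<close>
    by (simp add: sum.distrib Q_def sum_distrib_left sum_divide_distrib[symmetric]
        sum_distrib_right[symmetric] algebra_simps)
  finally have ss: "ip s s \<le> Q * (R + card I * \<rho>)"
    by (simp add: algebra_simps)
  have "Q * Q \<le> Q * ((R + card I * \<rho>) * ip b b)"
  proof -
    have "Q * Q \<le> ip s s * ip b b"
      using cauchy_schwarz_sq[OF bs assms(3)] \<open>ip s b = Q\<close> by (simp add: power2_eq_square)
    also have "\<dots> \<le> (Q * (R + card I * \<rho>)) * ip b b"
      using ss ip_self_nonneg[OF assms(3)] by (intro mult_right_mono) auto
    finally show ?thesis
      by (simp add: mult_ac)
  qed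
  moreover have "Q \<ge> 0"
    unfolding Q_def by (intro sum_nonneg) auto
  moreover have "0 \<le> (R + card I * \<rho>) * ip b b"
    using assms ip_self_nonneg[OF assms(3)] by auto
  ultimately have "Q \<le> (R + card I * \<rho>) * ip b b"
    by (cases "Q = 0") (auto simp: mult_le_cancel_left)
  then show ?thesis
    by (simp add: Q_def q_def mult.commute)
qed

text \<open>An approximate Riesz representation; it avoids completing the space.\<close>

lemma riesz_approx:
  assumes \<psi>_add: "\<And>u v. bfun S u \<Longrightarrow> bfun S v \<Longrightarrow> \<psi> (\<lambda>x. u x + v x) = \<psi> u + \<psi> v"
    and \<psi>_scale: "\<And>c u. bfun S u \<Longrightarrow> \<psi> (\<lambda>x. c * u x) = c * \<psi> u"
    and \<psi>_bd: "\<And>u. bfun S u \<Longrightarrow> \<bar>\<psi> u\<bar> \<le> B * nrm u"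
    and "\<beta> > 0"
  obtains v where "bfun S v" "\<And>u. bfun S u \<Longrightarrow> \<bar>\<psi> u - ip v u\<bar> \<le> \<beta> * nrm u"
proof -
  \<comment> \<open>An exact maximiser of this concave functional would be the Riesz representative
    of \<open>\<psi>\<close>. A near-maximiser is enough: perturbing it in direction u changes
    \<open>J\<close> to first order by \<open>\<psi> u - ip v u\<close>, which must therefore be
    small.\<close>
  define J where "J v = \<psi> v - ip v v / 2" for v
  define X where "X = J ` {v. bfun S v}"
  have bd: "bdd_above X"
  proof (rule bdd_aboveI)
    fix y assume "y \<in> X"
    then obtain v where v: "bfun S v" "y = J v"
      by (auto simp: X_def)
    have "J v \<le> B * nrm v - (nrm v)\<^sup>2 / 2"
      using \<psi>_bd[OF v(1)] nrm_sq[OF v(1)] by (simp add: J_def)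
    also have "\<dots> \<le> B\<^sup>2 / 2"
      using zero_le_power2[of "B - nrm v"] by (simp add: power2_eq_square algebra_simps)
    finally show "y \<le> B\<^sup>2 / 2"
      using v by simp
  qed
  have ne: "X \<noteq> {}"
    unfolding X_def using bfun_const[of S 0] by blast
  have "\<exists>y\<in>X. Sup X - \<beta>\<^sup>2 / 2 < y"
    using less_cSup_iff[OF ne bd, of "Sup X - \<beta>\<^sup>2 / 2"] \<open>\<beta> > 0\<close> by auto
  then obtain v where v: "bfun S v" "Sup X - \<beta>\<^sup>2 / 2 < J v"
    by (auto simp: X_def)
  have key: "t * (\<psi> u - ip v u) \<le> \<beta>\<^sup>2 / 2 + t\<^sup>2 * (nrm u)\<^sup>2 / 2" if u: "bfun S u" for u t
  proof -
    have "J (\<lambda>x. v x + t * u x) \<le> Sup X"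
      using u v bd by (intro cSup_upper) (auto simp: X_def intro!: bfun_intros)
    then have "J (\<lambda>x. v x + t * u x) \<le> J v + \<beta>\<^sup>2 / 2"
      using v(2) by linarith
    moreover have "J (\<lambda>x. v x + t * u x) = J v + t * (\<psi> u - ip v u) - t\<^sup>2 * (nrm u)\<^sup>2 / 2"
      using u v
      by (simp add: J_def \<psi>_add \<psi>_scale ip_simps bfun_intros nrm_sq ip_commute[of u v])
        (simp add: algebra_simps power2_eq_square)
    ultimately show ?thesis
      by linarith
  qed
  have "\<bar>\<psi> u - ip v u\<bar> \<le> \<beta> * nrm u" if u: "bfun S u" for u
  proof (rule ccontr)
    assume neg: "\<not> ?thesis"
    define z where "z = \<psi> u - ip v u"
    have z: "\<bar>z\<bar> > \<beta> * nrm u"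
      using neg by (simp add: z_def)
    then have "z \<noteq> 0"
      using nrm_nonneg[OF u] \<open>\<beta> > 0\<close> by (auto simp: mult_less_0_iff)
    \<comment> \<open>The perturbation size \<open>\<beta>\<^sup>2 / z\<close> matches the slack
      \<open>\<beta>\<^sup>2 / 2\<close> in the choice of v: half of the left side absorbs the
      slack, and what remains is \<open>z\<^sup>2 \<le> (\<beta> * nrm u)\<^sup>2\<close>.\<close>
    show False
      using key[OF u, of "\<beta>\<^sup>2 / z"] z \<open>z \<noteq> 0\<close> \<open>\<beta> > 0\<close>
    proof -
      have "\<beta>\<^sup>2 \<le> \<beta>\<^sup>2 / 2 + (\<beta>\<^sup>2 / z)\<^sup>2 * (nrm u)\<^sup>2 / 2"
        using key[OF u, of "\<beta>\<^sup>2 / z"] \<open>z \<noteq> 0\<close> unfolding z_def[symmetric] by simp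
      then have "\<beta>\<^sup>2 * z\<^sup>2 \<le> (\<beta>\<^sup>2)\<^sup>2 * (nrm u)\<^sup>2"
        using \<open>z \<noteq> 0\<close> by (simp add: power_divide field_simps)
      then have "z\<^sup>2 \<le> (\<beta> * nrm u)\<^sup>2"
        using \<open>\<beta> > 0\<close> by (simp add: power2_eq_square mult_ac)
      moreover have "(\<beta> * nrm u)\<^sup>2 < z\<^sup>2"
        using power_strict_mono[OF z, of 2] nrm_nonneg[OF u] \<open>\<beta> > 0\<close> by simp
      ultimately show False
        by simp
    qed
  qed
  then show ?thesis
    using that v(1) by blast
qed

end

text \<open>Finitely additive means need not satisfy Fubini, so this product is tied to one order of
  integration. The inner mean of a bounded function is bounded by the same constant, which makes the
  outer mean applicable.\<close>

lemma mean_product: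
  assumes "mean S M" "mean S' M'"
  shows "mean (S \<times> S') (\<lambda>u. M (\<lambda>x. M' (\<lambda>y. u (x, y))))"
proof -
  interpret A: mean S M by fact
  interpret B: mean S' M' by fact
  have sec: "bfun S' (\<lambda>y. u (x, y))" if "bfun (S \<times> S') u" "x \<in> S" for u x
    using that by (auto simp: bfun_def)
  have marg: "bfun S (\<lambda>x. M' (\<lambda>y. u (x, y)))" if u: "bfun (S \<times> S') u" for u
  proof -
    obtain C where "\<And>z. z \<in> S \<times> S' \<Longrightarrow> \<bar>u z\<bar> \<le> C"
      using u unfolding bfun_def by blast
    then show ?thesis
      by (intro bfunI[of _ _ C] B.abs_le_const) auto
  qed
  show ?thesis
  proof
    fix u v :: "'a \<times> 'b \<Rightarrow> real" assume uv: "bfun (S \<times> S') u" "bfun (S \<times> S') v"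
    show "M (\<lambda>x. M' (\<lambda>y. u (x, y) + v (x, y))) = M (\<lambda>x. M' (\<lambda>y. u (x, y))) + M (\<lambda>x. M' (\<lambda>y. v (x, y)))"
    proof -
      have "M (\<lambda>x. M' (\<lambda>y. u (x, y) + v (x, y))) = M (\<lambda>x. M' (\<lambda>y. u (x, y)) + M' (\<lambda>y. v (x, y)))"
        using marg[OF bfun_add[OF uv]] by (rule A.cong) (simp add: B.add sec uv)
      then show ?thesis
        by (simp add: A.add marg uv)
    qed
  next
    fix u :: "'a \<times> 'b \<Rightarrow> real" and c assume u: "bfun (S \<times> S') u"
    have "M (\<lambda>x. M' (\<lambda>y. c * u (x, y))) = M (\<lambda>x. c * M' (\<lambda>y. u (x, y)))"
      using marg[OF bfun_mult[OF bfun_const u]] by (rule A.cong) (simp add: B.scale sec u)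
    then show "M (\<lambda>x. M' (\<lambda>y. c * u (x, y))) = c * M (\<lambda>x. M' (\<lambda>y. u (x, y)))"
      by (simp add: A.scale marg u)
  next
    fix u :: "'a \<times> 'b \<Rightarrow> real" assume u: "bfun (S \<times> S') u" "\<And>z. z \<in> S \<times> S' \<Longrightarrow> 0 \<le> u z"
    then show "0 \<le> M (\<lambda>x. M' (\<lambda>y. u (x, y)))"
      by (intro A.nonneg B.nonneg marg sec) auto
  qed simp
qed

section \<open>Precompact invariant pseudometrics\<close>

lemma finite_image_representatives:
  assumes "finite (g ` C)"
  obtains F where "finite F" "F \<subseteq> C" "\<And>x. x \<in> C \<Longrightarrow> \<exists>y\<in>F. g y = g x"
proof -
  obtain F where "F \<subseteq> C" "finite F" "g ` C = g ` F"
    using finite_subset_image[OF assms subset_refl] by blast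
  then show ?thesis
    using that by (metis imageE image_eqI)
qed

text \<open>Round every value \<open>q z x\<close> down to a multiple of \<open>\<rho>\<close>.
  Boundedness leaves finitely many rounding patterns over the finite set Z, and F takes one point
  for each pattern that occurs.\<close>

lemma finite_net_of_bounded_functions:
  fixes q :: "'i \<Rightarrow> 'a \<Rightarrow> real"
  assumes "finite Z" "\<And>z. z \<in> Z \<Longrightarrow> bfun C (q z)" "\<rho> > 0"
  obtains F where "finite F" "F \<subseteq> C" "\<And>x. x \<in> C \<Longrightarrow> \<exists>y\<in>F. \<forall>z\<in>Z. \<bar>q z x - q z y\<bar> \<le> \<rho>"
proof -
  define g where "g x = restrict (\<lambda>z. \<lfloor>q z x / \<rho>\<rfloor>) Z" for x
  have "\<exists>B. \<forall>z\<in>Z. \<forall>x\<in>C. \<bar>q z x\<bar> \<le> B z"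
    using assms(2) unfolding bfun_def by metis
  then obtain B where B: "\<And>z x. z \<in> Z \<Longrightarrow> x \<in> C \<Longrightarrow> \<bar>q z x\<bar> \<le> B z"
    by blast
  have "g ` C \<subseteq> PiE Z (\<lambda>z. {\<lfloor>- B z / \<rho>\<rfloor>..\<lfloor>B z / \<rho>\<rfloor>})"
  proof (intro image_subsetI PiE_I)
    fix x z assume "x \<in> C" "z \<in> Z"
    then have "- B z \<le> q z x" "q z x \<le> B z"
      using B[of z x] by (auto simp: abs_le_iff)
    then have "- B z / \<rho> \<le> q z x / \<rho>" "q z x / \<rho> \<le> B z / \<rho>"
      using \<open>\<rho> > 0\<close> by (intro divide_right_mono; simp)+
    then show "g x z \<in> {\<lfloor>- B z / \<rho>\<rfloor>..\<lfloor>B z / \<rho>\<rfloor>}"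
      using \<open>z \<in> Z\<close> by (simp add: g_def floor_mono)
  qed (simp add: g_def)
  moreover have "finite (PiE Z (\<lambda>z. {\<lfloor>- B z / \<rho>\<rfloor>..\<lfloor>B z / \<rho>\<rfloor>}))"
    using \<open>finite Z\<close> by (intro finite_PiE) auto
  ultimately have "finite (g ` C)"
    by (rule finite_subset)
  then obtain F where F: "finite F" "F \<subseteq> C" "\<And>x. x \<in> C \<Longrightarrow> \<exists>y\<in>F. g y = g x"
    by (rule finite_image_representatives) blast
  have "\<bar>q z x - q z y\<bar> \<le> \<rho>" if "g y = g x" "z \<in> Z" for x y z
  proof -
    have "\<lfloor>q z x / \<rho>\<rfloor> = \<lfloor>q z y / \<rho>\<rfloor>"
      using that by (metis g_def restrict_apply)
    then have "\<bar>q z x / \<rho> - q z y / \<rho>\<bar> \<le> 1"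
      by linarith
    then show ?thesis
      using \<open>\<rho> > 0\<close> by (simp add: diff_divide_distrib[symmetric] divide_le_eq)
  qed
  then show ?thesis
    using that[OF F(1,2)] F(3) by (metis (full_types))
qed

text \<open>Used to pick almost orthogonal vectors one after the other. Only n terms are built, so
  the hypothesis needs to cover only sets of at most n earlier choices.\<close>

lemma greedy_sequence:
  assumes "\<And>Z. finite Z \<Longrightarrow> card Z \<le> n \<Longrightarrow> Z \<subseteq> X \<Longrightarrow> \<exists>x\<in>X. \<forall>z\<in>Z. P x z"
  shows "\<exists>e. \<forall>i<n. e i \<in> X \<and> (\<forall>j<i. P (e i) (e j))"
proof -
  have "\<exists>e. \<forall>i<m. e i \<in> X \<and> (\<forall>j<i. P (e i) (e j))" if "m \<le> n" for m
    using that
  proof (induction m)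
    case (Suc m)
    then obtain e where e: "\<And>i. i < m \<Longrightarrow> e i \<in> X" "\<And>i j. i < m \<Longrightarrow> j < i \<Longrightarrow> P (e i) (e j)"
      by auto
    have "card (e ` {..<m}) \<le> n"
      using card_image_le[of "{..<m}" e] Suc.prems by simp
    then obtain x where x: "x \<in> X" "\<forall>z\<in>e ` {..<m}. P x z"
      using assms[of "e ` {..<m}"] e(1) by auto
    have "\<forall>i<Suc m. (e(m := x)) i \<in> X \<and> (\<forall>j<i. P ((e(m := x)) i) ((e(m := x)) j))"
      using e x by (auto simp: less_Suc_eq)
    then show ?case
      by blast
  qed auto
  then show ?thesis
    by blast
qed

definition precompact_pm :: "('a, 'm) monoid_scheme \<Rightarrow> ('a \<Rightarrow> 'a \<Rightarrow> real) \<Rightarrow> bool" where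
  "precompact_pm G d \<longleftrightarrow>
     (\<forall>x\<in>carrier G. \<forall>y\<in>carrier G. d x y \<ge> 0 \<and> d x y = d y x) \<and>
     (\<forall>x\<in>carrier G. d x x = 0) \<and>
     (\<forall>x\<in>carrier G. \<forall>y\<in>carrier G. \<forall>z\<in>carrier G. d x z \<le> d x y + d y z) \<and>
     (\<forall>x\<in>carrier G. \<forall>y\<in>carrier G. \<forall>z\<in>carrier G. d (z \<otimes>\<^bsub>G\<^esub> x) (z \<otimes>\<^bsub>G\<^esub> y) = d x y) \<and>
     (\<forall>\<epsilon>>0. \<exists>F. finite F \<and> F \<subseteq> carrier G \<and> (\<forall>x\<in>carrier G. \<exists>y\<in>F. d x y \<le> \<epsilon>))"

text \<open>Invariance on both sides makes multiplication and inversion Lipschitz for d, which is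
  what carries the group operations over to the completion.\<close>

definition bi_precompact_pm :: "('a, 'm) monoid_scheme \<Rightarrow> ('a \<Rightarrow> 'a \<Rightarrow> real) \<Rightarrow> bool" where
  "bi_precompact_pm G d \<longleftrightarrow> precompact_pm G d \<and>
     (\<forall>x\<in>carrier G. \<forall>y\<in>carrier G. \<forall>z\<in>carrier G. d (x \<otimes>\<^bsub>G\<^esub> z) (y \<otimes>\<^bsub>G\<^esub> z) = d x y)"

context
  fixes G (structure) and d
  assumes pm: "precompact_pm G d"
begin

lemma pm_nonneg: "x \<in> carrier G \<Longrightarrow> y \<in> carrier G \<Longrightarrow> d x y \<ge> 0"
  using pm by (simp add: precompact_pm_def)

lemma pm_sym: "x \<in> carrier G \<Longrightarrow> y \<in> carrier G \<Longrightarrow> d x y = d y x"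
  using pm unfolding precompact_pm_def by blast

lemma pm_refl: "x \<in> carrier G \<Longrightarrow> d x x = 0"
  using pm by (simp add: precompact_pm_def)

lemma pm_triangle:
  "x \<in> carrier G \<Longrightarrow> y \<in> carrier G \<Longrightarrow> z \<in> carrier G \<Longrightarrow> d x z \<le> d x y + d y z"
  using pm by (simp add: precompact_pm_def)

lemma pm_left:
  "x \<in> carrier G \<Longrightarrow> y \<in> carrier G \<Longrightarrow> z \<in> carrier G \<Longrightarrow> d (z \<otimes> x) (z \<otimes> y) = d x y"
  using pm by (simp add: precompact_pm_def)

lemma pm_net:
  assumes "\<epsilon> > 0"
  obtains F where "finite F" "F \<subseteq> carrier G" "\<And>x. x \<in> carrier G \<Longrightarrow> \<exists>y\<in>F. d x y \<le> \<epsilon>"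
  using pm assms unfolding precompact_pm_def by meson

lemma pm_bounded:
  obtains B where "\<And>x y. x \<in> carrier G \<Longrightarrow> y \<in> carrier G \<Longrightarrow> d x y \<le> B"
proof -
  obtain F where F: "finite F" "F \<subseteq> carrier G" "\<And>x. x \<in> carrier G \<Longrightarrow> \<exists>y\<in>F. d x y \<le> 1"
    using pm_net[of 1] by auto
  define B where "B = (\<Sum>(a, b)\<in>F \<times> F. d a b)"
  have "d x y \<le> 2 + B" if xy: "x \<in> carrier G" "y \<in> carrier G" for x y
  proof -
    obtain a b where ab: "a \<in> F" "b \<in> F" "d x a \<le> 1" "d y b \<le> 1"
      using F(3) xy by meson
    have C: "a \<in> carrier G" "b \<in> carrier G"
      using ab F(2) by auto
    have "(\<lambda>(a, b). d a b) (a, b) \<le> B"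
      unfolding B_def using F ab by (intro member_le_sum) (auto intro!: pm_nonneg)
    then show ?thesis
      using pm_triangle[OF xy(1) C(1) xy(2)] pm_triangle[OF C(1,2) xy(2)] pm_sym[OF C(2) xy(2)] ab
      by simp
  qed
  then show ?thesis
    using that by blast
qed

text \<open>Total boundedness in the form of a finite colouring with cells of small diameter.
  Colourings, unlike nets, can be combined: pairing two of them refines both.\<close>

lemma pm_cells:
  assumes "\<epsilon> > 0"
  shows "\<exists>g :: 'a \<Rightarrow> 'a. finite (g ` carrier G) \<and>
    (\<forall>x\<in>carrier G. \<forall>y\<in>carrier G. g x = g y \<longrightarrow> d x y \<le> \<epsilon>)"
proof -
  obtain F where F: "finite F" "F \<subseteq> carrier G" "\<And>x. x \<in> carrier G \<Longrightarrow> \<exists>y\<in>F. d x y \<le> \<epsilon> / 2"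
    using pm_net[of "\<epsilon> / 2"] assms by auto
  then obtain g where g: "\<And>x. x \<in> carrier G \<Longrightarrow> g x \<in> F \<and> d x (g x) \<le> \<epsilon> / 2"
    by metis
  have "d x y \<le> \<epsilon>" if xy: "x \<in> carrier G" "y \<in> carrier G" "g x = g y" for x y
  proof -
    have "g y \<in> carrier G"
      using g[OF xy(2)] F(2) by auto
    then show ?thesis
      using pm_triangle[OF xy(1) _ xy(2), of "g y"] pm_sym[OF xy(2), of "g y"] g[OF xy(1)] g[OF xy(2)] xy(3)
      by fastforce
  qed
  then show ?thesis
    using g F finite_subset[of "g ` carrier G" F] by blast
qed

end

text \<open>Rescaling allows every neighbourhood to be written as a ball of the fixed radius
  1.\<close>

lemma (in group) bi_precompact_pm_scale:
  assumes "bi_precompact_pm G d" "c > 0"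
  shows "bi_precompact_pm G (\<lambda>x y. c * d x y)"
proof -
  have pm: "precompact_pm G d"
    using assms by (simp add: bi_precompact_pm_def)
  have "\<exists>F. finite F \<and> F \<subseteq> carrier G \<and> (\<forall>x\<in>carrier G. \<exists>y\<in>F. c * d x y \<le> \<epsilon>)" if "\<epsilon> > 0" for \<epsilon>
  proof -
    have "\<epsilon> / c > 0"
      using \<open>c > 0\<close> that by simp
    then obtain F where "finite F" "F \<subseteq> carrier G" "\<And>x. x \<in> carrier G \<Longrightarrow> \<exists>y\<in>F. d x y \<le> \<epsilon> / c"
      by (rule pm_net[OF pm]) blast
    then show ?thesis
      using \<open>c > 0\<close> by (intro exI[of _ F]) (auto simp: field_simps)
  qed
  moreover have "c * d x z \<le> c * d x y + c * d y z"
    if "x \<in> carrier G" "y \<in> carrier G" "z \<in> carrier G" for x y z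
    using pm_triangle[OF pm that] \<open>c > 0\<close> by (simp flip: distrib_left)
  ultimately show ?thesis
    using assms unfolding bi_precompact_pm_def precompact_pm_def by simp
qed

text \<open>Nets for d and d' may have no point in common, so the net is taken from the cells of the
  common refinement of two colourings.\<close>

lemma (in group) bi_precompact_pm_add:
  assumes "bi_precompact_pm G d" "bi_precompact_pm G d'"
  shows "bi_precompact_pm G (\<lambda>x y. d x y + d' x y)"
proof -
  have pm: "precompact_pm G d" "precompact_pm G d'"
    using assms by (simp_all add: bi_precompact_pm_def)
  have "\<exists>F. finite F \<and> F \<subseteq> carrier G \<and> (\<forall>x\<in>carrier G. \<exists>y\<in>F. d x y + d' x y \<le> \<epsilon>)" if "\<epsilon> > 0" for \<epsilon>
  proof -
    have "\<epsilon> / 2 > 0"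
      using that by simp
    obtain g :: "'a \<Rightarrow> 'a" where g: "finite (g ` carrier G)"
      "\<And>x y. x \<in> carrier G \<Longrightarrow> y \<in> carrier G \<Longrightarrow> g x = g y \<Longrightarrow> d x y \<le> \<epsilon> / 2"
      using pm_cells[OF pm(1) \<open>\<epsilon> / 2 > 0\<close>] by blast
    obtain g' :: "'a \<Rightarrow> 'a" where g': "finite (g' ` carrier G)"
      "\<And>x y. x \<in> carrier G \<Longrightarrow> y \<in> carrier G \<Longrightarrow> g' x = g' y \<Longrightarrow> d' x y \<le> \<epsilon> / 2"
      using pm_cells[OF pm(2) \<open>\<epsilon> / 2 > 0\<close>] by blast
    have "finite ((\<lambda>x. (g x, g' x)) ` carrier G)"
      by (rule finite_subset[of _ "g ` carrier G \<times> g' ` carrier G"]) (use g(1) g'(1) in auto)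
    then obtain F where F: "finite F" "F \<subseteq> carrier G"
      "\<And>x. x \<in> carrier G \<Longrightarrow> \<exists>y\<in>F. (g y, g' y) = (g x, g' x)"
      using finite_image_representatives by (metis (no_types, lifting))
    have "\<exists>y\<in>F. d x y + d' x y \<le> \<epsilon>" if x: "x \<in> carrier G" for x
    proof -
      obtain y where "y \<in> F" "g x = g y" "g' x = g' y"
        using F(3)[OF x] by auto
      then show ?thesis
        using g(2)[OF x, of y] g'(2)[OF x, of y] F(2) by (intro bexI[of _ y]) auto
    qed
    then show ?thesis
      using F by blast
  qed
  moreover have "d x z + d' x z \<le> d x y + d' x y + (d y z + d' y z)"
    if "x \<in> carrier G" "y \<in> carrier G" "z \<in> carrier G" for x y z
    using pm_triangle[OF pm(1) that] pm_triangle[OF pm(2) that] by linarith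
  ultimately show ?thesis
    using assms unfolding bi_precompact_pm_def precompact_pm_def by simp
qed

text \<open>Total boundedness survives because it suffices to take the supremum over the points of a
  finite net.\<close>

lemma (in group) bi_precompact_pm_Sup:
  assumes pm: "precompact_pm G d"
  defines "D \<equiv> \<lambda>x y. SUP z\<in>carrier G. d (x \<otimes> z) (y \<otimes> z)"
  shows "bi_precompact_pm G D"
    and "\<And>x y. x \<in> carrier G \<Longrightarrow> y \<in> carrier G \<Longrightarrow> d x y \<le> D x y"
proof -
  obtain B where B: "\<And>x y. x \<in> carrier G \<Longrightarrow> y \<in> carrier G \<Longrightarrow> d x y \<le> B"
    using pm_bounded[OF pm] by blast
  have bdd: "bdd_above ((\<lambda>z. d (x \<otimes> z) (y \<otimes> z)) ` carrier G)"
    if "x \<in> carrier G" "y \<in> carrier G" for x y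
    using B that by (intro bdd_aboveI2[of _ _ B]) auto
  have up: "d (x \<otimes> z) (y \<otimes> z) \<le> D x y" if "x \<in> carrier G" "y \<in> carrier G" "z \<in> carrier G" for x y z
    unfolding D_def using that bdd by (intro cSUP_upper)
  have least: "D x y \<le> c" if "\<And>z. z \<in> carrier G \<Longrightarrow> d (x \<otimes> z) (y \<otimes> z) \<le> c" for x y c
    unfolding D_def using that by (intro cSUP_least) auto
  show dD: "d x y \<le> D x y" if "x \<in> carrier G" "y \<in> carrier G" for x y
    using up[OF that one_closed] that by simp
  have tri: "D x z \<le> D x y + D y z"
    if "x \<in> carrier G" "y \<in> carrier G" "z \<in> carrier G" for x y z
  proof (rule least)
    fix r assume "r \<in> carrier G"
    then show "d (x \<otimes> r) (z \<otimes> r) \<le> D x y + D y z"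
      using pm_triangle[OF pm, of "x \<otimes> r" "y \<otimes> r" "z \<otimes> r"] up[OF that(1,2)] up[OF that(2,3)] that
      by fastforce
  qed
  have left: "D (z \<otimes> x) (z \<otimes> y) = D x y"
    if "x \<in> carrier G" "y \<in> carrier G" "z \<in> carrier G" for x y z
    unfolding D_def using that by (intro SUP_cong) (auto simp: m_assoc pm_left[OF pm])
  have rle: "D (x \<otimes> z) (y \<otimes> z) \<le> D x y"
    if "x \<in> carrier G" "y \<in> carrier G" "z \<in> carrier G" for x y z
    using that up by (intro least) (simp add: m_assoc)
  have right: "D (x \<otimes> z) (y \<otimes> z) = D x y"
    if "x \<in> carrier G" "y \<in> carrier G" "z \<in> carrier G" for x y z
    using rle[OF that] rle[of "x \<otimes> z" "y \<otimes> z" "inv z"] that by (simp add: m_assoc)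
  have net: "\<exists>F. finite F \<and> F \<subseteq> carrier G \<and> (\<forall>x\<in>carrier G. \<exists>y\<in>F. D x y \<le> \<epsilon>)" if "\<epsilon> > 0" for \<epsilon>
  proof -
    have e: "\<epsilon> / 3 > 0"
      using that by simp
    obtain Z where Z: "finite Z" "Z \<subseteq> carrier G" "\<And>x. x \<in> carrier G \<Longrightarrow> \<exists>y\<in>Z. d x y \<le> \<epsilon> / 3"
      using pm_net[OF pm e] by blast
    obtain g :: "'a \<Rightarrow> 'a" where g: "finite (g ` carrier G)"
      "\<And>x y. x \<in> carrier G \<Longrightarrow> y \<in> carrier G \<Longrightarrow> g x = g y \<Longrightarrow> d x y \<le> \<epsilon> / 3"
      using pm_cells[OF pm e] by blast
    \<comment> \<open>Each x is coloured by the cells of its products with the net points z. If x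
      and y agree, an arbitrary r is compared with its nearest z: left invariance turns the
      distances from \<open>x \<otimes> r\<close> to \<open>x \<otimes> z\<close> and from
      \<open>y \<otimes> z\<close> to \<open>y \<otimes> r\<close> into that of r and z, so three
      errors of \<open>\<epsilon> / 3\<close> arise.\<close>
    define h where "h x = restrict (\<lambda>z. g (x \<otimes> z)) Z" for x
    have "h ` carrier G \<subseteq> PiE Z (\<lambda>_. g ` carrier G)"
      using Z(2) by (auto simp: h_def)
    then have "finite (h ` carrier G)"
      by (rule finite_subset) (use Z g in \<open>auto intro!: finite_PiE\<close>)
    then obtain F where F: "finite F" "F \<subseteq> carrier G" "\<And>x. x \<in> carrier G \<Longrightarrow> \<exists>y\<in>F. h y = h x"
      by (rule finite_image_representatives) blast
    have "D x y \<le> \<epsilon>" if xy: "x \<in> carrier G" "y \<in> carrier G" "h y = h x" for x y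
    proof (rule least)
      fix r assume r: "r \<in> carrier G"
      obtain z where z: "z \<in> Z" "d r z \<le> \<epsilon> / 3"
        using Z(3)[OF r] by blast
      have zc: "z \<in> carrier G"
        using z Z by blast
      have "g (x \<otimes> z) = g (y \<otimes> z)"
        using xy(3) z(1) by (metis h_def restrict_apply)
      then have "d (x \<otimes> z) (y \<otimes> z) \<le> \<epsilon> / 3"
        using g(2) xy zc by simp
      moreover have "d (x \<otimes> r) (x \<otimes> z) \<le> \<epsilon> / 3" "d (y \<otimes> z) (y \<otimes> r) \<le> \<epsilon> / 3"
        using z pm_left[OF pm] pm_sym[OF pm r zc] r zc xy by auto
      ultimately show "d (x \<otimes> r) (y \<otimes> r) \<le> \<epsilon>"
        using pm_triangle[OF pm, of "x \<otimes> r" "x \<otimes> z" "y \<otimes> r"]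
          pm_triangle[OF pm, of "x \<otimes> z" "y \<otimes> z" "y \<otimes> r"] xy r zc by simp
    qed
    then show ?thesis
      using F by (meson subsetD)
  qed
  have nonneg: "D x y \<ge> 0" if "x \<in> carrier G" "y \<in> carrier G" for x y
    using dD[OF that] pm_nonneg[OF pm that] by linarith
  have sym: "D x y = D y x" if "x \<in> carrier G" "y \<in> carrier G" for x y
    unfolding D_def using that by (intro SUP_cong refl pm_sym[OF pm] m_closed)
  have refl: "D x x = 0" if "x \<in> carrier G" for x
    using nonneg[OF that that] least[of x x 0] pm_refl[OF pm] that by (simp add: order_antisym)
  show "bi_precompact_pm G D"
    unfolding bi_precompact_pm_def precompact_pm_def
    by (intro conjI ballI allI impI) (rule nonneg sym refl tri left right net; assumption)+
qed

section \<open>Invariant means on groups\<close>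

locale invariant_mean = group G + mean "carrier G" M
  for G (structure) and M +
  assumes invariant: "g \<in> carrier G \<Longrightarrow> bfun (carrier G) u \<Longrightarrow> M (\<lambda>t. u (g \<otimes> t)) = M u"
begin

text \<open>The left regular representation. The inverse makes \<open>tr x (tr y u)\<close> agree
  with \<open>tr (x \<otimes> y) u\<close> on the carrier.\<close>

definition tr :: "'a \<Rightarrow> ('a \<Rightarrow> real) \<Rightarrow> 'a \<Rightarrow> real" where
  "tr x u = (\<lambda>t. u (inv x \<otimes> t))"

abbreviation bf :: "('a \<Rightarrow> real) \<Rightarrow> bool" where
  "bf \<equiv> bfun (carrier G)"

lemma bfun_translate: "x \<in> carrier G \<Longrightarrow> bf u \<Longrightarrow> bf (\<lambda>t. u (x \<otimes> t))"
  by (rule bfun_comp) auto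

lemma bfun_tr [bfun_intros]: "x \<in> carrier G \<Longrightarrow> bf u \<Longrightarrow> bf (tr x u)"
  unfolding tr_def by (intro bfun_translate) auto

lemma ip_cong:
  "bf u \<Longrightarrow> bf v \<Longrightarrow> (\<And>t. t \<in> carrier G \<Longrightarrow> u t = u' t) \<Longrightarrow> (\<And>t. t \<in> carrier G \<Longrightarrow> v t = v' t)
    \<Longrightarrow> ip u v = ip u' v'"
  unfolding ip_def by (rule cong) (auto intro: bfun_intros)

lemma ip_tr: "x \<in> carrier G \<Longrightarrow> bf u \<Longrightarrow> bf v \<Longrightarrow> ip (tr x u) (tr x v) = ip u v"
  unfolding ip_def tr_def using invariant[of "inv x" "\<lambda>t. u t * v t"] by (simp add: bfun_intros)

lemma tr_tr: "x \<in> carrier G \<Longrightarrow> y \<in> carrier G \<Longrightarrow> t \<in> carrier G \<Longrightarrow> tr x (tr y u) t = tr (x \<otimes> y) u t"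
  by (simp add: tr_def inv_mult_group m_assoc)

lemma tr_one [simp]: "t \<in> carrier G \<Longrightarrow> tr \<one> u t = u t"
  by (simp add: tr_def)

lemma ip_tr_adjoint:
  assumes "x \<in> carrier G" "bf u" "bf v"
  shows "ip (tr x u) v = ip u (tr (inv x) v)"
proof -
  have "ip (tr x u) v = ip (tr (inv x) (tr x u)) (tr (inv x) v)"
    using assms by (simp add: ip_tr bfun_intros)
  also have "\<dots> = ip u (tr (inv x) v)"
    using assms by (intro ip_cong bfun_intros) (auto simp: tr_tr)
  finally show ?thesis .
qed

lemma nrm_tr: "x \<in> carrier G \<Longrightarrow> bf u \<Longrightarrow> nrm (tr x u) = nrm u"
  by (simp add: nrm_def ip_tr)

lemma nrm_cong: "bf u \<Longrightarrow> (\<And>t. t \<in> carrier G \<Longrightarrow> u t = v t) \<Longrightarrow> nrm u = nrm v"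
  unfolding nrm_def by (subst ip_cong[of u u v v]) auto

section \<open>Matrix coefficients of translation and the seminorm they define\<close>

definition coef :: "('a \<Rightarrow> real) \<Rightarrow> ('a \<Rightarrow> real) \<Rightarrow> 'a \<Rightarrow> real" where
  "coef w v s = ip v (tr s w)"

lemma coef_bound: "bf w \<Longrightarrow> bf v \<Longrightarrow> s \<in> carrier G \<Longrightarrow> \<bar>coef w v s\<bar> \<le> nrm w * nrm v"
  using cauchy_schwarz[of v "tr s w"] by (simp add: coef_def nrm_tr bfun_intros mult.commute)

lemma bfun_coef [bfun_intros]: "bf w \<Longrightarrow> bf v \<Longrightarrow> bf (coef w v)"
  by (rule bfunI, rule coef_bound)

lemma coef_tr:
  assumes "bf w" "bf v" "x \<in> carrier G" "s \<in> carrier G"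
  shows "coef w (tr x v) s = tr x (coef w v) s"
  unfolding coef_def using assms
  by (simp add: ip_tr_adjoint bfun_intros)
    (simp add: tr_def[of x "\<lambda>s. ip v (tr s w)"], rule ip_cong, auto intro!: bfun_intros simp: tr_tr)

text \<open>The square of \<open>ctn w v\<close> is the quadratic form of the positive operator that
  sends v to the average over s of \<open>ip v (tr s w)\<close> times \<open>tr s w\<close>. A
  vector w with \<open>ctn w w = 0\<close> is weakly mixing: its correlations with its own
  translates vanish in mean square.\<close>

definition ctn :: "('a \<Rightarrow> real) \<Rightarrow> ('a \<Rightarrow> real) \<Rightarrow> real" where
  "ctn w v = nrm (coef w v)"

lemma ctn_nonneg [simp]: "bf w \<Longrightarrow> bf v \<Longrightarrow> ctn w v \<ge> 0"
  by (simp add: ctn_def bfun_intros)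

lemma ctn_cong: "bf w \<Longrightarrow> bf u \<Longrightarrow> (\<And>t. t \<in> carrier G \<Longrightarrow> u t = v t) \<Longrightarrow> ctn w u = ctn w v"
  unfolding ctn_def coef_def
  by (rule nrm_cong) (auto intro!: ip_cong bfun_intros bfun_coef[unfolded coef_def])

lemma ctn_tr: "bf w \<Longrightarrow> bf v \<Longrightarrow> x \<in> carrier G \<Longrightarrow> ctn w (tr x v) = ctn w v"
  unfolding ctn_def using nrm_cong[of "coef w (tr x v)" "tr x (coef w v)"]
  by (simp add: coef_tr bfun_intros nrm_tr)

lemma ctn_triangle:
  assumes "bf w" "bf u" "bf v"
  shows "ctn w (\<lambda>t. u t + v t) \<le> ctn w u + ctn w v"
proof -
  have "ctn w (\<lambda>t. u t + v t) = nrm (\<lambda>s. coef w u s + coef w v s)"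
    unfolding ctn_def using assms
    by (intro nrm_cong bfun_intros) (auto simp: coef_def ip_add_left bfun_intros)
  also have "\<dots> \<le> ctn w u + ctn w v"
    unfolding ctn_def using assms by (intro nrm_triangle bfun_intros)
  finally show ?thesis .
qed

lemma ctn_minus: "bf w \<Longrightarrow> bf u \<Longrightarrow> ctn w (\<lambda>t. - u t) = ctn w u"
  unfolding ctn_def
  using nrm_cong[of "coef w (\<lambda>t. - u t)" "\<lambda>s. (-1) * coef w u s"] nrm_scale[of "coef w u" "-1"]
  by (simp add: coef_def ip_minus_left bfun_intros bfun_coef[unfolded coef_def])

text \<open>Bessel's inequality for the translates of \<open>w\<close>, averaged over the group, bounds the number
  of almost orthogonal vectors on which \<^term>\<open>ctn w\<close> is large.\<close>

lemma ctn_small_off_finite_set: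
  assumes w: "bf w" and "\<epsilon> > 0" "R \<ge> 0"
  shows "\<exists>Z \<rho>. finite Z \<and> (\<forall>z\<in>Z. bf z) \<and> \<rho> > 0 \<and>
    (\<forall>v. bf v \<longrightarrow> ip v v \<le> R \<longrightarrow> (\<forall>z\<in>Z. \<bar>ip v z\<bar> \<le> \<rho>) \<longrightarrow> ctn w v \<le> \<epsilon>)"
proof (rule ccontr)
  assume neg: "\<not> ?thesis"
  \<comment> \<open>N is chosen so that N vectors with \<open>ctn\<close> above
    \<open>\<epsilon>\<close> would exceed the averaged Bessel bound; \<open>\<rho>\<close> is then
    so small that the off-diagonal part \<open>N * \<rho>\<close> costs at most 1, whence
    \<open>R + 1\<close>.\<close>
  obtain N :: nat where N: "ip w w * (R + 1) < N * \<epsilon>\<^sup>2"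
    using reals_Archimedean3[of "\<epsilon>\<^sup>2"] \<open>\<epsilon> > 0\<close> by auto
  define \<rho> where "\<rho> = 1 / (real N + 1)"
  have \<rho>: "\<rho> > 0" "N * \<rho> \<le> 1"
    by (auto simp: \<rho>_def)
  define X where "X = {v. bf v \<and> ip v v \<le> R \<and> ctn w v > \<epsilon>}"
  \<comment> \<open>If no finite Z does the job, every finite part of X leaves a vector of X almost
    orthogonal to it, and a sequence of length N can be chosen greedily.\<close>
  have "\<exists>v\<in>X. \<forall>z\<in>Z. \<bar>ip v z\<bar> \<le> \<rho>" if "finite Z" "Z \<subseteq> X" for Z
  proof (rule ccontr)
    assume "\<not> ?thesis"
    then have "\<forall>v. bf v \<longrightarrow> ip v v \<le> R \<longrightarrow> (\<forall>z\<in>Z. \<bar>ip v z\<bar> \<le> \<rho>) \<longrightarrow> ctn w v \<le> \<epsilon>"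
      by (force simp: X_def)
    moreover have "\<forall>z\<in>Z. bf z"
      using that by (auto simp: X_def)
    ultimately show False
      using neg \<open>finite Z\<close> \<rho>(1) by blast
  qed
  then have "\<exists>e. \<forall>i<N. e i \<in> X \<and> (\<forall>j<i. \<bar>ip (e i) (e j)\<bar> \<le> \<rho>)"
    by (rule greedy_sequence)
  then obtain e where e0: "\<forall>i<N. e i \<in> X \<and> (\<forall>j<i. \<bar>ip (e i) (e j)\<bar> \<le> \<rho>)" ..
  have e: "\<And>i. i < N \<Longrightarrow> e i \<in> X" "\<And>i j. i < N \<Longrightarrow> j < i \<Longrightarrow> \<bar>ip (e i) (e j)\<bar> \<le> \<rho>"
    using e0 by simp_all
  have be: "bf (e i)" "ip (e i) (e i) \<le> R" "\<epsilon> < ctn w (e i)" if "i < N" for i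
    using e(1)[OF that] by (auto simp: X_def)
  have off: "\<bar>ip (e i) (e j)\<bar> \<le> \<rho>" if "i < N" "j < N" "i \<noteq> j" for i j
    using e(2)[of i j] e(2)[of j i] that ip_commute[of "e i" "e j"] by (cases "j < i") auto
  have "real N * \<epsilon>\<^sup>2 = (\<Sum>i<N. \<epsilon>\<^sup>2)"
    by simp
  also have "\<dots> \<le> (\<Sum>i<N. (ctn w (e i))\<^sup>2)"
    using be(3) \<open>\<epsilon> > 0\<close> by (intro sum_mono power_mono) (auto simp: less_imp_le)
  also have "\<dots> = (\<Sum>i<N. M (\<lambda>s. (coef w (e i) s)\<^sup>2))"
    using be w by (intro sum.cong refl) (simp add: ctn_def nrm_sq bfun_intros, simp add: ip_def power2_eq_square)
  also have "\<dots> = M (\<lambda>s. \<Sum>i<N. (coef w (e i) s)\<^sup>2)"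
    using be w by (intro sum[symmetric] bfun_intros) auto
  also have "\<dots> \<le> ip w w * (R + 1)"
  proof (rule le_const)
    fix s assume s: "s \<in> carrier G"
    have "(\<Sum>i<N. (coef w (e i) s)\<^sup>2) \<le> ip (tr s w) (tr s w) * (R + card {..<N} * \<rho>)"
      unfolding coef_def
      by (rule almost_bessel[of "{..<N}" e "tr s w" R \<rho>]) (use be off w s \<open>R \<ge> 0\<close> \<rho> in \<open>auto intro: bfun_intros\<close>)
    also have "\<dots> \<le> ip w w * (R + 1)"
      using s w \<rho> by (auto simp: ip_tr intro!: mult_left_mono ip_self_nonneg)
    finally show "(\<Sum>i<N. (coef w (e i) s)\<^sup>2) \<le> ip w w * (R + 1)" .
  qed (use be w in \<open>auto intro!: bfun_intros\<close>)
  finally show False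
    using N by simp
qed

text \<open>The translates of w need not be totally bounded for \<open>nrm\<close>, but they are for
  \<open>ctn w\<close>: on the ball that contains all differences of translates,
  \<open>ctn w\<close> is small as soon as finitely many inner products are. The functions
  \<open>ip (tr x w) z\<close> of x are bounded, so finitely many x approximate all of these values.
  Left invariance is the translation invariance of \<open>ctn w\<close>.\<close>

lemma precompact_ctn:
  assumes w: "bf w"
  shows "precompact_pm G (\<lambda>x y. ctn w (\<lambda>t. tr x w t - tr y w t))" (is "precompact_pm G ?d")
proof -
  have bd: "bf (\<lambda>t. tr x w t - tr y w t)" if "x \<in> carrier G" "y \<in> carrier G" for x y
    using that w by (intro bfun_intros)
  have sym: "?d x y = ?d y x" if "x \<in> carrier G" "y \<in> carrier G" for x y
    using ctn_minus[OF w bd[OF that]] by simp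
  have refl: "?d x x = 0" for x
    by (simp add: ctn_def coef_def[abs_def] nrm_def ip_def)
  have tri: "?d x z \<le> ?d x y + ?d y z"
    if "x \<in> carrier G" "y \<in> carrier G" "z \<in> carrier G" for x y z
    using ctn_triangle[OF w bd[OF that(1,2)] bd[OF that(2,3)]] by simp
  have left: "?d (z \<otimes> x) (z \<otimes> y) = ?d x y"
    if "x \<in> carrier G" "y \<in> carrier G" "z \<in> carrier G" for x y z
  proof -
    have "?d (z \<otimes> x) (z \<otimes> y) = ctn w (tr z (\<lambda>t. tr x w t - tr y w t))"
      using that w by (intro ctn_cong bd) (auto simp: tr_def inv_mult_group m_assoc)
    then show ?thesis
      using that w bd by (simp add: ctn_tr)
  qed
  have net: "\<exists>F. finite F \<and> F \<subseteq> carrier G \<and> (\<forall>x\<in>carrier G. \<exists>y\<in>F. ?d x y \<le> \<epsilon>)" if \<epsilon>: "\<epsilon> > 0" for \<epsilon>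
  proof -
    obtain Z \<rho> where Z0: "finite Z \<and> (\<forall>z\<in>Z. bf z) \<and> \<rho> > 0 \<and>
      (\<forall>v. bf v \<longrightarrow> ip v v \<le> (2 * nrm w)\<^sup>2 \<longrightarrow> (\<forall>z\<in>Z. \<bar>ip v z\<bar> \<le> \<rho>) \<longrightarrow> ctn w v \<le> \<epsilon>)"
      using ctn_small_off_finite_set[OF w \<epsilon> zero_le_power2[of "2 * nrm w"]] by (elim exE)
    have Z: "finite Z" "\<And>z. z \<in> Z \<Longrightarrow> bf z" "\<rho> > 0"
      using Z0 by blast+
    have small: "ctn w v \<le> \<epsilon>"
      if "bf v" "ip v v \<le> (2 * nrm w)\<^sup>2" "\<forall>z\<in>Z. \<bar>ip v z\<bar> \<le> \<rho>" for v
      using Z0 that by blast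
    have bz: "bf (\<lambda>x. ip (tr x w) z)" if "z \<in> Z" for z
    proof (rule bfunI)
      fix x assume "x \<in> carrier G"
      then show "\<bar>ip (tr x w) z\<bar> \<le> nrm w * nrm z"
        using cauchy_schwarz[of "tr x w" z] Z(2)[OF that] w by (simp add: nrm_tr bfun_intros)
    qed
    obtain F where F: "finite F" "F \<subseteq> carrier G"
      "\<And>x. x \<in> carrier G \<Longrightarrow> \<exists>y\<in>F. \<forall>z\<in>Z. \<bar>ip (tr x w) z - ip (tr y w) z\<bar> \<le> \<rho>"
      using finite_net_of_bounded_functions[OF Z(1), of "carrier G" "\<lambda>z x. ip (tr x w) z" \<rho>] bz Z(3)
      by metis
    have "?d x y \<le> \<epsilon>"
      if xy: "x \<in> carrier G" "y \<in> carrier G" "\<forall>z\<in>Z. \<bar>ip (tr x w) z - ip (tr y w) z\<bar> \<le> \<rho>" for x y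
    proof (rule small)
      show "bf (\<lambda>t. tr x w t - tr y w t)"
        using bd xy by blast
      have "nrm (\<lambda>t. tr x w t - tr y w t) \<le> 2 * nrm w"
        using nrm_triangle[of "tr x w" "\<lambda>t. (-1) * tr y w t"] nrm_scale[of "tr y w" "-1"] xy w
        by (simp add: nrm_tr bfun_intros)
      then show "ip (\<lambda>t. tr x w t - tr y w t) (\<lambda>t. tr x w t - tr y w t) \<le> (2 * nrm w)\<^sup>2"
        using nrm_sq[OF bd[OF xy(1,2)]] nrm_nonneg[OF bd[OF xy(1,2)]] power_mono by metis
      show "\<forall>z\<in>Z. \<bar>ip (\<lambda>t. tr x w t - tr y w t) z\<bar> \<le> \<rho>"
        using xy w Z(2) by (simp add: ip_diff_left bfun_tr)
    qed
    then show ?thesis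
      using F by (meson subsetD)
  qed
  have nonneg: "?d x y \<ge> 0" if "x \<in> carrier G" "y \<in> carrier G" for x y
    using w bd[OF that] by simp
  show ?thesis
    unfolding precompact_pm_def
    by (intro conjI ballI allI impI) (rule nonneg sym refl tri left net; assumption)+
qed

text \<open>A quantitative substitute for almost periodicity in \<open>L\<^sup>2\<close>.\<close>

definition controlled :: "real \<Rightarrow> ('a \<Rightarrow> real) \<Rightarrow> bool" where
  "controlled \<eta> u \<longleftrightarrow> bf u \<and> (\<exists>D. bi_precompact_pm G D \<and>
     (\<forall>x\<in>carrier G. D x \<one> < 1 \<longrightarrow> nrm (\<lambda>t. tr x u t - u t) \<le> \<eta>))"

text \<open>The unit ball of the sum of two pseudometrics lies in the unit ball of each, because
  both are nonnegative.\<close>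

lemma controlled_add:
  assumes "controlled \<eta> u" "controlled \<theta> v"
  shows "controlled (\<eta> + \<theta>) (\<lambda>t. u t + v t)"
proof -
  obtain D where D: "bi_precompact_pm G D" "bf u"
    "\<And>x. x \<in> carrier G \<Longrightarrow> D x \<one> < 1 \<Longrightarrow> nrm (\<lambda>t. tr x u t - u t) \<le> \<eta>"
    using assms(1) by (auto simp: controlled_def)
  obtain E where E: "bi_precompact_pm G E" "bf v"
    "\<And>x. x \<in> carrier G \<Longrightarrow> E x \<one> < 1 \<Longrightarrow> nrm (\<lambda>t. tr x v t - v t) \<le> \<theta>"
    using assms(2) by (auto simp: controlled_def)
  have "nrm (\<lambda>t. tr x (\<lambda>t. u t + v t) t - (u t + v t)) \<le> \<eta> + \<theta>"
    if x: "x \<in> carrier G" "D x \<one> + E x \<one> < 1" for x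
  proof -
    have "D x \<one> \<ge> 0" "E x \<one> \<ge> 0"
      using D(1) E(1) x by (auto simp: bi_precompact_pm_def intro: pm_nonneg)
    then have "nrm (\<lambda>t. tr x u t - u t) \<le> \<eta>" "nrm (\<lambda>t. tr x v t - v t) \<le> \<theta>"
      using D(3) E(3) x by auto
    moreover have "(\<lambda>t. tr x (\<lambda>t. u t + v t) t - (u t + v t)) = (\<lambda>t. (tr x u t - u t) + (tr x v t - v t))"
      by (auto simp: tr_def)
    ultimately show ?thesis
      using nrm_triangle[of "\<lambda>t. tr x u t - u t" "\<lambda>t. tr x v t - v t"] D(2) E(2) x(1)
      by (simp add: bfun_intros)
  qed
  then show ?thesis
    using bi_precompact_pm_add[OF D(1) E(1)] D(2) E(2)
    unfolding controlled_def by (intro conjI bfun_intros exI[of _ "\<lambda>x y. D x y + E x y"]) auto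
qed

lemma controlled_mono: "controlled \<eta> u \<Longrightarrow> \<eta> \<le> \<theta> \<Longrightarrow> controlled \<theta> u"
  unfolding controlled_def by (meson order_trans)

lemma controlled_scale:
  assumes "controlled \<eta> u"
  shows "controlled (\<bar>c\<bar> * \<eta>) (\<lambda>t. c * u t)"
proof -
  have u: "bf u"
    using assms by (simp add: controlled_def)
  have "nrm (\<lambda>t. tr x (\<lambda>t. c * u t) t - c * u t) = \<bar>c\<bar> * nrm (\<lambda>t. tr x u t - u t)"
    if "x \<in> carrier G" for x
    using nrm_scale[OF bfun_diff[OF bfun_tr[OF that u] u], of c] by (simp add: tr_def right_diff_distrib)
  then show ?thesis
    using assms unfolding controlled_def
    by (elim conjE exE, intro conjI bfun_intros exI) (auto simp: mult_left_mono)
qed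

lemma controlled_zero: "controlled 0 (\<lambda>_. 0)"
proof -
  have "bi_precompact_pm G (\<lambda>x y. 0)"
    unfolding bi_precompact_pm_def precompact_pm_def
    by (auto intro!: exI[of _ "{\<one>}"])
  then show ?thesis
    unfolding controlled_def by (auto simp: tr_def nrm_def ip_def)
qed

text \<open>The \<open>v\<close> below approximates the weak integral of \<open>\<langle>w, \<tau>\<^sub>s w\<rangle> \<tau>\<^sub>s w\<close> over \<open>s\<close>.\<close>

lemma structured_part:
  assumes w: "bf w" and "\<eta> > 0" "\<beta> > 0"
  obtains v where "controlled \<eta> v" "ip v w \<ge> (ctn w w)\<^sup>2 - \<beta> * nrm w"
    "nrm v \<le> (nrm w) ^ 3 + \<beta>"
proof -
  define \<kappa> where "\<kappa> = coef w w"
  have b\<kappa>: "bf \<kappa>"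
    using w by (simp add: \<kappa>_def bfun_intros)
  \<comment> \<open>This is the average over s of \<open>ip w (tr s w) * ip u (tr s w)\<close>, the
    pairing of u with the desired weak integral. The bound \<open>(nrm w) ^ 3\<close> comes from two
    matrix coefficients, one of them with u in place of w.\<close>
  define \<psi> where "\<psi> u = ip \<kappa> (coef w u)" for u
  have coef_add: "coef w (\<lambda>t. u t + v t) s = coef w u s + coef w v s" if "bf u" "bf v" "s \<in> carrier G" for u v s
    using that w by (simp add: coef_def ip_add_left bfun_intros)
  have coef_scale: "coef w (\<lambda>t. c * u t) s = c * coef w u s" if "bf u" "s \<in> carrier G" for u s c
    using that w by (simp add: coef_def ip_scale_left bfun_intros)
  have \<psi>_add: "\<psi> (\<lambda>t. u t + v t) = \<psi> u + \<psi> v" if "bf u" "bf v" for u v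
  proof -
    have "\<psi> (\<lambda>t. u t + v t) = ip \<kappa> (\<lambda>s. coef w u s + coef w v s)"
      unfolding \<psi>_def using that w b\<kappa> by (intro ip_cong bfun_intros) (auto simp: coef_add)
    then show ?thesis
      using that w b\<kappa> by (simp add: \<psi>_def ip_add_right bfun_intros)
  qed
  have \<psi>_scale: "\<psi> (\<lambda>t. c * u t) = c * \<psi> u" if "bf u" for u c
  proof -
    have "\<psi> (\<lambda>t. c * u t) = ip \<kappa> (\<lambda>s. c * coef w u s)"
      unfolding \<psi>_def using that w b\<kappa> by (intro ip_cong bfun_intros) (auto simp: coef_scale)
    then show ?thesis
      using that w b\<kappa> by (simp add: \<psi>_def ip_scale_right bfun_intros)
  qed
  have nrm_coef: "nrm (coef w u) \<le> nrm w * nrm u" if "bf u" for u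
  proof (rule power2_le_imp_le)
    have "(nrm (coef w u))\<^sup>2 = ip (coef w u) (coef w u)"
      using that w by (simp add: nrm_sq bfun_intros)
    also have "\<dots> \<le> (nrm w * nrm u) * (nrm w * nrm u)"
      using ip_bound[of "coef w u" "nrm w * nrm u" "coef w u" "nrm w * nrm u"]
        coef_bound[OF w that] that w by auto
    finally show "(nrm (coef w u))\<^sup>2 \<le> (nrm w * nrm u)\<^sup>2"
      by (simp add: power2_eq_square)
  qed (use that w in auto)
  have \<psi>_bd: "\<bar>\<psi> u\<bar> \<le> (nrm w) ^ 3 * nrm u" if "bf u" for u
  proof -
    have "\<bar>\<psi> u\<bar> \<le> nrm \<kappa> * nrm (coef w u)"
      unfolding \<psi>_def using that w b\<kappa> by (intro cauchy_schwarz bfun_intros)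
    also have "\<dots> \<le> (nrm w * nrm w) * (nrm w * nrm u)"
      using nrm_coef[OF that] nrm_coef[OF w] that w b\<kappa> unfolding \<kappa>_def
      by (intro mult_mono) (auto simp: bfun_intros)
    finally show ?thesis
      by (simp add: power3_eq_cube mult_ac)
  qed
  \<comment> \<open>One third of \<open>\<eta>\<close> because three errors occur when v is moved:
    the Riesz error is used twice, and the movement of \<open>\<kappa>\<close> contributes the
    third.\<close>
  define \<gamma> where "\<gamma> = min \<beta> (\<eta> / 3)"
  have \<gamma>: "\<gamma> > 0" "\<gamma> \<le> \<beta>" "3 * \<gamma> \<le> \<eta>"
    using \<open>\<eta> > 0\<close> \<open>\<beta> > 0\<close> by (auto simp: \<gamma>_def)
  obtain v where v: "bf v" "\<And>u. bf u \<Longrightarrow> \<bar>\<psi> u - ip v u\<bar> \<le> \<gamma> * nrm u"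
    using riesz_approx[OF \<psi>_add \<psi>_scale \<psi>_bd \<gamma>(1)] by metis
  define d where "d x y = ctn w (\<lambda>t. tr x w t - tr y w t)" for x y
  have pmd: "precompact_pm G d"
    unfolding d_def using precompact_ctn[OF w] .
  define D where "D x y = (SUP z\<in>carrier G. d (x \<otimes> z) (y \<otimes> z))" for x y
  have D: "bi_precompact_pm G D" "\<And>x y. x \<in> carrier G \<Longrightarrow> y \<in> carrier G \<Longrightarrow> d x y \<le> D x y"
    unfolding D_def using bi_precompact_pm_Sup[OF pmd] by auto
  \<comment> \<open>A translation of u can be moved onto \<open>\<kappa>\<close>. The displacement
    of \<open>\<kappa>\<close> is the coefficient function of the displacement of w, so its norm is
    exactly \<open>d x \<one>\<close>.\<close>
  have \<psi>_tr: "\<bar>\<psi> (tr (inv x) u) - \<psi> u\<bar> \<le> d x \<one> * (nrm w * nrm u)" if x: "x \<in> carrier G" and u: "bf u" for x u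
  proof -
    have "\<psi> (tr (inv x) u) = ip \<kappa> (tr (inv x) (coef w u))"
      unfolding \<psi>_def using x u w b\<kappa> by (intro ip_cong bfun_intros) (auto simp: coef_tr)
    also have "\<dots> = ip (tr x \<kappa>) (coef w u)"
      using x u w b\<kappa> by (simp add: ip_tr_adjoint bfun_intros)
    finally have "\<psi> (tr (inv x) u) - \<psi> u = ip (\<lambda>s. tr x \<kappa> s - \<kappa> s) (coef w u)"
      using x u w b\<kappa> by (simp add: \<psi>_def ip_diff_left bfun_intros)
    moreover have "\<bar>ip (\<lambda>s. tr x \<kappa> s - \<kappa> s) (coef w u)\<bar> \<le> nrm (\<lambda>s. tr x \<kappa> s - \<kappa> s) * nrm (coef w u)"
      using x u w b\<kappa> by (intro cauchy_schwarz bfun_intros)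
    moreover have "nrm (\<lambda>s. tr x \<kappa> s - \<kappa> s) = d x \<one>"
    proof -
      have "coef w (\<lambda>t. tr x w t - tr \<one> w t) s = tr x \<kappa> s - \<kappa> s" if "s \<in> carrier G" for s
      proof -
        have "coef w (\<lambda>t. tr x w t - tr \<one> w t) s = coef w (tr x w) s - coef w (tr \<one> w) s"
          using that x w by (simp add: coef_def ip_diff_left bfun_intros)
        then show ?thesis
          using that x w by (simp add: coef_tr \<kappa>_def)
      qed
      then show ?thesis
        unfolding d_def ctn_def using x w b\<kappa> by (intro nrm_cong[symmetric] bfun_intros) auto
    qed
    moreover have "nrm (\<lambda>s. tr x \<kappa> s - \<kappa> s) * nrm (coef w u) \<le> nrm (\<lambda>s. tr x \<kappa> s - \<kappa> s) * (nrm w * nrm u)"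
      using nrm_coef[OF u] x b\<kappa> by (intro mult_left_mono) (auto simp: bfun_intros)
    ultimately show ?thesis
      by simp
  qed
  have main: "nrm (\<lambda>t. tr x v t - v t) \<le> 2 * \<gamma> + d x \<one> * nrm w" if x: "x \<in> carrier G" for x
  proof -
    define u where "u = (\<lambda>t. tr x v t - v t)"
    have u: "bf u"
      unfolding u_def using v x by (intro bfun_intros)
    \<comment> \<open>The displacement u of v is tested against itself. After passing to the adjoint
      translation, \<open>ip v\<close> is replaced by \<open>\<psi>\<close> at both arguments, and
      in the end one factor \<open>nrm u\<close> cancels.\<close>
    have "(nrm u)\<^sup>2 = ip (tr x v) u - ip v u"
      using u v x by (simp add: nrm_sq) (simp add: u_def ip_diff_left bfun_intros)
    also have "\<dots> = ip v (tr (inv x) u) - ip v u"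
      using u v x by (simp add: ip_tr_adjoint)
    also have "\<dots> \<le> \<gamma> * nrm (tr (inv x) u) + \<gamma> * nrm u + d x \<one> * (nrm w * nrm u)"
      using v(2)[of "tr (inv x) u"] v(2)[of u] \<psi>_tr[OF x u] u x by (simp add: bfun_intros abs_le_iff)
    also have "\<dots> = (2 * \<gamma> + d x \<one> * nrm w) * nrm u"
      using u x by (simp add: nrm_tr algebra_simps)
    finally have "nrm u * nrm u \<le> (2 * \<gamma> + d x \<one> * nrm w) * nrm u"
      by (simp add: power2_eq_square)
    moreover have "0 \<le> 2 * \<gamma> + d x \<one> * nrm w"
      using \<gamma> w x pm_nonneg[OF pmd, of x \<one>] by simp
    ultimately show ?thesis
      using nrm_nonneg[OF u] by (cases "nrm u = 0") (auto simp: u_def[symmetric])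
  qed
  \<comment> \<open>The unit ball of \<open>c * D\<close> forces
    \<open>d x \<one> * nrm w \<le> \<gamma>\<close>; the added 1 keeps c positive when
    \<open>nrm w = 0\<close>.\<close>
  define c where "c = (nrm w + 1) / \<gamma>"
  have c: "c > 0"
    unfolding c_def using \<gamma> nrm_nonneg[OF w] by simp
  have "nrm (\<lambda>t. tr x v t - v t) \<le> \<eta>" if x: "x \<in> carrier G" "c * D x \<one> < 1" for x
  proof -
    have "d x \<one> * nrm w \<le> D x \<one> * (nrm w + 1)"
      using D(2)[of x \<one>] pm_nonneg[OF pmd, of x \<one>] x w by (intro mult_mono) auto
    also have "\<dots> \<le> \<gamma>"
      using x(2) \<gamma>(1) by (simp add: c_def field_simps)
    finally show ?thesis
      using main[OF x(1)] \<gamma>(3) by linarith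
  qed
  then have "controlled \<eta> v"
    unfolding controlled_def using v(1) bi_precompact_pm_scale[OF D(1) c]
    by (intro conjI exI[of _ "\<lambda>x y. c * D x y"]) auto
  moreover have "ip v w \<ge> (ctn w w)\<^sup>2 - \<beta> * nrm w"
  proof -
    have "\<psi> w = (ctn w w)\<^sup>2"
      using b\<kappa> w by (simp add: \<psi>_def ctn_def nrm_sq bfun_intros \<kappa>_def)
    moreover have "\<gamma> * nrm w \<le> \<beta> * nrm w"
      using \<gamma> w by (intro mult_right_mono) auto
    ultimately show ?thesis
      using v(2)[OF w] by linarith
  qed
  moreover have "nrm v \<le> (nrm w) ^ 3 + \<beta>"
  proof -
    have "nrm v * nrm v \<le> ((nrm w) ^ 3 + \<gamma>) * nrm v"
      using v(2)[OF v(1)] \<psi>_bd[OF v(1)] nrm_sq[OF v(1)] by (simp add: power2_eq_square algebra_simps)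
    moreover have "0 \<le> (nrm w) ^ 3 + \<gamma>"
      using w \<gamma> by simp
    ultimately have "nrm v \<le> (nrm w) ^ 3 + \<gamma>"
      using nrm_nonneg[OF v(1)] by (cases "nrm v = 0") auto
    then show ?thesis
      using \<gamma> by linarith
  qed
  ultimately show ?thesis
    using that by blast
qed

end

section \<open>Almost invariance of convolutions\<close>

context invariant_mean
begin

text \<open>The number \<open>\<Delta>\<close> is the supremum over \<open>\<eta> > 0\<close> of the
  infimum of the squared distance from a to \<open>\<eta>\<close>-controlled functions. The classes
  shrink with \<open>\<eta>\<close>, so it stands for the squared distance to the almost periodic
  functions: each single class gets at least this close, and for small \<open>\<eta>\<close> none
  gets noticeably closer. The bound by \<open>ip a a\<close> comes from the zero function.\<close>

lemma minimal_defect: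
  assumes a: "bf a"
  shows "\<exists>\<Delta>. \<Delta> \<le> ip a a \<and>
    (\<forall>\<eta>>0. \<forall>\<zeta>>0. \<exists>h. controlled \<eta> h \<and> ip (\<lambda>t. a t - h t) (\<lambda>t. a t - h t) < \<Delta> + \<zeta>) \<and>
    (\<forall>\<zeta>>0. \<exists>\<eta>>0. \<forall>h. controlled \<eta> h \<longrightarrow> \<Delta> - \<zeta> < ip (\<lambda>t. a t - h t) (\<lambda>t. a t - h t))"
proof -
  define q where "q h = ip (\<lambda>t. a t - h t) (\<lambda>t. a t - h t)" for h
  define S where "S \<eta> = q ` {h. controlled \<eta> h}" for \<eta>
  have S_bd: "bdd_below (S \<eta>)" for \<eta>
  proof (rule bdd_belowI)
    fix y assume "y \<in> S \<eta>"
    then obtain h where "bf h" "y = q h"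
      by (auto simp: S_def controlled_def)
    then show "0 \<le> y"
      using a by (auto simp: q_def intro!: ip_self_nonneg bfun_diff)
  qed
  have lower: "Inf (S \<eta>) \<le> q h" if "controlled \<eta> h" for \<eta> h
    using that by (intro cInf_lower S_bd) (auto simp: S_def)
  have zero: "controlled \<eta> (\<lambda>_. 0)" if "\<eta> > 0" for \<eta>
    using controlled_mono[OF controlled_zero] that by simp
  then have S_ne: "S \<eta> \<noteq> {}" if "\<eta> > 0" for \<eta>
    using that by (force simp: S_def)
  define X where "X = (\<lambda>\<eta>. Inf (S \<eta>)) ` {0<..}"
  have le: "Inf (S \<eta>) \<le> ip a a" if "\<eta> > 0" for \<eta>
    using lower[OF zero[OF that]] by (simp add: q_def)
  have X_bd: "bdd_above X"
    using le by (intro bdd_aboveI[of _ "ip a a"]) (auto simp: X_def)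
  have X_ne: "X \<noteq> {}"
    by (auto simp: X_def)
  show ?thesis
  proof (rule exI[of _ "Sup X"], intro conjI allI impI)
    show "Sup X \<le> ip a a"
      using le by (intro cSup_least[OF X_ne]) (auto simp: X_def)
    show "\<exists>h. controlled \<eta> h \<and> ip (\<lambda>t. a t - h t) (\<lambda>t. a t - h t) < Sup X + \<zeta>"
      if \<eta>: "\<eta> > 0" and \<zeta>: "\<zeta> > 0" for \<eta> \<zeta>
    proof -
      have "Inf (S \<eta>) \<le> Sup X"
        using \<eta> X_bd by (intro cSup_upper) (auto simp: X_def)
      then have "Inf (S \<eta>) < Sup X + \<zeta>"
        using \<zeta> by linarith
      then obtain y where "y \<in> S \<eta>" "y < Sup X + \<zeta>"
        using cInf_less_iff[OF S_ne[OF \<eta>] S_bd] by blast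
      then show ?thesis
        unfolding S_def q_def by blast
    qed
    show "\<exists>\<eta>>0. \<forall>h. controlled \<eta> h \<longrightarrow> Sup X - \<zeta> < ip (\<lambda>t. a t - h t) (\<lambda>t. a t - h t)"
      if \<zeta>: "\<zeta> > 0" for \<zeta>
    proof -
      obtain y where "y \<in> X" "Sup X - \<zeta> < y"
        using less_cSup_iff[OF X_ne X_bd, of "Sup X - \<zeta>"] \<zeta> by auto
      then obtain \<eta> where \<eta>: "\<eta> > 0" "Sup X - \<zeta> < Inf (S \<eta>)"
        by (auto simp: X_def)
      have "Sup X - \<zeta> < q h" if "controlled \<eta> h" for h
        using lower[OF that] \<eta>(2) by linarith
      then show ?thesis
        using \<eta>(1) by (auto simp: q_def)
    qed
  qed
qed

text \<open>A remainder that correlates with its own translates could be shortened by subtracting a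
  multiple of its structured part.\<close>

lemma small_self_correlation:
  assumes a: "bf a" "ip a a \<le> 1"
    and \<Delta>: "\<Delta> \<le> ip a a"
    "\<And>\<eta> \<zeta>. \<eta> > 0 \<Longrightarrow> \<zeta> > 0 \<Longrightarrow> \<exists>h. controlled \<eta> h \<and> ip (\<lambda>t. a t - h t) (\<lambda>t. a t - h t) < \<Delta> + \<zeta>"
    "\<And>\<zeta>. \<zeta> > 0 \<Longrightarrow> \<exists>\<eta>>0. \<forall>h. controlled \<eta> h \<longrightarrow> \<Delta> - \<zeta> < ip (\<lambda>t. a t - h t) (\<lambda>t. a t - h t)"
    and pos: "\<eta> > 0" "\<zeta> > 0" "\<theta> > 0"
  shows "\<exists>h. controlled \<eta> h \<and> ip (\<lambda>t. a t - h t) (\<lambda>t. a t - h t) < \<Delta> + \<zeta> \<and>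
    nrm (\<lambda>t. a t - h t) \<le> 2 \<and> ctn (\<lambda>t. a t - h t) (\<lambda>t. a t - h t) \<le> \<theta>"
proof -
  \<comment> \<open>With \<open>nrm w \<le> 2\<close> and \<open>\<beta> \<le> 1\<close> the
    structured part satisfies \<open>nrm v \<le> 9\<close>, hence \<open>ip v v \<le> 81\<close>,
    and \<open>ip v w > \<theta>\<^sup>2 / 2\<close>. Replacing w by \<open>w - l v\<close> gains
    more than \<open>l * \<theta>\<^sup>2\<close>, while the losses \<open>81 * l\<^sup>2\<close>
    and \<open>2 * \<zeta>'\<close> are at most one half and one quarter of that.\<close>
  define l where "l = min 1 (\<theta>\<^sup>2 / 162)"
  define \<zeta>' where "\<zeta>' = min (min \<zeta> 1) (l * \<theta>\<^sup>2 / 8)"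
  define \<beta> where "\<beta> = min 1 (\<theta>\<^sup>2 / 4)"
  have l: "l > 0" "l \<le> 1" "81 * l\<^sup>2 \<le> l * \<theta>\<^sup>2 / 2"
  proof -
    show "l > 0" "l \<le> 1"
      using pos by (auto simp: l_def)
    then have "162 * l * l \<le> \<theta>\<^sup>2 * l"
      by (intro mult_right_mono) (auto simp: l_def min_def)
    then show "81 * l\<^sup>2 \<le> l * \<theta>\<^sup>2 / 2"
      by (simp add: power2_eq_square algebra_simps)
  qed
  have \<zeta>': "\<zeta>' > 0" "\<zeta>' \<le> \<zeta>" "\<zeta>' \<le> 1" "\<zeta>' \<le> l * \<theta>\<^sup>2 / 8"
    using pos l by (auto simp: \<zeta>'_def)
  have \<beta>: "\<beta> > 0" "\<beta> \<le> 1" "\<beta> \<le> \<theta>\<^sup>2 / 4"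
    using pos by (auto simp: \<beta>_def)
  obtain \<eta>' where \<eta>': "\<eta>' > 0"
    "\<And>h. controlled \<eta>' h \<Longrightarrow> \<Delta> - \<zeta>' < ip (\<lambda>t. a t - h t) (\<lambda>t. a t - h t)"
    using \<Delta>(3)[OF \<zeta>'(1)] by blast
  \<comment> \<open>Halving leaves room for the competitor \<open>h + l v\<close> with
    \<open>l \<le> 1\<close> to stay \<open>\<eta>'\<close>-controlled.\<close>
  define \<eta>2 where "\<eta>2 = min \<eta> \<eta>' / 2"
  have \<eta>2: "\<eta>2 > 0" "\<eta>2 \<le> \<eta>" "\<eta>2 + \<eta>2 \<le> \<eta>'"
    using pos \<eta>' by (auto simp: \<eta>2_def)
  obtain h where h: "controlled \<eta>2 h" "ip (\<lambda>t. a t - h t) (\<lambda>t. a t - h t) < \<Delta> + \<zeta>'"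
    using \<Delta>(2)[OF \<eta>2(1) \<zeta>'(1)] by blast
  define w where "w = (\<lambda>t. a t - h t)"
  have bh: "bf h"
    using h(1) by (simp add: controlled_def)
  then have w: "bf w"
    using a by (simp add: w_def bfun_intros)
  have ww: "ip w w < \<Delta> + \<zeta>'"
    using h by (simp add: w_def)
  have nw: "nrm w \<le> 2"
  proof (rule power2_le_imp_le)
    show "(nrm w)\<^sup>2 \<le> 2\<^sup>2"
      unfolding nrm_sq[OF w] using ww \<Delta>(1) a(2) \<zeta>'(3) by simp
  qed simp
  have "ctn w w \<le> \<theta>"
  proof (rule ccontr)
    assume "\<not> ctn w w \<le> \<theta>"
    then have big: "\<theta>\<^sup>2 < (ctn w w)\<^sup>2"
      using pos by (intro power_strict_mono) auto
    obtain v where v: "controlled \<eta>2 v" "ip v w \<ge> (ctn w w)\<^sup>2 - \<beta> * nrm w" "nrm v \<le> (nrm w) ^ 3 + \<beta>"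
      using structured_part[OF w \<eta>2(1) \<beta>(1)] by blast
    have bv: "bf v"
      using v(1) by (simp add: controlled_def)
    have "(nrm w) ^ 3 \<le> 2 ^ 3"
      using nw w by (intro power_mono) auto
    then have "nrm v \<le> 9"
      using v(3) \<beta>(2) by simp
    then have vv: "ip v v \<le> 81"
      using power_mono[of "nrm v" 9 2] bv by (simp add: nrm_sq)
    have "\<beta> * nrm w \<le> \<theta>\<^sup>2 / 4 * 2"
      using nw \<beta> w by (intro mult_mono) auto
    then have vw: "ip v w > \<theta>\<^sup>2 / 2"
      using v(2) big by linarith
    have "controlled (\<eta>2 + \<bar>l\<bar> * \<eta>2) (\<lambda>t. h t + l * v t)"
      using h(1) v(1) by (intro controlled_add controlled_scale)
    moreover have "\<eta>2 + \<bar>l\<bar> * \<eta>2 \<le> \<eta>'"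
      using \<eta>2 l mult_right_mono[of l 1 \<eta>2] by linarith
    ultimately have "\<Delta> - \<zeta>' < ip (\<lambda>t. a t - (h t + l * v t)) (\<lambda>t. a t - (h t + l * v t))"
      using \<eta>'(2) controlled_mono by blast
    also have "(\<lambda>t. a t - (h t + l * v t)) = (\<lambda>t. w t - l * v t)"
      by (auto simp: w_def)
    also have "ip (\<lambda>t. w t - l * v t) (\<lambda>t. w t - l * v t) = ip w w - 2 * l * ip v w + l\<^sup>2 * ip v v"
      using w bv
      by (simp add: ip_diff_left ip_diff_right ip_scale_left ip_scale_right bfun_intros
          ip_commute[of w v] power2_eq_square algebra_simps)
    finally have "2 * l * ip v w < 2 * \<zeta>' + l\<^sup>2 * ip v v"
      using ww by linarith
    moreover have "l\<^sup>2 * ip v v \<le> l\<^sup>2 * 81"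
      using vv by (intro mult_left_mono) auto
    moreover have "2 * l * (\<theta>\<^sup>2 / 2) < 2 * l * ip v w"
      using vw l by (intro mult_strict_left_mono) auto
    moreover have "0 < l * \<theta>\<^sup>2"
      using l pos by simp
    ultimately show False
      using l(3) \<zeta>'(4) by simp
  qed
  then show ?thesis
    using controlled_mono[OF h(1) \<eta>2(2)] ww \<zeta>'(2) nw by (intro exI[of _ h]) (auto simp: w_def)
qed

end

locale two_means = \<mu>: invariant_mean G \<mu> + \<nu>: invariant_mean G \<nu>
  for G (structure) and \<mu> \<nu> +
  fixes b :: "'a \<Rightarrow> real"
  assumes b_le: "x \<in> carrier G \<Longrightarrow> \<bar>b x\<bar> \<le> 1"
begin

text \<open>For a the indicator of A and b the indicator of B, the functional
  \<open>\<lambda>\<close> is \<open>\<mu>.ip a (conv g)\<close>.\<close>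

definition conv :: "('a \<Rightarrow> real) \<Rightarrow> 'a \<Rightarrow> real" where
  "conv g t = \<nu> (\<lambda>z. b (inv t \<otimes> z) * g z)"

lemma bfun_b [bfun_intros]: "t \<in> carrier G \<Longrightarrow> \<mu>.bf (\<lambda>z. b (t \<otimes> z))"
  using b_le by (intro bfunI[of _ _ 1]) auto

lemma conv_bound:
  assumes g: "\<mu>.bf g" and t: "t \<in> carrier G"
  shows "\<bar>conv g t\<bar> \<le> \<nu> (\<lambda>z. \<bar>g z\<bar>)"
proof -
  have "\<bar>conv g t\<bar> \<le> \<nu> (\<lambda>z. \<bar>b (inv t \<otimes> z) * g z\<bar>)"
    unfolding conv_def using g t by (intro \<nu>.abs_le bfun_intros) auto
  also have "\<dots> \<le> \<nu> (\<lambda>z. \<bar>g z\<bar>)"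
    using g t b_le by (intro \<nu>.mono bfun_intros) (auto simp: abs_mult intro!: mult_left_le_one_le)
  finally show ?thesis .
qed

lemma bfun_conv [bfun_intros]: "\<mu>.bf g \<Longrightarrow> \<mu>.bf (conv g)"
  by (rule bfunI, rule conv_bound)

text \<open>The kernel \<open>b (inv t \<otimes> z)\<close> does not change when t and z are
  multiplied on the left by the same element, so the substitution \<open>x \<otimes> z\<close> in
  \<open>\<nu>\<close> moves a translation from g to t. There it can be passed on to the other
  factor of \<open>\<mu>.ip\<close>.\<close>

lemma conv_translate:
  assumes "\<mu>.bf g" "x \<in> carrier G" "t \<in> carrier G"
  shows "conv (\<lambda>z. g (x \<otimes> z)) t = conv g (x \<otimes> t)"
proof -
  have "conv g (x \<otimes> t) = \<nu> (\<lambda>z. b (inv (x \<otimes> t) \<otimes> (x \<otimes> z)) * g (x \<otimes> z))"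
    unfolding conv_def using assms
    by (intro \<nu>.invariant[symmetric] bfun_intros) auto
  also have "\<dots> = conv (\<lambda>z. g (x \<otimes> z)) t"
    unfolding conv_def
  proof (rule \<nu>.cong[symmetric])
    show "\<mu>.bf (\<lambda>z. b (inv t \<otimes> z) * g (x \<otimes> z))"
      using assms by (intro bfun_mult bfun_b \<nu>.bfun_translate) auto
    fix z assume z: "z \<in> carrier G"
    have "inv (x \<otimes> t) \<otimes> (x \<otimes> z) = inv t \<otimes> (inv x \<otimes> (x \<otimes> z))"
      using assms z by (simp add: \<mu>.inv_mult_group \<mu>.m_assoc)
    also have "inv x \<otimes> (x \<otimes> z) = z"
      using assms z by (simp flip: \<mu>.m_assoc)
    finally show "b (inv t \<otimes> z) * g (x \<otimes> z) = b (inv (x \<otimes> t) \<otimes> (x \<otimes> z)) * g (x \<otimes> z)"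
      by simp
  qed
  finally show ?thesis ..
qed

text \<open>Since \<open>conv g\<close> is bounded pointwise by the mean of
  \<open>\<bar>g\<bar>\<close>, only the mean of \<open>\<bar>u\<bar>\<close> enters. This is the
  source of the factor \<open>\<nu> (\<lambda>z. \<bar>g z\<bar>)\<close> in the almost
  invariance.\<close>

lemma ip_conv_le:
  assumes "\<mu>.bf u" "\<mu>.bf g"
  shows "\<bar>\<mu>.ip u (conv g)\<bar> \<le> \<mu>.nrm u * \<nu> (\<lambda>z. \<bar>g z\<bar>)"
proof -
  have "\<bar>\<mu>.ip u (conv g)\<bar> \<le> \<mu> (\<lambda>t. \<bar>u t\<bar>) * \<nu> (\<lambda>z. \<bar>g z\<bar>)"
    using assms by (intro \<mu>.ip_mono_abs bfun_intros conv_bound)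
  also have "\<dots> \<le> \<mu>.nrm u * \<nu> (\<lambda>z. \<bar>g z\<bar>)"
    using assms by (intro mult_right_mono \<mu>.mean_abs_le_nrm \<nu>.nonneg bfun_intros) auto
  finally show ?thesis .
qed

text \<open>A van der Corput argument on \<open>G \<times> G\<close>: the functions \<open>\<tau>\<^sub>s w \<otimes> \<tau>\<^sub>s g\<close> all have the same
  correlation with \<open>b (t\<^sup>-\<^sup>1 z)\<close>, and many of them are almost orthogonal.\<close>

lemma ip_conv_small:
  assumes g: "\<mu>.bf g" and "\<epsilon> > 0"
  shows "\<exists>\<theta>>0. \<forall>w. \<mu>.bf w \<longrightarrow> \<mu>.nrm w \<le> 2 \<longrightarrow> \<mu>.ctn w w \<le> \<theta> \<longrightarrow>
    \<bar>\<mu>.ip w (conv g)\<bar> \<le> \<epsilon>"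
proof -
  interpret P: mean "carrier G \<times> carrier G" "\<lambda>u. \<mu> (\<lambda>x. \<nu> (\<lambda>y. u (x, y)))"
    by (rule mean_product) unfold_locales
  define K where "K = \<nu>.ip g g"
  have K: "K \<ge> 0"
    unfolding K_def using g by (rule \<nu>.ip_self_nonneg)
  \<comment> \<open>The Bessel bound below is \<open>4 * K + N * (\<rho> * K)\<close>, where 4
    bounds \<open>ip w w\<close>. Large N makes the first term at most
    \<open>N * \<epsilon>\<^sup>2 / 2\<close>, and small \<open>\<rho>\<close> does the same for the
    second. \<open>K + 1\<close> in the definition of \<open>\<rho>\<close> avoids division by zero,
    and \<open>Suc n\<close> keeps N positive.\<close>
  obtain n :: nat where n: "8 * K / \<epsilon>\<^sup>2 < n"
    using reals_Archimedean2 by blast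
  define N where "N = Suc n"
  have "8 * K < n * \<epsilon>\<^sup>2"
    using n \<open>\<epsilon> > 0\<close> by (simp add: divide_less_eq)
  then have N: "8 * K \<le> N * \<epsilon>\<^sup>2" "N > 0"
    using zero_le_power2[of \<epsilon>] unfolding N_def of_nat_Suc distrib_right by linarith+
  define \<rho> where "\<rho> = \<epsilon>\<^sup>2 / (2 * (K + 1))"
  have \<rho>: "\<rho> > 0" "\<rho> * K \<le> \<epsilon>\<^sup>2 / 2"
  proof -
    have "K / (K + 1) \<le> 1"
      using K by simp
    then have "\<epsilon>\<^sup>2 / 2 * (K / (K + 1)) \<le> \<epsilon>\<^sup>2 / 2"
      by (intro mult_left_le) auto
    then show "\<rho> * K \<le> \<epsilon>\<^sup>2 / 2"
      by (simp add: \<rho>_def)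
    show "\<rho> > 0"
      using K \<open>\<epsilon> > 0\<close> by (simp add: \<rho>_def)
  qed
  define \<theta> where "\<theta> = \<rho> / (real N + 1)"
  have \<theta>: "\<theta> > 0" "N * \<theta>\<^sup>2 < \<rho>\<^sup>2"
  proof -
    show "\<theta> > 0"
      using \<rho>(1) by (simp add: \<theta>_def)
    have "real N < (real N + 1)\<^sup>2"
      by (simp add: power2_eq_square algebra_simps add_strict_increasing)
    then have "real N / (real N + 1)\<^sup>2 < 1"
      by (simp add: divide_less_eq)
    then have "\<rho>\<^sup>2 * (real N / (real N + 1)\<^sup>2) < \<rho>\<^sup>2 * 1"
      using \<rho>(1) by (intro mult_strict_left_mono) auto
    then show "N * \<theta>\<^sup>2 < \<rho>\<^sup>2"
      unfolding \<theta>_def power_divide by (simp add: mult.commute)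
  qed
  have "\<bar>\<mu>.ip w (conv g)\<bar> \<le> \<epsilon>"
    if w: "\<mu>.bf w" "\<mu>.nrm w \<le> 2" "\<mu>.ctn w w \<le> \<theta>" for w
  proof -
    \<comment> \<open>The squared correlations of \<open>tr s w\<close> with the translates indexed
      by Z sum to a function of s whose mean is \<open>card Z\<close> times the square of
      \<open>ctn w w\<close>, by translation invariance of \<open>ctn\<close>. This is below
      \<open>\<rho>\<^sup>2\<close> by the choice of \<open>\<theta>\<close>, so some s makes all of
      them small at once.\<close>
    have "\<exists>x\<in>carrier G. \<forall>z\<in>Z. \<bar>\<mu>.ip (\<mu>.tr x w) (\<mu>.tr z w)\<bar> \<le> \<rho>"
      if Z: "finite Z" "card Z \<le> N" "Z \<subseteq> carrier G" for Z
    proof -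
      define f where "f s = (\<Sum>z\<in>Z. (\<mu>.coef w (\<mu>.tr z w) s)\<^sup>2)" for s
      have bZ: "\<mu>.bf (\<mu>.tr z w)" if "z \<in> Z" for z
        using that Z(3) w(1) by (intro \<mu>.bfun_tr) auto
      have bf: "\<mu>.bf f"
        unfolding f_def by (intro bfun_sum bfun_power \<mu>.bfun_coef bZ w(1))
      have "\<mu> f = (\<Sum>z\<in>Z. (\<mu>.ctn w (\<mu>.tr z w))\<^sup>2)"
      proof -
        have "\<mu> f = (\<Sum>z\<in>Z. \<mu> (\<lambda>s. (\<mu>.coef w (\<mu>.tr z w) s)\<^sup>2))"
          unfolding f_def by (intro \<mu>.sum bfun_power \<mu>.bfun_coef bZ w(1))
        also have "\<dots> = (\<Sum>z\<in>Z. (\<mu>.ctn w (\<mu>.tr z w))\<^sup>2)"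
          using w bZ by (intro sum.cong refl)
            (simp add: \<mu>.ctn_def \<mu>.nrm_sq \<mu>.bfun_coef, simp add: \<mu>.ip_def power2_eq_square)
        finally show ?thesis .
      qed
      also have "\<dots> = (\<Sum>z\<in>Z. (\<mu>.ctn w w)\<^sup>2)"
        using Z(3) w(1) by (intro sum.cong refl) (auto simp: \<mu>.ctn_tr subset_iff)
      also have "\<dots> \<le> N * \<theta>\<^sup>2"
        using Z(2) w by (auto intro!: mult_mono power_mono)
      finally have "\<mu> f < \<rho>\<^sup>2"
        using \<theta>(2) by simp
      then obtain x where x: "x \<in> carrier G" "f x < \<rho>\<^sup>2"
        using \<mu>.ex_le[OF bf] by blast
      have "\<bar>\<mu>.ip (\<mu>.tr x w) (\<mu>.tr z w)\<bar> \<le> \<rho>" if "z \<in> Z" for z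
      proof (rule power2_le_imp_le)
        have "(\<mu>.coef w (\<mu>.tr z w) x)\<^sup>2 \<le> f x"
          unfolding f_def using Z that by (intro member_le_sum) auto
        then show "\<bar>\<mu>.ip (\<mu>.tr x w) (\<mu>.tr z w)\<bar>\<^sup>2 \<le> \<rho>\<^sup>2"
          using x(2) by (simp add: \<mu>.coef_def \<mu>.ip_commute)
      qed (use \<rho> in simp)
      then show ?thesis
        using x(1) by blast
    qed
    then have "\<exists>s. \<forall>i<N. s i \<in> carrier G \<and> (\<forall>j<i. \<bar>\<mu>.ip (\<mu>.tr (s i) w) (\<mu>.tr (s j) w)\<bar> \<le> \<rho>)"
      by (rule greedy_sequence)
    then obtain s where "\<forall>i<N. s i \<in> carrier G \<and> (\<forall>j<i. \<bar>\<mu>.ip (\<mu>.tr (s i) w) (\<mu>.tr (s j) w)\<bar> \<le> \<rho>)" ..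
    then have s: "s i \<in> carrier G" and s_lt: "j < i \<Longrightarrow> \<bar>\<mu>.ip (\<mu>.tr (s i) w) (\<mu>.tr (s j) w)\<bar> \<le> \<rho>"
      if "i < N" for i j
      using that by simp_all
    have s_ne: "\<bar>\<mu>.ip (\<mu>.tr (s i) w) (\<mu>.tr (s j) w)\<bar> \<le> \<rho>" if "i < N" "j < N" "i \<noteq> j" for i j
      using s_lt[of i j] s_lt[of j i] that \<mu>.ip_commute by (metis linorder_neqE_nat)
    define e where "e i = (\<lambda>(t, z). \<mu>.tr (s i) w t * \<nu>.tr (s i) g z)" for i
    define b' where "b' = (\<lambda>(t, z). b (inv t \<otimes> z))"
    have be: "bfun (carrier G \<times> carrier G) (e i)" if i: "i < N" for i
    proof -
      obtain C where C: "\<And>x. x \<in> carrier G \<Longrightarrow> \<bar>\<mu>.tr (s i) w x\<bar> \<le> C"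
        using \<mu>.bfun_tr[OF s[OF i] w(1)] unfolding bfun_def by blast
      obtain C' where C': "\<And>x. x \<in> carrier G \<Longrightarrow> \<bar>\<nu>.tr (s i) g x\<bar> \<le> C'"
        using \<nu>.bfun_tr[OF s[OF i] g] unfolding bfun_def by blast
      have "C \<ge> 0"
        using C[OF \<mu>.one_closed] by linarith
      then show ?thesis
        using C C' by (intro bfunI[of _ _ "C * C'"]) (auto simp: e_def abs_mult intro!: mult_mono)
    qed
    have bb: "bfun (carrier G \<times> carrier G) b'"
      using b_le by (intro bfunI[of _ _ 1]) (auto simp: b'_def)
    have Pee: "P.ip (e i) (e j) = \<mu>.ip (\<mu>.tr (s i) w) (\<mu>.tr (s j) w) * \<nu>.ip (\<nu>.tr (s i) g) (\<nu>.tr (s j) g)"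
      if "i < N" "j < N" for i j
    proof -
      have "P.ip (e i) (e j) = \<mu> (\<lambda>t. \<nu> (\<lambda>z. (\<mu>.tr (s i) w t * \<mu>.tr (s j) w t) * (\<nu>.tr (s i) g z * \<nu>.tr (s j) g z)))"
        unfolding P.ip_def e_def by (simp only: prod.case mult_ac)
      also have "\<dots> = \<mu> (\<lambda>t. \<nu>.ip (\<nu>.tr (s i) g) (\<nu>.tr (s j) g) * (\<mu>.tr (s i) w t * \<mu>.tr (s j) w t))"
      proof -
        have "\<mu>.bf (\<lambda>z. \<nu>.tr (s i) g z * \<nu>.tr (s j) g z)"
          using that s g by (intro bfun_mult \<nu>.bfun_tr)
        then show ?thesis
          unfolding \<nu>.ip_def by (simp only: \<nu>.scale) (simp only: mult.commute)
      qed
      also have "\<dots> = \<nu>.ip (\<nu>.tr (s i) g) (\<nu>.tr (s j) g) * \<mu>.ip (\<mu>.tr (s i) w) (\<mu>.tr (s j) w)"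
        unfolding \<mu>.ip_def using that s w(1) by (intro \<mu>.scale bfun_mult \<mu>.bfun_tr)
      finally show ?thesis
        by simp
    qed
    have \<nu>_le: "\<bar>\<nu>.ip (\<nu>.tr (s i) g) (\<nu>.tr (s j) g)\<bar> \<le> K" if "i < N" "j < N" for i j
    proof -
      have "\<bar>\<nu>.ip (\<nu>.tr (s i) g) (\<nu>.tr (s j) g)\<bar> \<le> \<nu>.nrm g * \<nu>.nrm g"
        using \<nu>.cauchy_schwarz[OF \<nu>.bfun_tr[OF s g] \<nu>.bfun_tr[OF s g], of i j] that s g
        by (simp add: \<nu>.nrm_tr)
      then show ?thesis
        using \<nu>.nrm_sq[OF g] by (simp add: K_def power2_eq_square)
    qed
    have corr: "P.ip (e i) b' = \<mu>.ip w (conv g)" if i: "i < N" for i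
    proof -
      have inner: "\<nu> (\<lambda>z. \<nu>.tr (s i) g z * b (inv t \<otimes> z)) = \<mu>.tr (s i) (conv g) t" if t: "t \<in> carrier G" for t
        using conv_translate[OF g, of "inv (s i)" t] s[OF i] t
        by (simp add: \<mu>.tr_def \<nu>.tr_def conv_def mult.commute)
      have btr: "\<mu>.bf (\<lambda>t. \<mu>.tr (s i) w t * \<mu>.tr (s i) (conv g) t)"
        using s[OF i] w g by (intro bfun_intros \<mu>.bfun_tr)
      have "P.ip (e i) b' = \<mu> (\<lambda>t. \<nu> (\<lambda>z. \<mu>.tr (s i) w t * (\<nu>.tr (s i) g z * b (inv t \<otimes> z))))"
        unfolding P.ip_def e_def b'_def by (simp add: mult.assoc)
      also have "\<dots> = \<mu> (\<lambda>t. \<mu>.tr (s i) w t * \<mu>.tr (s i) (conv g) t)"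
      proof (rule \<mu>.cong[OF btr, symmetric])
        fix t assume t: "t \<in> carrier G"
        have "\<mu>.bf (\<lambda>z. \<nu>.tr (s i) g z * b (inv t \<otimes> z))"
          using t s[OF i] g by (intro bfun_intros \<nu>.bfun_tr) auto
        then show "\<mu>.tr (s i) w t * \<mu>.tr (s i) (conv g) t
            = \<nu> (\<lambda>z. \<mu>.tr (s i) w t * (\<nu>.tr (s i) g z * b (inv t \<otimes> z)))"
          using inner[OF t] by (simp add: \<nu>.scale)
      qed
      also have "\<dots> = \<mu>.ip (\<mu>.tr (s i) w) (\<mu>.tr (s i) (conv g))"
        by (simp add: \<mu>.ip_def)
      also have "\<dots> = \<mu>.ip w (conv g)"
        using s[OF i] w g by (intro \<mu>.ip_tr bfun_intros)
      finally show ?thesis .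
    qed
    have "(\<Sum>i<N. (P.ip (e i) b')\<^sup>2) \<le> P.ip b' b' * (4 * K + card {..<N} * (\<rho> * K))"
    proof (rule P.almost_bessel)
      show "P.ip (e i) (e i) \<le> 4 * K" if "i \<in> {..<N}" for i
      proof -
        have "\<mu>.ip (\<mu>.tr (s i) w) (\<mu>.tr (s i) w) \<le> 4"
          using w that s power_mono[of "\<mu>.nrm w" 2 2] by (simp add: \<mu>.ip_tr \<mu>.nrm_sq)
        then have "\<mu>.ip (\<mu>.tr (s i) w) (\<mu>.tr (s i) w) * \<nu>.ip (\<nu>.tr (s i) g) (\<nu>.tr (s i) g) \<le> 4 * K"
          using that s g by (intro mult_mono) (auto simp: \<nu>.ip_tr K_def intro: \<nu>.ip_self_nonneg)
        then show ?thesis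
          using that by (simp add: Pee)
      qed
      show "\<bar>P.ip (e i) (e j)\<bar> \<le> \<rho> * K" if "i \<in> {..<N}" "j \<in> {..<N}" "i \<noteq> j" for i j
        using that s_ne[of i j] \<nu>_le[of i j] \<rho> by (auto simp: Pee abs_mult intro!: mult_mono)
    qed (use be bb K \<rho> in auto)
    also have "\<dots> \<le> 1 * (4 * K + N * (\<rho> * K))"
    proof (intro mult_mono)
      show "P.ip b' b' \<le> 1"
        using P.ip_bound[of b' 1 b' 1] b_le by (auto simp: b'_def)
    qed (use K \<rho> bb P.ip_self_nonneg in auto)
    also have "\<dots> \<le> N * \<epsilon>\<^sup>2"
    proof -
      have "N * (\<rho> * K) \<le> N * (\<epsilon>\<^sup>2 / 2)"
        using \<rho>(2) by (intro mult_left_mono) auto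
      then show ?thesis
        using N(1) unfolding times_divide_eq_right mult_1 by linarith
    qed
    finally have "(\<Sum>i<N. (P.ip (e i) b')\<^sup>2) \<le> N * \<epsilon>\<^sup>2" .
    moreover have "(\<Sum>i<N. (P.ip (e i) b')\<^sup>2) = (\<Sum>i<N. (\<mu>.ip w (conv g))\<^sup>2)"
      using corr by (intro sum.cong refl) simp
    ultimately have "N * (\<mu>.ip w (conv g))\<^sup>2 \<le> N * \<epsilon>\<^sup>2"
      by simp
    then have "\<bar>\<mu>.ip w (conv g)\<bar>\<^sup>2 \<le> \<epsilon>\<^sup>2"
      using N(2) by simp
    then show ?thesis
      by (rule power2_le_imp_le) (use \<open>\<epsilon> > 0\<close> in simp)
  qed
  then show ?thesis
    using \<theta>(1) by blast
qed

text \<open>D comes from one fixed near-minimiser h and does not depend on g. The remainder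
  \<open>w = a - h\<close> need not be weakly mixing enough for a given g, so for each g a second
  near-minimiser k is taken whose remainder is; k and h are close by the parallelogram law. Of the
  total \<open>\<epsilon>\<close>, one half pays for the movement of h and one quarter for w at each
  of g and its translate.\<close>

theorem almost_invariance:
  assumes a: "\<mu>.bf a" "\<mu>.ip a a \<le> 1" and "\<epsilon> > 0"
  obtains D where "bi_precompact_pm G D"
    "\<And>x g. x \<in> carrier G \<Longrightarrow> D x \<one> < 1 \<Longrightarrow> \<mu>.bf g \<Longrightarrow>
      \<bar>\<mu>.ip a (conv (\<lambda>z. g (x \<otimes> z))) - \<mu>.ip a (conv g)\<bar> \<le> \<epsilon> * \<nu> (\<lambda>z. \<bar>g z\<bar>)"
proof -
  obtain \<Delta> where \<Delta>0: "\<Delta> \<le> \<mu>.ip a a"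
    "\<forall>\<eta>>0. \<forall>\<zeta>>0. \<exists>h. \<mu>.controlled \<eta> h \<and> \<mu>.ip (\<lambda>t. a t - h t) (\<lambda>t. a t - h t) < \<Delta> + \<zeta>"
    "\<forall>\<zeta>>0. \<exists>\<eta>>0. \<forall>h. \<mu>.controlled \<eta> h \<longrightarrow> \<Delta> - \<zeta> < \<mu>.ip (\<lambda>t. a t - h t) (\<lambda>t. a t - h t)"
    using \<mu>.minimal_defect[OF a(1)] by (elim exE conjE)
  note \<Delta> = \<Delta>0(1) \<Delta>0(2)[rule_format] \<Delta>0(3)[rule_format]
  \<comment> \<open>Remainders of two near-minimisers have squared norm below
    \<open>\<Delta> + \<zeta>\<close>, that of their midpoint is above
    \<open>\<Delta> - \<zeta>\<close>, so the parallelogram law bounds the squared distance by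
    \<open>8 * \<zeta>\<close>. Taking \<open>\<eta> \<le> \<eta>'\<close> below keeps the midpoint
    admissible for the lower bound.\<close>
  define \<zeta> where "\<zeta> = (\<epsilon> / 4)\<^sup>2 / 8"
  have \<zeta>: "\<zeta> > 0" "8 * \<zeta> = (\<epsilon> / 4)\<^sup>2"
    using \<open>\<epsilon> > 0\<close> by (auto simp: \<zeta>_def)
  obtain \<eta>' where \<eta>': "\<eta>' > 0"
    "\<And>h. \<mu>.controlled \<eta>' h \<Longrightarrow> \<Delta> - \<zeta> < \<mu>.ip (\<lambda>t. a t - h t) (\<lambda>t. a t - h t)"
    using \<Delta>(3)[OF \<zeta>(1)] by blast
  define \<eta> where "\<eta> = min \<eta>' (\<epsilon> / 2)"
  have \<eta>: "\<eta> > 0" "\<eta> \<le> \<eta>'" "\<eta> \<le> \<epsilon> / 2"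
    using \<eta>'(1) \<open>\<epsilon> > 0\<close> by (auto simp: \<eta>_def)
  obtain h where h: "\<mu>.controlled \<eta> h" "\<mu>.ip (\<lambda>t. a t - h t) (\<lambda>t. a t - h t) < \<Delta> + \<zeta>"
    using \<Delta>(2)[OF \<eta>(1) \<zeta>(1)] by blast
  define w where "w = (\<lambda>t. a t - h t)"
  obtain D where D: "bi_precompact_pm G D" and bh: "\<mu>.bf h"
    and Dh: "\<And>x. x \<in> carrier G \<Longrightarrow> D x \<one> < 1 \<Longrightarrow> \<mu>.nrm (\<lambda>t. \<mu>.tr x h t - h t) \<le> \<eta>"
    using h(1) unfolding \<mu>.controlled_def by blast
  have bw: "\<mu>.bf w"
    unfolding w_def using a bh by (intro bfun_intros)
  have close: "\<mu>.nrm (\<lambda>t. k t - h t) \<le> \<epsilon> / 4"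
    if k: "\<mu>.controlled \<eta> k" "\<mu>.ip (\<lambda>t. a t - k t) (\<lambda>t. a t - k t) < \<Delta> + \<zeta>" for k
  proof -
    have bk: "\<mu>.bf k"
      using k(1) by (simp add: \<mu>.controlled_def)
    have "\<mu>.controlled (\<bar>1/2\<bar> * \<eta> + \<bar>1/2\<bar> * \<eta>) (\<lambda>t. 1/2 * h t + 1/2 * k t)"
      using h(1) k(1) by (intro \<mu>.controlled_add \<mu>.controlled_scale)
    then have "\<mu>.controlled \<eta>' (\<lambda>t. 1/2 * h t + 1/2 * k t)"
      by (rule \<mu>.controlled_mono) (use \<eta> in simp)
    then have mid: "\<Delta> - \<zeta> < \<mu>.ip (\<lambda>t. a t - (1/2 * h t + 1/2 * k t)) (\<lambda>t. a t - (1/2 * h t + 1/2 * k t))"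
      by (rule \<eta>'(2))
    define v where "v = (\<lambda>t. a t - k t)"
    have bv: "\<mu>.bf v"
      unfolding v_def using a bk by (intro bfun_intros)
    have "(\<lambda>t. a t - (1/2 * h t + 1/2 * k t)) = (\<lambda>t. 1/2 * (w t + v t))"
      by (auto simp: w_def v_def field_simps)
    then have "\<Delta> - \<zeta> < (\<mu>.ip w w + 2 * \<mu>.ip w v + \<mu>.ip v v) / 4"
      using mid bw bv
      by (simp add: \<mu>.ip_simps bfun_intros \<mu>.ip_commute[of v w] del: times_divide_eq_left) argo
    moreover have "\<mu>.ip (\<lambda>t. w t - v t) (\<lambda>t. w t - v t) = \<mu>.ip w w - 2 * \<mu>.ip w v + \<mu>.ip v v"
      using bw bv by (simp add: \<mu>.ip_simps bfun_intros \<mu>.ip_commute[of v w])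
    moreover have "\<mu>.ip w w < \<Delta> + \<zeta>" "\<mu>.ip v v < \<Delta> + \<zeta>"
      using h(2) k(2) by (simp_all add: w_def v_def)
    ultimately have "\<mu>.ip (\<lambda>t. w t - v t) (\<lambda>t. w t - v t) \<le> (\<epsilon> / 4)\<^sup>2"
      unfolding \<zeta>(2)[symmetric] by argo
    moreover have "(\<lambda>t. w t - v t) = (\<lambda>t. k t - h t)"
      by (auto simp: w_def v_def)
    ultimately have "(\<mu>.nrm (\<lambda>t. k t - h t))\<^sup>2 \<le> (\<epsilon> / 4)\<^sup>2"
      using \<mu>.nrm_sq[OF bfun_diff[OF bk bh]] by simp
    then show ?thesis
      by (rule power2_le_imp_le) (use \<open>\<epsilon> > 0\<close> in simp)
  qed
  have w_small: "\<bar>\<mu>.ip w (conv g)\<bar> \<le> \<epsilon> / 4 * \<nu> (\<lambda>z. \<bar>g z\<bar>)" if g: "\<mu>.bf g" for g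
  proof (rule field_le_epsilon)
    fix \<tau> :: real assume "\<tau> > 0"
    then obtain \<theta> where \<theta>: "\<theta> > 0" "\<forall>w. \<mu>.bf w \<longrightarrow> \<mu>.nrm w \<le> 2 \<longrightarrow>
        \<mu>.ctn w w \<le> \<theta> \<longrightarrow> \<bar>\<mu>.ip w (conv g)\<bar> \<le> \<tau>"
      using ip_conv_small[OF g] by blast
    obtain k where k: "\<mu>.controlled \<eta> k" "\<mu>.ip (\<lambda>t. a t - k t) (\<lambda>t. a t - k t) < \<Delta> + \<zeta>"
      "\<mu>.nrm (\<lambda>t. a t - k t) \<le> 2" "\<mu>.ctn (\<lambda>t. a t - k t) (\<lambda>t. a t - k t) \<le> \<theta>"
      using \<mu>.small_self_correlation[OF a \<Delta> \<eta>(1) \<zeta>(1) \<theta>(1)] by blast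
    have bk: "\<mu>.bf k"
      using k(1) by (simp add: \<mu>.controlled_def)
    have w_eq: "w = (\<lambda>t. (a t - k t) + (k t - h t))"
      \<comment> \<open>Pointwise cancellation of k: the first summand is negligible against
        \<open>conv g\<close> up to the arbitrary \<open>\<tau>\<close>, and the second has norm at
        most \<open>\<epsilon> / 4\<close>.\<close>
      by (auto simp: w_def)
    have "\<mu>.ip w (conv g) = \<mu>.ip (\<lambda>t. a t - k t) (conv g) + \<mu>.ip (\<lambda>t. k t - h t) (conv g)"
      unfolding w_eq using a bk bh g by (intro \<mu>.ip_add_left bfun_diff bfun_conv)
    moreover have "\<bar>\<mu>.ip (\<lambda>t. a t - k t) (conv g)\<bar> \<le> \<tau>"
      using \<theta>(2) k(3,4) bfun_diff[OF a(1) bk] by blast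
    moreover have "\<bar>\<mu>.ip (\<lambda>t. k t - h t) (conv g)\<bar> \<le> \<mu>.nrm (\<lambda>t. k t - h t) * \<nu> (\<lambda>z. \<bar>g z\<bar>)"
      using bk bh g by (intro ip_conv_le bfun_intros)
    moreover have "\<mu>.nrm (\<lambda>t. k t - h t) * \<nu> (\<lambda>z. \<bar>g z\<bar>) \<le> \<epsilon> / 4 * \<nu> (\<lambda>z. \<bar>g z\<bar>)"
      using g close[OF k(1,2)] by (intro mult_right_mono \<nu>.nonneg bfun_intros) auto
    ultimately show "\<bar>\<mu>.ip w (conv g)\<bar> \<le> \<epsilon> / 4 * \<nu> (\<lambda>z. \<bar>g z\<bar>) + \<tau>"
      by linarith
  qed
  show ?thesis
  proof (rule that[OF D])
    fix x g assume x: "x \<in> carrier G" "D x \<one> < 1" and g: "\<mu>.bf g"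
    define g' where "g' = (\<lambda>z. g (x \<otimes> z))"
    have bg': "\<mu>.bf g'"
      unfolding g'_def using x g by (intro \<nu>.bfun_translate)
    have shift: "\<mu>.ip u (conv g') = \<mu>.ip (\<mu>.tr x u) (conv g)" if u: "\<mu>.bf u" for u
    proof -
      have "\<mu>.ip u (conv g') = \<mu>.ip u (\<mu>.tr (inv x) (conv g))"
        using u x g bg' by (intro \<mu>.ip_cong bfun_intros) (auto simp: g'_def conv_translate \<mu>.tr_def)
      then show ?thesis
        using u x g by (simp add: \<mu>.ip_tr_adjoint bfun_intros)
    qed
    have mass: "\<nu> (\<lambda>z. \<bar>g' z\<bar>) = \<nu> (\<lambda>z. \<bar>g z\<bar>)"
      unfolding g'_def using x g by (intro \<nu>.invariant[of x "\<lambda>z. \<bar>g z\<bar>"] bfun_intros)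
    have a_eq: "a = (\<lambda>t. h t + w t)"
      by (auto simp: w_def)
    have "\<mu>.ip a (conv g') - \<mu>.ip a (conv g)
      = (\<mu>.ip h (conv g') - \<mu>.ip h (conv g)) + (\<mu>.ip w (conv g') - \<mu>.ip w (conv g))"
      using bh bw g bg' by (subst (1 2) a_eq) (simp add: \<mu>.ip_add_left bfun_intros)
    also have "\<mu>.ip h (conv g') - \<mu>.ip h (conv g) = \<mu>.ip (\<lambda>t. \<mu>.tr x h t - h t) (conv g)"
      using bh x g by (simp add: shift \<mu>.ip_diff_left bfun_intros \<mu>.bfun_tr)
    finally have "\<bar>\<mu>.ip a (conv g') - \<mu>.ip a (conv g)\<bar>
      \<le> \<bar>\<mu>.ip (\<lambda>t. \<mu>.tr x h t - h t) (conv g)\<bar> + \<bar>\<mu>.ip w (conv g')\<bar> + \<bar>\<mu>.ip w (conv g)\<bar>"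
      by linarith
    moreover have "\<bar>\<mu>.ip (\<lambda>t. \<mu>.tr x h t - h t) (conv g)\<bar> \<le> \<epsilon> / 2 * \<nu> (\<lambda>z. \<bar>g z\<bar>)"
    proof -
      have "\<bar>\<mu>.ip (\<lambda>t. \<mu>.tr x h t - h t) (conv g)\<bar> \<le> \<mu>.nrm (\<lambda>t. \<mu>.tr x h t - h t) * \<nu> (\<lambda>z. \<bar>g z\<bar>)"
        using bh x g by (intro ip_conv_le bfun_intros \<mu>.bfun_tr)
      also have "\<dots> \<le> \<epsilon> / 2 * \<nu> (\<lambda>z. \<bar>g z\<bar>)"
        using Dh[OF x] \<eta>(3) g by (intro mult_right_mono \<nu>.nonneg bfun_intros) auto
      finally show ?thesis .
    qed
    ultimately show "\<bar>\<mu>.ip a (conv (\<lambda>z. g (x \<otimes> z))) - \<mu>.ip a (conv g)\<bar> \<le> \<epsilon> * \<nu> (\<lambda>z. \<bar>g z\<bar>)"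
      using w_small[OF g] w_small[OF bg'] unfolding mass g'_def[symmetric] by argo
  qed
qed

end

section \<open>Folner sets\<close>

text \<open>Rado's argument: in a minimal subrelation satisfying Hall's condition all images of points are
  singletons.\<close>

lemma infinite_marriage:
  fixes S :: "'i \<Rightarrow> 'b set"
  assumes fin: "\<And>i. i \<in> I \<Longrightarrow> finite (S i)"
    and hall: "\<And>J. finite J \<Longrightarrow> J \<subseteq> I \<Longrightarrow> card J \<le> card (\<Union>(S ` J))"
  shows "\<exists>f. inj_on f I \<and> (\<forall>i\<in>I. f i \<in> S i)"
proof -
  define E where "E = Sigma I S"
  define H where "H R \<longleftrightarrow> (\<forall>J. finite J \<and> J \<subseteq> I \<longrightarrow> card J \<le> card (R `` J))" for R :: "('i \<times> 'b) set"
  \<comment> \<open>The members are sets of removed edges, so a maximal member leaves a minimal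
    relation that still satisfies Hall's condition.\<close>
  define \<D> where "\<D> = {D. D \<subseteq> E \<and> H (E - D)}"
  have EJ: "finite (E `` J)" "finite (E \<inter> J \<times> UNIV)" if "finite J" for J
  proof -
    have "E `` J \<subseteq> \<Union>(S ` (J \<inter> I))" "E \<inter> J \<times> UNIV \<subseteq> Sigma (J \<inter> I) S"
      by (auto simp: E_def)
    moreover have "finite (\<Union>(S ` (J \<inter> I)))" "finite (Sigma (J \<inter> I) S)"
      using that fin by auto
    ultimately show "finite (E `` J)" "finite (E \<inter> J \<times> UNIV)"
      using finite_subset by blast+
  qed
  have "\<exists>D\<in>\<D>. \<forall>X\<in>\<D>. D \<subseteq> X \<longrightarrow> X = D"
  proof (rule subset_Zorn')
    fix \<C> assume C: "subset.chain \<D> \<C>"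
    show "\<Union>\<C> \<in> \<D>"
    proof (cases "\<C> = {}")
      case True
      have "H E"
        unfolding H_def
      proof (intro allI impI)
        fix J assume J: "finite J \<and> J \<subseteq> I"
        then have "E `` J = \<Union>(S ` J)"
          by (auto simp: E_def)
        then show "card J \<le> card (E `` J)"
          using hall J by simp
      qed
      then show ?thesis
        using True by (simp add: \<D>_def)
    next
      case False
      have "H (E - \<Union>\<C>)"
        unfolding H_def
      proof (intro allI impI)
        fix J assume J: "finite J \<and> J \<subseteq> I"
        \<comment> \<open>Finiteness of the sets \<open>S i\<close> enters here: only finitely many
          edges start in J, so a single member of the chain already removes all those that the union
          removes there.\<close>
        have "finite (\<Union>\<C> \<inter> (E \<inter> J \<times> UNIV))"
          using EJ(2) J by blast
        then obtain D where D: "D \<in> \<C>" "\<Union>\<C> \<inter> (E \<inter> J \<times> UNIV) \<subseteq> D"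
          using finite_subset_Union_chain[of "\<Union>\<C> \<inter> (E \<inter> J \<times> UNIV)" \<C> \<D>] False C by blast
        then have "(E - \<Union>\<C>) `` J = (E - D) `` J"
          by blast
        moreover have "H (E - D)"
          using D(1) C by (auto simp: subset.chain_def \<D>_def)
        ultimately show "card J \<le> card ((E - \<Union>\<C>) `` J)"
          using J by (simp add: H_def)
      qed
      moreover have "\<Union>\<C> \<subseteq> E"
        using C by (auto simp: subset.chain_def \<D>_def)
      ultimately show ?thesis
        by (simp add: \<D>_def)
    qed
  qed
  then obtain D where D: "D \<in> \<D>" "\<And>X. X \<in> \<D> \<Longrightarrow> D \<subseteq> X \<Longrightarrow> X = D"
    by blast
  define R where "R = E - D"
  have R: "H R" "R \<subseteq> E"
    using D(1) by (auto simp: R_def \<D>_def)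
  have RH: "card J \<le> card (R `` J)" if "finite J" "J \<subseteq> I" for J
    using R(1) that by (simp add: H_def)
  have finR: "finite (R `` J)" if "finite J" for J
    using finite_subset[OF _ EJ(1)[OF that]] R(2) by blast
  \<comment> \<open>By minimality, removing the edge breaks Hall's condition for some finite set,
    which must contain i. Taking i out of it turns the strict inequality into the bound stated for
    J.\<close>
  have crit: "\<exists>J. finite J \<and> J \<subseteq> I \<and> i \<notin> J \<and> card (R `` J \<union> (R `` {i} - {x})) \<le> card J"
    if ix: "(i, x) \<in> R" for i x
  proof -
    have "insert (i, x) D \<notin> \<D>"
      using D(2)[of "insert (i, x) D"] ix by (auto simp: R_def)
    moreover have "E - insert (i, x) D = R - {(i, x)}" "insert (i, x) D \<subseteq> E"
      using ix D(1) by (auto simp: R_def \<D>_def)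
    ultimately have "\<not> H (R - {(i, x)})"
      by (simp add: \<D>_def)
    then obtain J where J: "finite J" "J \<subseteq> I" "card ((R - {(i, x)}) `` J) < card J"
      by (auto simp: H_def not_le)
    have "i \<in> J"
    proof (rule ccontr)
      assume "i \<notin> J"
      then have "(R - {(i, x)}) `` J = R `` J"
        by auto
      then show False
        using R(1) J by (auto simp: H_def)
    qed
    moreover have "(R - {(i, x)}) `` J = R `` (J - {i}) \<union> (R `` {i} - {x})"
      using \<open>i \<in> J\<close> by auto
    ultimately show ?thesis
      using J by (intro exI[of _ "J - {i}"]) auto
  qed
  have single: "x = y" if xy: "(i, x) \<in> R" "(i, y) \<in> R" for i x y
  proof (rule ccontr)
    assume "x \<noteq> y"
    obtain J where J: "finite J" "J \<subseteq> I" "i \<notin> J" "card (R `` J \<union> (R `` {i} - {x})) \<le> card J"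
      using crit[OF xy(1)] by blast
    obtain K where K: "finite K" "K \<subseteq> I" "i \<notin> K" "card (R `` K \<union> (R `` {i} - {y})) \<le> card K"
      using crit[OF xy(2)] by blast
    \<comment> \<open>Counting as for a submodular function: P and Q have at most
      \<open>card J\<close> and \<open>card K\<close> elements, yet their union has at least
      \<open>card (J \<union> K) + 1\<close> and their intersection at least
      \<open>card (J \<inter> K)\<close>.\<close>
    define P where "P = R `` J \<union> (R `` {i} - {x})"
    define Q where "Q = R `` K \<union> (R `` {i} - {y})"
    have fin': "finite P" "finite Q"
      using finR J K by (auto simp: P_def Q_def)
    have "i \<in> I"
      using xy R(2) by (auto simp: E_def)
    have "P \<union> Q = R `` (insert i (J \<union> K))"
      using \<open>x \<noteq> y\<close> by (auto simp: P_def Q_def)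
    then have "card (insert i (J \<union> K)) \<le> card (P \<union> Q)"
      using RH[of "insert i (J \<union> K)"] J K \<open>i \<in> I\<close> by simp
    moreover have "card (insert i (J \<union> K)) = Suc (card (J \<union> K))"
      using J K by simp
    moreover have "card (J \<inter> K) \<le> card (P \<inter> Q)"
    proof -
      have "card (J \<inter> K) \<le> card (R `` (J \<inter> K))"
        using RH[of "J \<inter> K"] J K by blast
      also have "\<dots> \<le> card (P \<inter> Q)"
        using fin' by (intro card_mono) (auto simp: P_def Q_def)
      finally show ?thesis .
    qed
    moreover have "card (P \<union> Q) + card (P \<inter> Q) = card P + card Q"
      using card_Un_Int[OF fin'] by simp
    moreover have "card (J \<union> K) + card (J \<inter> K) = card J + card K"
      using card_Un_Int[OF J(1) K(1)] by simp
    ultimately show False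
      using J(4) K(4) unfolding P_def Q_def by linarith
  qed
  have nonempty: "\<exists>x. (i, x) \<in> R" if "i \<in> I" for i
  proof -
    have "card {i} \<le> card (R `` {i})"
      using RH[of "{i}"] that by blast
    then show ?thesis
      by (cases "R `` {i} = {}") auto
  qed
  define f where "f i = (SOME x. (i, x) \<in> R)" for i
  have f: "(i, f i) \<in> R" if "i \<in> I" for i
    unfolding f_def using nonempty[OF that] by (rule someI_ex)
  have Rf: "R `` {k} = {f k}" if "k \<in> I" for k
  proof (intro equalityI subsetI)
    fix x assume "x \<in> R `` {k}"
    then have "x = f k"
      using f[OF that] by (intro single[of k]) auto
    then show "x \<in> {f k}"
      by simp
  qed (use f[OF that] in simp)
  have "inj_on f I"
  proof (rule inj_onI, rule ccontr)
    fix i j assume ij: "i \<in> I" "j \<in> I" "f i = f j" "i \<noteq> j"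
    have "R `` {i, j} = R `` {i} \<union> R `` {j}"
      by blast
    then have "R `` {i, j} = {f i}"
      using Rf[OF ij(1)] Rf[OF ij(2)] ij(3) by simp
    moreover have "card {i, j} \<le> card (R `` {i, j})"
      using RH[of "{i, j}"] ij by blast
    ultimately show False
      using ij by simp
  qed
  then show ?thesis
    using f R(2) by (auto simp: E_def)
qed

lemma (in group) growth_of_finite_sets:
  fixes \<epsilon> :: real
  assumes K: "finite K" "K \<subseteq> carrier G" "\<one> \<in> K"
    and "\<epsilon> \<ge> 0"
    and grow: "\<And>F. finite F \<Longrightarrow> F \<subseteq> carrier G \<Longrightarrow> (1 + \<epsilon>) * card F \<le> card (K <#> F)"
  shows "\<exists>L. finite L \<and> L \<subseteq> carrier G \<and>
    (\<forall>F. finite F \<and> F \<subseteq> carrier G \<longrightarrow> (1 + \<epsilon>) ^ n * card F \<le> card (L <#> F))"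
proof (induction n)
  case 0
  have "card (K <#> F) \<ge> card F" if "finite F" "F \<subseteq> carrier G" for F
    using grow[OF that] \<open>\<epsilon> \<ge> 0\<close> mult_right_mono[of 1 "1 + \<epsilon>" "real (card F)"] by simp
  then show ?case
    using K by (intro exI[of _ K]) auto
next
  case (Suc n)
  then obtain L where L: "finite L" "L \<subseteq> carrier G"
    "\<And>F. finite F \<Longrightarrow> F \<subseteq> carrier G \<Longrightarrow> (1 + \<epsilon>) ^ n * card F \<le> card (L <#> F)"
    by blast
  have fin: "finite (A <#> B)" if "finite A" "finite B" for A B
    using that by (auto simp: set_mult_def)
  have "(1 + \<epsilon>) ^ Suc n * card F \<le> card ((K <#> L) <#> F)" if F: "finite F" "F \<subseteq> carrier G" for F
  proof -
    have "(1 + \<epsilon>) ^ Suc n * card F \<le> (1 + \<epsilon>) * card (L <#> F)"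
      using L(3)[OF F] \<open>\<epsilon> \<ge> 0\<close> mult_left_mono[of "(1 + \<epsilon>) ^ n * card F" "card (L <#> F)" "1 + \<epsilon>"]
      by (simp add: mult.assoc)
    also have "\<dots> \<le> card (K <#> (L <#> F))"
      using L F by (intro grow fin set_mult_closed) auto
    also have "K <#> (L <#> F) = (K <#> L) <#> F"
      using K L F by (simp add: set_mult_assoc)
    finally show ?thesis .
  qed
  then show ?case
    using K L by (intro exI[of _ "K <#> L"]) (auto intro: fin set_mult_closed[THEN subsetD])
qed

text \<open>If there are no Folner sets then all finite sets grow under multiplication by a fixed finite
  set, and the marriage theorem yields a paradoxical decomposition.\<close>

lemma Folner_sets:
  fixes G :: "('a, 'm) monoid_scheme" (structure) and \<epsilon> :: real
  assumes amen: "amenable_group G" and K: "finite K" "K \<subseteq> carrier G" and "\<epsilon> > 0"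
  shows "\<exists>F. finite F \<and> F \<noteq> {} \<and> F \<subseteq> carrier G \<and> (\<forall>k\<in>K. card ((k <# F) - F) \<le> \<epsilon> * card F)"
proof (rule ccontr)
  assume neg: "\<not> ?thesis"
  interpret group G
    using amen by (simp add: amenable_group_def)
  obtain m :: "'a set \<Rightarrow> real" where m0: "\<forall>S. S \<subseteq> carrier G \<longrightarrow> m S \<ge> 0" "m (carrier G) = 1"
    "\<forall>S S'. S \<subseteq> carrier G \<longrightarrow> S' \<subseteq> carrier G \<longrightarrow> S \<inter> S' = {} \<longrightarrow> m (S \<union> S') = m S + m S'"
    "\<forall>g S. g \<in> carrier G \<longrightarrow> S \<subseteq> carrier G \<longrightarrow> m (g <# S) = m S"
    using amen unfolding amenable_group_def by (elim conjE exE)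
  note m = m0(1)[rule_format] m0(2) m0(3)[rule_format] m0(4)[rule_format]
  have m_empty: "m {} = 0"
    using m(3)[of "{}" "{}"] by simp
  have m_UN: "m (\<Union>i\<in>X. S i) = (\<Sum>i\<in>X. m (S i))"
    if "finite X" "\<And>i. i \<in> X \<Longrightarrow> S i \<subseteq> carrier G" "disjoint_family_on S X" for X and S :: "'i \<Rightarrow> 'a set"
    using that
  proof (induction X rule: finite_induct)
    case (insert x X)
    have "S x \<inter> (\<Union>i\<in>X. S i) = {}"
      using insert.prems(2) insert.hyps(2) by (auto simp: disjoint_family_on_def)
    moreover have "(\<Union>i\<in>X. S i) \<subseteq> carrier G" "disjoint_family_on S X"
      using insert.prems by (auto simp: disjoint_family_on_def)
    ultimately show ?case
      using insert by (simp add: m(3))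
  qed (simp add: m_empty)
  \<comment> \<open>If F is not a Folner set, some k in K moves more than
    \<open>\<epsilon> * card F\<close> points out of F; the unit adjoined to K keeps F
    itself.\<close>
  have grow: "(1 + \<epsilon>) * card F \<le> card (insert \<one> K <#> F)" if F: "finite F" "F \<subseteq> carrier G" for F
  proof (cases "F = {}")
    case False
    obtain k where k: "k \<in> K" "\<epsilon> * card F < card ((k <# F) - F)"
      using neg F False by (meson not_le)
    have "F \<union> ((k <# F) - F) \<subseteq> insert \<one> K <#> F"
    proof -
      have "x \<in> insert \<one> K <#> F" if "x \<in> F" for x
        using that F(2) by (force simp: set_mult_def)
      moreover have "x \<in> insert \<one> K <#> F" if "x \<in> k <# F" for x
        using that k(1) by (auto simp: set_mult_def l_coset_def)
      ultimately show ?thesis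
        by blast
    qed
    then have "card (F \<union> ((k <# F) - F)) \<le> card (insert \<one> K <#> F)"
      using F K by (intro card_mono) (auto simp: set_mult_def)
    moreover have "card (F \<union> ((k <# F) - F)) = card F + card ((k <# F) - F)"
      using F by (intro card_Un_disjoint) (auto simp: l_coset_def)
    ultimately show ?thesis
      using k(2) by (simp add: distrib_right)
  qed simp
  obtain n where n: "2 < (1 + \<epsilon>) ^ n"
    using real_arch_pow[of "1 + \<epsilon>" 2] \<open>\<epsilon> > 0\<close> by auto
  obtain L where L: "finite L" "L \<subseteq> carrier G"
    "\<And>F. finite F \<Longrightarrow> F \<subseteq> carrier G \<Longrightarrow> (1 + \<epsilon>) ^ n * card F \<le> card (L <#> F)"
    using growth_of_finite_sets[of "insert \<one> K" \<epsilon> n] K grow \<open>\<epsilon> > 0\<close> by auto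
  have two: "2 * card F \<le> card (L <#> F)" if "finite F" "F \<subseteq> carrier G" for F
  proof -
    have "2 * real (card F) \<le> (1 + \<epsilon>) ^ n * card F"
      using n by (intro mult_right_mono) auto
    then show ?thesis
      using L(3)[OF that] by linarith
  qed
  \<comment> \<open>Two copies of G are to be embedded injectively into G, moving each g only within
    \<open>L #> g\<close>. Hall's condition is the doubling \<open>two\<close>, because J has at
    most two points over each g.\<close>
  define I where "I = carrier G \<times> (UNIV :: bool set)"
  have "card J \<le> card (\<Union>((\<lambda>(g, b). L #> g) ` J))" if J: "finite J" "J \<subseteq> I" for J
  proof -
    have "card J \<le> card (fst ` J \<times> (UNIV :: bool set))"
      using J by (intro card_mono) force+
    also have "\<dots> = 2 * card (fst ` J)"
      by (simp add: card_cartesian_product)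
    also have "\<dots> \<le> card (L <#> (fst ` J))"
      using J by (intro two) (auto simp: I_def)
    also have "L <#> (fst ` J) = \<Union>((\<lambda>(g, b). L #> g) ` J)"
      by (force simp: set_mult_def r_coset_def)
    finally show ?thesis .
  qed
  moreover have "finite ((\<lambda>(g, b). L #> g) i)" for i :: "'a \<times> bool"
    using L(1) by (auto simp: r_coset_def split: prod.split)
  ultimately have "\<exists>f. inj_on f I \<and> (\<forall>i\<in>I. f i \<in> (\<lambda>(g, b). L #> g) i)"
    by (intro infinite_marriage)
  then obtain f where f: "inj_on f I" "\<forall>i\<in>I. f i \<in> (\<lambda>(g, b). L #> g) i"
    by (elim exE conjE)
  have "\<forall>i\<in>I. \<exists>l\<in>L. f i = l \<otimes> fst i"
    using f(2) by (force simp: r_coset_def)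
  then obtain l where l: "\<And>i. i \<in> I \<Longrightarrow> l i \<in> L \<and> f i = l i \<otimes> fst i"
    by metis
  \<comment> \<open>The pieces of copy b are sorted by the factor in L that moves them. For each b
    they partition G and have total mass 1; the translated pieces \<open>Q\<close> of both copies
    are disjoint by injectivity of f and have total mass 2 by left invariance.\<close>
  define P where "P = (\<lambda>(x, b). {g \<in> carrier G. l (g, b) = x})"
  have Psub: "P i \<subseteq> carrier G" for i
    by (auto simp: P_def split: prod.split)
  have total: "(\<Sum>x\<in>L. m (P (x, b))) = 1" for b
  proof -
    have "(\<Union>x\<in>L. P (x, b)) = carrier G"
      using l by (auto simp: P_def I_def)
    moreover have "disjoint_family_on (\<lambda>x. P (x, b)) L"
      by (auto simp: disjoint_family_on_def P_def)
    ultimately show ?thesis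
      using m_UN[OF L(1), of "\<lambda>x. P (x, b)"] Psub m(2) by simp
  qed
  define Q where "Q = (\<lambda>(x, b). x <# P (x, b))"
  have Qsub: "Q i \<subseteq> carrier G" if "i \<in> L \<times> UNIV" for i
    using that L(2) by (auto simp: Q_def l_coset_def P_def)
  have Qf: "\<exists>g\<in>carrier G. l (g, b) = x \<and> z = f (g, b)" if "z \<in> Q (x, b)" for z x b
    using that l by (auto simp: Q_def l_coset_def P_def I_def)
  have "disjoint_family_on Q (L \<times> UNIV)"
    unfolding disjoint_family_on_def
  proof (intro ballI impI)
    fix i j assume ij: "i \<in> L \<times> (UNIV :: bool set)" "j \<in> L \<times> UNIV" "i \<noteq> j"
    show "Q i \<inter> Q j = {}"
    proof (rule ccontr)
      assume "Q i \<inter> Q j \<noteq> {}"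
      then obtain z where "z \<in> Q (fst i, snd i)" "z \<in> Q (fst j, snd j)"
        by auto
      then obtain g h where gh: "g \<in> carrier G" "l (g, snd i) = fst i" "h \<in> carrier G" "l (h, snd j) = fst j"
        "f (g, snd i) = f (h, snd j)"
        using Qf by metis
      then have "(g, snd i) = (h, snd j)"
        using f(1) by (intro inj_onD[OF f(1)]) (auto simp: I_def)
      then show False
        using gh ij by (auto simp: prod_eq_iff)
    qed
  qed
  then have "m (\<Union>i\<in>L \<times> UNIV. Q i) = (\<Sum>i\<in>L \<times> UNIV. m (Q i))"
    using L(1) Qsub by (intro m_UN) auto
  also have "\<dots> = (\<Sum>i\<in>L \<times> UNIV. m (P i))"
    using L(2) Psub by (intro sum.cong refl) (auto simp: Q_def m(4) split: prod.split)
  also have "\<dots> = (\<Sum>b\<in>UNIV. \<Sum>x\<in>L. m (P (x, b)))"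
    by (subst sum.swap) (simp add: sum.cartesian_product)
  also have "\<dots> = 2"
    by (simp add: total)
  finally have "m (\<Union>i\<in>L \<times> UNIV. Q i) = 2" .
  moreover have "m (\<Union>i\<in>L \<times> UNIV. Q i) \<le> 1"
  proof -
    define U where "U = (\<Union>i\<in>L \<times> UNIV. Q i)"
    have "U \<subseteq> carrier G"
      using Qsub by (auto simp: U_def)
    then have "m (U \<union> (carrier G - U)) = m U + m (carrier G - U)" "U \<union> (carrier G - U) = carrier G"
      using m(3)[of U "carrier G - U"] by auto
    then show ?thesis
      using m(1)[of "carrier G - U"] m(2) by (simp add: U_def)
  qed
  ultimately show False
    by simp
qed

section \<open>Invariant means of positive density\<close>

text \<open>Positivity of \<open>sigma_R\<close> provides, for each finite nonempty F, a right
  translate of A with density above s in F. For F nearly invariant under left multiplication,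
  averaging over \<open>F\<close> translated on the right by \<open>inv y\<close> remains nearly
  left invariant and gives A mass above s. A cluster point of such averages is the mean.\<close>

lemma invariant_mean_positive_density:
  fixes G :: "('a, 'm) monoid_scheme" (structure)
  assumes amen: "amenable_group G" and A: "A \<subseteq> carrier G" and pos: "sigma_R G A > 0"
  obtains M where "invariant_mean G M" "M (indicator A) > 0"
proof -
  interpret group G
    using amen by (simp add: amenable_group_def)
  let ?C = "carrier G"
  define s where "s = sigma_R G A / 2"
  have s: "s > 0" "s < sigma_R G A"
    using pos by (auto simp: s_def)
  have dense: "\<exists>y\<in>?C. s * card F < card (F \<inter> (A #> y))"
    if F: "finite F" "F \<noteq> {}" "F \<subseteq> ?C" for F
  proof -
    have le1: "real (card (F' \<inter> (A #> y))) / card F' \<le> 1" if "finite F'" for F' y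
      using card_mono[of F' "F' \<inter> (A #> y)"] that by (auto simp: divide_le_eq)
    have "sigma_R G A \<le> (SUP y\<in>?C. real (card (F \<inter> (A #> y))) / card F)"
      unfolding sigma_R_def
    proof (rule cINF_lower)
      show "bdd_below ((\<lambda>F. SUP y\<in>?C. real (card (F \<inter> (A #> y))) / card F) `
          {F. finite F \<and> F \<noteq> {} \<and> F \<subseteq> ?C})"
      proof (rule bdd_belowI2)
        fix F' assume "F' \<in> {F. finite F \<and> F \<noteq> {} \<and> F \<subseteq> ?C}"
        then have "real (card (F' \<inter> (A #> \<one>))) / card F' \<le> (SUP y\<in>?C. real (card (F' \<inter> (A #> y))) / card F')"
          using le1 by (intro cSUP_upper bdd_aboveI2[of _ _ 1]) auto
        then show "0 \<le> (SUP y\<in>?C. real (card (F' \<inter> (A #> y))) / card F')"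
          by (rule order.trans[rotated]) simp
      qed
    qed (use F in simp)
    then have "s < (SUP y\<in>?C. real (card (F \<inter> (A #> y))) / card F)"
      using s by linarith
    moreover have "bdd_above ((\<lambda>y. real (card (F \<inter> (A #> y))) / card F) ` ?C)"
      using le1[OF F(1)] by (intro bdd_aboveI2[of _ _ 1])
    ultimately obtain y where "y \<in> ?C" "s < real (card (F \<inter> (A #> y))) / card F"
      using less_cSUP_iff[of ?C "\<lambda>y. real (card (F \<inter> (A #> y))) / card F" s] one_closed by blast
    moreover have "card F > 0"
      using F by (simp add: card_gt_0_iff)
    ultimately show ?thesis
      by (auto simp: field_simps)
  qed
  \<comment> \<open>The natural numbers make \<open>card J\<close> unbounded even for finite G, so
    that the error \<open>1 / (card J + 1)\<close> tends to 0 along the finite subsets.\<close>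
  let ?Idx = "?C \<times> (UNIV :: nat set)"
  have "\<forall>J. \<exists>F y. finite J \<and> J \<subseteq> ?Idx \<longrightarrow> finite F \<and> F \<noteq> {} \<and> F \<subseteq> ?C \<and> y \<in> ?C \<and>
    s * card F < card (F \<inter> (A #> y)) \<and> (\<forall>k\<in>fst ` J. card ((k <# F) - F) \<le> 1 / (real (card J) + 1) * card F)"
  proof
    fix J :: "('a \<times> nat) set"
    show "\<exists>F y. finite J \<and> J \<subseteq> ?Idx \<longrightarrow> finite F \<and> F \<noteq> {} \<and> F \<subseteq> ?C \<and> y \<in> ?C \<and>
      s * card F < card (F \<inter> (A #> y)) \<and> (\<forall>k\<in>fst ` J. card ((k <# F) - F) \<le> 1 / (real (card J) + 1) * card F)"
    proof (cases "finite J \<and> J \<subseteq> ?Idx")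
      case True
      then have "finite (fst ` J)" "fst ` J \<subseteq> ?C" "1 / (real (card J) + 1) > 0"
        by auto
      then obtain F where F: "finite F" "F \<noteq> {}" "F \<subseteq> ?C"
        "\<forall>k\<in>fst ` J. card ((k <# F) - F) \<le> 1 / (real (card J) + 1) * card F"
        using Folner_sets[OF amen, of "fst ` J" "1 / (real (card J) + 1)"] by blast
      then show ?thesis
        using dense[OF F(1-3)] by blast
    qed auto
  qed
  then obtain F y where Fy: "\<And>J. finite J \<Longrightarrow> J \<subseteq> ?Idx \<Longrightarrow> finite (F J) \<and> F J \<noteq> {} \<and> F J \<subseteq> ?C \<and> y J \<in> ?C \<and>
    s * card (F J) < card (F J \<inter> (A #> y J)) \<and>
    (\<forall>k\<in>fst ` J. card ((k <# F J) - F J) \<le> 1 / (real (card J) + 1) * card (F J))"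
    by metis
  \<comment> \<open>The value 0 at unbounded functions keeps all \<open>N J\<close> inside a product
    of compact intervals.\<close>
  define N where "N J u = (if bfun ?C u then (\<Sum>f\<in>F J. u (f \<otimes> inv (y J))) / card (F J) else 0)" for J u
  define \<F> where "\<F> = filtermap N (finite_subsets_at_top ?Idx)"
  have F_nontriv: "\<F> \<noteq> bot"
    by (simp add: \<F>_def filtermap_bot_iff)
  have ev: "eventually P \<F>" if "\<And>J. finite J \<Longrightarrow> J \<subseteq> ?Idx \<Longrightarrow> P (N J)" for P
    unfolding \<F>_def eventually_filtermap by (rule eventually_finite_subsets_at_top_weakI) (rule that)
  have "\<forall>u. \<exists>B. bfun ?C u \<longrightarrow> (\<forall>x\<in>?C. \<bar>u x\<bar> \<le> B)"
    by (auto simp: bfun_def)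
  then obtain B where B: "\<And>u x. bfun ?C u \<Longrightarrow> x \<in> ?C \<Longrightarrow> \<bar>u x\<bar> \<le> B u"
    by metis
  have B_nonneg: "B u \<ge> 0" if "bfun ?C u" for u
    using B[OF that one_closed] by linarith
  \<comment> \<open>For unbounded u the chosen \<open>B u\<close> is arbitrary and may be negative,
    hence the absolute value. Compactness is Tychonoff's theorem.\<close>
  define X where "X = PiE UNIV (\<lambda>u. {- \<bar>B u\<bar>..\<bar>B u\<bar>})"
  have "compactin (product_topology (\<lambda>_. euclidean) UNIV) X"
    unfolding X_def by (subst compactin_PiE) (auto simp: compactin_euclidean_iff)
  then have "compact X"
    by (simp add: euclidean_product_topology compactin_euclidean_iff)
  moreover have "eventually (\<lambda>\<phi>. \<phi> \<in> X) \<F>"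
  proof (rule ev)
    fix J assume J: "finite J" "J \<subseteq> ?Idx"
    have "\<bar>N J u\<bar> \<le> \<bar>B u\<bar>" for u
    proof (cases "bfun ?C u")
      case True
      have "\<bar>\<Sum>f\<in>F J. u (f \<otimes> inv (y J))\<bar> \<le> (\<Sum>f\<in>F J. B u)"
        using Fy[OF J] B[OF True] by (intro order.trans[OF sum_abs] sum_mono) auto
      then have "\<bar>N J u\<bar> \<le> B u"
        using True Fy[OF J] by (simp add: N_def divide_le_eq card_gt_0_iff mult.commute)
      then show ?thesis
        by linarith
    qed (simp add: N_def)
    then show "N J \<in> X"
      by (auto simp: X_def abs_le_iff minus_le_iff)
  qed
  ultimately obtain M where M: "inf (nhds M) \<F> \<noteq> bot"
    using F_nontriv unfolding compact_filter by blast
  \<comment> \<open>A cluster point inherits every closed condition that holds eventually; each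
    property of M below is obtained in this way.\<close>
  have lim: "P M" if "closed {\<phi>. P \<phi>}" "eventually P \<F>" for P
  proof (rule ccontr)
    assume "\<not> P M"
    then have "eventually (\<lambda>\<phi>. \<phi> \<in> - {\<phi>. P \<phi>}) (nhds M)"
      using that(1) by (intro eventually_nhds_in_open) auto
    then have "eventually (\<lambda>\<phi>. \<not> P \<phi>) (nhds M)"
      by simp
    then have "eventually (\<lambda>_. False) (inf (nhds M) \<F>)"
      using that(2) unfolding eventually_inf by blast
    then show False
      using M by (simp add: trivial_limit_def)
  qed
  have cont: "continuous_on UNIV (\<lambda>\<phi>. \<phi> u)" for u :: "'a \<Rightarrow> real"
    by (rule continuous_on_product_coordinates)
  have "invariant_mean G M"
  proof
    fix u v assume uv: "bfun ?C u" "bfun ?C v"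
    show "M (\<lambda>x. u x + v x) = M u + M v"
    proof (rule lim)
      show "closed {\<phi>. \<phi> (\<lambda>x. u x + v x) = (\<phi> u + \<phi> v :: real)}"
        by (intro closed_Collect_eq continuous_intros cont)
    qed (rule ev, use uv in \<open>simp add: N_def bfun_add sum.distrib add_divide_distrib\<close>)
  next
    fix u c assume u: "bfun ?C u"
    show "M (\<lambda>x. c * u x) = c * M u"
    proof (rule lim)
      show "closed {\<phi>. \<phi> (\<lambda>x. c * u x) = (c * \<phi> u :: real)}"
        by (intro closed_Collect_eq continuous_intros cont)
    qed (rule ev, use u in \<open>simp add: N_def bfun_mult sum_distrib_left\<close>)
  next
    fix u assume u: "bfun ?C u" "\<And>x. x \<in> ?C \<Longrightarrow> 0 \<le> u x"
    show "0 \<le> M u"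
    proof (rule lim)
      show "closed {\<phi>. 0 \<le> (\<phi> u :: real)}"
        by (intro closed_Collect_le continuous_intros cont)
      have "0 \<le> N J u" if J: "finite J" "J \<subseteq> ?Idx" for J
        using Fy[OF J] u by (auto simp: N_def intro!: divide_nonneg_nonneg sum_nonneg)
      then show "eventually (\<lambda>\<phi>. 0 \<le> \<phi> u) \<F>"
        by (rule ev)
    qed
  next
    show "M (\<lambda>_. 1) = 1"
    proof (rule lim)
      show "closed {\<phi>. \<phi> (\<lambda>_ :: 'a. 1 :: real) = (1 :: real)}"
        by (intro closed_Collect_eq continuous_intros cont)
      have "N J (\<lambda>_. 1) = 1" if J: "finite J" "J \<subseteq> ?Idx" for J
        using Fy[OF J] by (simp add: N_def)
      then show "eventually (\<lambda>\<phi>. \<phi> (\<lambda>_. 1) = 1) \<F>"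
        by (rule ev)
    qed
  next
    fix g u assume g: "g \<in> ?C" and u: "bfun ?C u"
    have gu: "bfun ?C (\<lambda>t. u (g \<otimes> t))"
      using g by (intro bfun_comp[OF u]) auto
    have diff: "\<bar>N J (\<lambda>t. u (g \<otimes> t)) - N J u\<bar> \<le> 2 * B u / (real (card J) + 1)"
      if J: "finite J" "J \<subseteq> ?Idx" and gJ: "g \<in> fst ` J" for J
    proof -
      have FJ: "finite (F J)" "F J \<noteq> {}" "F J \<subseteq> ?C" "y J \<in> ?C"
        "card ((g <# F J) - F J) \<le> 1 / (real (card J) + 1) * card (F J)"
        using Fy[OF J] gJ by blast+
      define v where "v f = u (f \<otimes> inv (y J))" for f
      have v: "\<bar>v f\<bar> \<le> B u" if "f \<in> ?C" for f
        unfolding v_def using B[OF u] that FJ by simp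
      have vsum: "\<bar>\<Sum>f\<in>X. v f\<bar> \<le> card X * B u" if "X \<subseteq> ?C" for X
      proof -
        have "\<bar>\<Sum>f\<in>X. v f\<bar> \<le> (\<Sum>f\<in>X. \<bar>v f\<bar>)"
          by (rule sum_abs)
        also have "\<dots> \<le> (\<Sum>f\<in>X. B u)"
          using v that by (intro sum_mono) blast
        finally show ?thesis
          by simp
      qed
      have inj: "inj_on ((\<otimes>) g) (F J)"
        using g FJ(3) by (intro inj_onI) (auto simp: subset_iff)
      have im: "g <# F J = (\<otimes>) g ` F J"
        by (auto simp: l_coset_def)
      have gF: "finite (g <# F J)" "card (g <# F J) = card (F J)" "g <# F J \<subseteq> ?C"
        using FJ g inj by (auto simp: im card_image)
      have "(\<Sum>f\<in>F J. v (g \<otimes> f)) = (\<Sum>f\<in>g <# F J. v f)"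
        unfolding im by (simp add: sum.reindex[OF inj])
      then have "(\<Sum>f\<in>F J. v (g \<otimes> f)) - (\<Sum>f\<in>F J. v f)
          = (\<Sum>f\<in>(g <# F J) - F J. v f) - (\<Sum>f\<in>F J - (g <# F J). v f)"
        using sum.Int_Diff[OF gF(1), of v "F J"] sum.Int_Diff[OF FJ(1), of v "g <# F J"]
        by (simp add: Int_commute)
      moreover have "\<bar>\<Sum>f\<in>(g <# F J) - F J. v f\<bar> \<le> card ((g <# F J) - F J) * B u"
        using gF(3) by (intro vsum) auto
      \<comment> \<open>Both one-sided differences of \<open>F J\<close> and its translate have the
        same size because the two sets do, so the one-sided Folner bound suffices.\<close>
      moreover have "\<bar>\<Sum>f\<in>F J - (g <# F J). v f\<bar> \<le> card ((g <# F J) - F J) * B u"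
      proof -
        have "card (F J - (g <# F J)) = card ((g <# F J) - F J)"
          using gF(1,2) FJ(1) card_Diff_subset_Int[of "F J" "g <# F J"] card_Diff_subset_Int[of "g <# F J" "F J"]
          by (simp add: Int_commute)
        then show ?thesis
          using vsum[of "F J - (g <# F J)"] FJ(3) by auto
      qed
      ultimately have "\<bar>(\<Sum>f\<in>F J. v (g \<otimes> f)) - (\<Sum>f\<in>F J. v f)\<bar> \<le> 2 * (card ((g <# F J) - F J) * B u)"
        by linarith
      also have "\<dots> \<le> 2 * (1 / (real (card J) + 1) * card (F J) * B u)"
        using FJ(5) B_nonneg[OF u] by (intro mult_left_mono mult_right_mono) auto
      finally have "\<bar>(\<Sum>f\<in>F J. v (g \<otimes> f)) - (\<Sum>f\<in>F J. v f)\<bar> / card (F J) \<le> 2 * B u / (real (card J) + 1)"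
        using FJ(1,2) by (simp add: divide_le_eq card_gt_0_iff mult_ac)
      moreover have "N J (\<lambda>t. u (g \<otimes> t)) - N J u = ((\<Sum>f\<in>F J. v (g \<otimes> f)) - (\<Sum>f\<in>F J. v f)) / card (F J)"
      proof -
        have "(\<Sum>f\<in>F J. u (g \<otimes> (f \<otimes> inv (y J)))) = (\<Sum>f\<in>F J. v (g \<otimes> f))"
          unfolding v_def using FJ g by (intro sum.cong refl) (auto simp: m_assoc subset_iff)
        then show ?thesis
          using u gu by (simp add: N_def v_def diff_divide_distrib)
      qed
      ultimately show ?thesis
        by (simp add: abs_divide)
    qed
    have "\<bar>M (\<lambda>t. u (g \<otimes> t)) - M u\<bar> \<le> \<delta>" if "\<delta> > 0" for \<delta>
    proof (rule lim)
      show "closed {\<phi>. \<bar>\<phi> (\<lambda>t. u (g \<otimes> t)) - \<phi> u :: real\<bar> \<le> \<delta>}"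
        by (intro closed_Collect_le continuous_intros cont)
      \<comment> \<open>Every J that contains \<open>{g} \<times> {..<n}\<close> has g among its
        first components and at least n elements, which brings the bound \<open>diff\<close> below
        \<open>\<delta>\<close>.\<close>
      obtain n :: nat where n: "2 * B u / \<delta> < n"
        using reals_Archimedean2 by blast
      have "\<bar>N J (\<lambda>t. u (g \<otimes> t)) - N J u\<bar> \<le> \<delta>" if J: "finite J" "{g} \<times> {..<n} \<subseteq> J" "J \<subseteq> ?Idx" and "n > 0" for J
      proof -
        have "card ({g} \<times> {..<n}) \<le> card J"
          using J by (intro card_mono)
        then have "n \<le> card J"
          by (simp add: card_cartesian_product)
        have "2 * B u < n * \<delta>"
          using n \<open>\<delta> > 0\<close> by (simp add: divide_less_eq)
        also have "\<dots> \<le> (real (card J) + 1) * \<delta>"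
          using \<open>n \<le> card J\<close> \<open>\<delta> > 0\<close> by (intro mult_right_mono) auto
        finally have "2 * B u / (real (card J) + 1) \<le> \<delta>"
          by (simp add: divide_le_eq mult.commute)
        moreover have "g \<in> fst ` J"
          using J(2) \<open>n > 0\<close> by force
        ultimately show ?thesis
          using diff[OF J(1,3)] by linarith
      qed
      moreover have "n > 0"
        using n B_nonneg[OF u] \<open>\<delta> > 0\<close> by (cases "n = 0") (auto simp: divide_less_0_iff)
      ultimately show "eventually (\<lambda>\<phi>. \<bar>\<phi> (\<lambda>t. u (g \<otimes> t)) - \<phi> u\<bar> \<le> \<delta>) \<F>"
        unfolding \<F>_def eventually_filtermap eventually_finite_subsets_at_top
        using g by (intro exI[of _ "{g} \<times> {..<n}"]) auto
    qed
    then show "M (\<lambda>t. u (g \<otimes> t)) = M u"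
      by (metis abs_le_zero_iff dense_ge eq_iff_diff_eq_0)
  qed
  moreover have "s \<le> M (indicator A)"
  proof (rule lim)
    show "closed {\<phi>. s \<le> \<phi> (indicator A :: 'a \<Rightarrow> real)}"
      by (intro closed_Collect_le continuous_intros cont)
    have "s \<le> N J (indicator A)" if J: "finite J" "J \<subseteq> ?Idx" for J
    proof -
      have FJ: "finite (F J)" "F J \<noteq> {}" "F J \<subseteq> ?C" "y J \<in> ?C" "s * card (F J) < card (F J \<inter> (A #> y J))"
        using Fy[OF J] by blast+
      have iff: "f \<otimes> inv (y J) \<in> A \<longleftrightarrow> f \<in> A #> y J" if "f \<in> F J" for f
      proof
        assume "f \<otimes> inv (y J) \<in> A"
        moreover have "f = (f \<otimes> inv (y J)) \<otimes> y J"
          using FJ that by (auto simp: m_assoc subset_iff)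
        ultimately show "f \<in> A #> y J"
          by (auto simp: r_coset_def)
      next
        assume "f \<in> A #> y J"
        then obtain a where "a \<in> A" "f = a \<otimes> y J"
          by (auto simp: r_coset_def)
        then show "f \<otimes> inv (y J) \<in> A"
          using A FJ by (auto simp: m_assoc subset_iff)
      qed
      have "(\<Sum>f\<in>F J. indicator A (f \<otimes> inv (y J)) :: real) = (\<Sum>f\<in>F J. indicator (A #> y J) f)"
        using iff by (intro sum.cong refl) (simp add: indicator_def)
      also have "\<dots> = card (F J \<inter> (A #> y J))"
        using FJ(1) by (simp add: indicator_def sum.If_cases Int_def)
      finally show ?thesis
        using FJ by (simp add: N_def bfun_indicator le_divide_eq card_gt_0_iff)
    qed
    then show "eventually (\<lambda>\<phi>. s \<le> \<phi> (indicator A)) \<F>"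
      by (rule ev)
  qed
  ultimately show ?thesis
    using that[of M] s by simp
qed

section \<open>Bohr open balls\<close>

lemma le_if_le_all_inverse:
  assumes "\<And>n. (s :: real) \<le> t + c * inverse (real (Suc n))"
  shows "s \<le> t"
proof (rule LIMSEQ_le_const)
  have "(\<lambda>n. t + c * inverse (real (Suc n))) \<longlonglongrightarrow> t + c * 0"
    by (intro tendsto_intros LIMSEQ_inverse_real_of_nat)
  then show "(\<lambda>n. t + c * inverse (real (Suc n))) \<longlonglongrightarrow> t"
    by simp
qed (use assms in blast)

section \<open>Compact group structure on the completion of a bi-invariant pseudometric\<close>

context
  fixes G (structure) and D \<rho> \<iota> and K :: "'k set"
  assumes group_G: "group G" and bi: "bi_precompact_pm G D"
    and metric: "Metric_space K \<rho>" and complete: "Metric_space.mcomplete K \<rho>"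
    and \<iota>_in: "\<And>x. x \<in> carrier G \<Longrightarrow> \<iota> x \<in> K"
    and \<iota>_iso: "\<And>x z. x \<in> carrier G \<Longrightarrow> z \<in> carrier G \<Longrightarrow> \<rho> (\<iota> x) (\<iota> z) = D x z"
    and \<iota>_dense: "\<And>p \<epsilon>. p \<in> K \<Longrightarrow> \<epsilon> > 0 \<Longrightarrow> \<exists>x\<in>carrier G. \<rho> p (\<iota> x) \<le> \<epsilon>"
begin

interpretation group G
  by (rule group_G)

interpretation K: Metric_space K \<rho>
  by (rule metric)

lemma D_pm: "precompact_pm G D"
  using bi by (simp add: bi_precompact_pm_def)

lemma D_right: "x \<in> carrier G \<Longrightarrow> y \<in> carrier G \<Longrightarrow> z \<in> carrier G \<Longrightarrow> D (x \<otimes> z) (y \<otimes> z) = D x y"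
  using bi by (simp add: bi_precompact_pm_def)

lemma D_mult:
  assumes "x \<in> carrier G" "y \<in> carrier G" "x' \<in> carrier G" "y' \<in> carrier G"
  shows "D (x \<otimes> y) (x' \<otimes> y') \<le> D x x' + D y y'"
  using pm_triangle[OF D_pm, of "x \<otimes> y" "x' \<otimes> y" "x' \<otimes> y'"] pm_left[OF D_pm] D_right assms
  by simp

lemma D_inv:
  assumes "x \<in> carrier G" "y \<in> carrier G"
  shows "D (inv x) (inv y) = D x y"
proof -
  have "D (inv x) (inv y) = D (x \<otimes> inv x) (x \<otimes> inv y)"
    using assms by (simp only: pm_left[OF D_pm] inv_closed)
  also have "\<dots> = D (x \<otimes> inv x \<otimes> y) (x \<otimes> inv y \<otimes> y)"
    using assms by (simp only: D_right inv_closed m_closed)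
  also have "\<dots> = D x y"
    using assms pm_sym[OF D_pm, of x y] by (simp add: m_assoc)
  finally show ?thesis .
qed

text \<open>Points of the completion are handled through group elements with an explicit error. The
  extended product is characterised by the addition of errors and the extended inverse by their
  preservation.\<close>

definition appr :: "'k \<Rightarrow> 'a \<Rightarrow> real \<Rightarrow> bool" where
  "appr p x \<epsilon> \<longleftrightarrow> p \<in> K \<and> x \<in> carrier G \<and> \<rho> p (\<iota> x) \<le> \<epsilon>"

lemma appr_ex: "p \<in> K \<Longrightarrow> \<epsilon> > 0 \<Longrightarrow> \<exists>x. appr p x \<epsilon>"
  using \<iota>_dense by (auto simp: appr_def)

lemma appr_\<iota>: "x \<in> carrier G \<Longrightarrow> appr (\<iota> x) x 0"
  by (simp add: appr_def \<iota>_in \<iota>_iso pm_refl[OF D_pm])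

lemma appr_dist:
  assumes "appr p x a" "appr q z b"
  shows "\<rho> p q \<le> a + D x z + b" "D x z \<le> a + \<rho> p q + b"
proof -
  have in_K: "p \<in> K" "q \<in> K" "\<iota> x \<in> K" "\<iota> z \<in> K" "\<rho> (\<iota> x) (\<iota> z) = D x z"
    using assms by (auto simp: appr_def \<iota>_in \<iota>_iso)
  show "\<rho> p q \<le> a + D x z + b"
    using K.triangle[of p "\<iota> x" q] K.triangle[of "\<iota> x" "\<iota> z" q] K.commute[of q "\<iota> z"] in_K assms
    by (auto simp: appr_def)
  show "D x z \<le> a + \<rho> p q + b"
    using K.triangle[of "\<iota> x" p "\<iota> z"] K.triangle[of p q "\<iota> z"] K.commute[of p "\<iota> x"] in_K assms
    by (auto simp: appr_def)
qed

text \<open>Identities in the completion reduce to identities in G: it suffices to exhibit common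
  approximants of both sides.\<close>

lemma appr_unique:
  assumes "p \<in> K" "q \<in> K" "\<And>\<epsilon>. \<epsilon> > 0 \<Longrightarrow> \<exists>x. appr p x \<epsilon> \<and> appr q x \<epsilon>"
  shows "p = q"
proof -
  have "\<rho> p q \<le> 0 + \<epsilon>" if \<epsilon>: "\<epsilon> > 0" for \<epsilon>
  proof -
    obtain x where "appr p x (\<epsilon> / 2)" "appr q x (\<epsilon> / 2)"
      using assms(3)[OF half_gt_zero[OF \<epsilon>]] by blast
    then show ?thesis
      using appr_dist(1)[of p x "\<epsilon> / 2" q x "\<epsilon> / 2"] pm_refl[OF D_pm, of x] by (simp add: appr_def)
  qed
  then have "\<rho> p q \<le> 0"
    by (rule field_le_epsilon)
  then show ?thesis
    using K.nonneg[of p q] K.zero[OF assms(1,2)] by simp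
qed

text \<open>The limit exists by completeness. Letting m tend to infinity in the Cauchy estimate
  keeps the explicit rate, which the later error bounds rely on.\<close>

lemma appr_limit:
  assumes y: "\<And>n. y n \<in> carrier G" and "c > 0"
    and cauchy: "\<And>n m. D (y n) (y m) \<le> c * inverse (real (Suc n)) + c * inverse (real (Suc m))"
  obtains r where "r \<in> K" "\<And>n. \<rho> r (\<iota> (y n)) \<le> c * inverse (real (Suc n))"
proof -
  have small: "\<exists>N. \<forall>n\<ge>N. c * inverse (real (Suc n)) < \<epsilon>" if "\<epsilon> > 0" for \<epsilon>
  proof -
    have "(\<lambda>n. c * inverse (real (Suc n))) \<longlonglongrightarrow> c * 0"
      by (intro tendsto_intros LIMSEQ_inverse_real_of_nat)
    then show ?thesis
      using order_tendstoD(2)[of _ "c * 0" sequentially \<epsilon>] that by (simp add: eventually_sequentially)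
  qed
  have "K.MCauchy (\<lambda>n. \<iota> (y n))"
    unfolding K.MCauchy_def
  proof (intro conjI allI impI)
    show "range (\<lambda>n. \<iota> (y n)) \<subseteq> K"
      using y \<iota>_in by auto
    fix \<epsilon> :: real assume "\<epsilon> > 0"
    then obtain N where N: "\<forall>n\<ge>N. c * inverse (real (Suc n)) < \<epsilon> / 2"
      using small[of "\<epsilon> / 2"] by auto
    have "\<rho> (\<iota> (y n)) (\<iota> (y m)) < \<epsilon>" if "N \<le> n" "N \<le> m" for n m
      using N[rule_format, OF that(1)] N[rule_format, OF that(2)] cauchy[of n m] by (simp add: \<iota>_iso y)
    then show "\<exists>N. \<forall>n n'. N \<le> n \<longrightarrow> N \<le> n' \<longrightarrow> \<rho> (\<iota> (y n)) (\<iota> (y n')) < \<epsilon>"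
      by blast
  qed
  then obtain r where "limitin K.mtopology (\<lambda>n. \<iota> (y n)) r sequentially"
    using complete unfolding K.mcomplete_def by blast
  then have r: "r \<in> K" "\<forall>\<epsilon>>0. \<exists>N. \<forall>n\<ge>N. \<iota> (y n) \<in> K \<and> \<rho> (\<iota> (y n)) r < \<epsilon>"
    by (simp_all add: K.limit_metric_sequentially)
  have "\<rho> r (\<iota> (y n)) \<le> c * inverse (real (Suc n))" for n
  proof (rule field_le_epsilon)
    fix \<epsilon> :: real assume "\<epsilon> > 0"
    then obtain N where N: "\<forall>m\<ge>N. \<rho> (\<iota> (y m)) r < \<epsilon> / 2"
      using r(2)[rule_format, of "\<epsilon> / 2"] by auto
    obtain N' where N': "\<forall>m\<ge>N'. c * inverse (real (Suc m)) < \<epsilon> / 2"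
      using small[of "\<epsilon> / 2"] \<open>\<epsilon> > 0\<close> by auto
    define m where "m = max N N'"
    have "\<rho> r (\<iota> (y n)) \<le> \<rho> r (\<iota> (y m)) + \<rho> (\<iota> (y m)) (\<iota> (y n))"
      by (intro K.triangle \<iota>_in y r(1))
    moreover have "\<rho> r (\<iota> (y m)) < \<epsilon> / 2"
      using N K.commute[of r "\<iota> (y m)"] by (simp add: m_def)
    moreover have "c * inverse (real (Suc m)) < \<epsilon> / 2"
      using N' by (simp add: m_def)
    ultimately show "\<rho> r (\<iota> (y n)) \<le> c * inverse (real (Suc n)) + \<epsilon>"
      using cauchy[of m n] y by (simp add: \<iota>_iso)
  qed
  then show ?thesis
    using that r(1) by blast
qed

lemma appr_seq:
  assumes "p \<in> K"
  obtains X where "\<And>n. appr p (X n) (inverse (real (Suc n)))"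
proof -
  have "\<forall>n. \<exists>x. appr p x (inverse (real (Suc n)))"
    using appr_ex[OF assms] by simp
  then have "\<exists>X. \<forall>n. appr p (X n) (inverse (real (Suc n)))"
    by (rule choice)
  then show ?thesis
    using that by blast
qed

text \<open>The product is the limit of products of approximating sequences. Stating the error bound
  for all approximants of p and q makes it independent of the chosen sequences.\<close>

lemma mult_ex:
  assumes "p \<in> K" "q \<in> K"
  shows "\<exists>r\<in>K. \<forall>x z a b. appr p x a \<longrightarrow> appr q z b \<longrightarrow> appr r (x \<otimes> z) (a + b)"
proof -
  obtain X where X: "\<And>n. appr p (X n) (inverse (real (Suc n)))"
    using appr_seq[OF assms(1)] by blast
  obtain Z where Z: "\<And>n. appr q (Z n) (inverse (real (Suc n)))"
    using appr_seq[OF assms(2)] by blast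
  have XZ: "X n \<in> carrier G" "Z n \<in> carrier G" for n
    using X Z by (auto simp: appr_def)
  have pp: "\<rho> p p = 0" "\<rho> q q = 0"
    using assms by auto
  have "D (X n \<otimes> Z n) (X m \<otimes> Z m) \<le> 2 * inverse (real (Suc n)) + 2 * inverse (real (Suc m))" for n m
    using D_mult[OF XZ XZ, of n n m m] appr_dist(2)[OF X X, of n m] appr_dist(2)[OF Z Z, of n m] pp
    by linarith
  then obtain r where r: "r \<in> K" "\<And>n. \<rho> r (\<iota> (X n \<otimes> Z n)) \<le> 2 * inverse (real (Suc n))"
    using appr_limit[of "\<lambda>n. X n \<otimes> Z n" 2] XZ by auto
  have "appr r (x \<otimes> z) (a + b)" if x: "appr p x a" and z: "appr q z b" for x z a b
  proof -
    have xz: "x \<in> carrier G" "z \<in> carrier G"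
      using x z by (auto simp: appr_def)
    \<comment> \<open>Of the 4, two come from the distance of r to the nth product, and one each
      from \<open>X n\<close> and \<open>Z n\<close>.\<close>
    have "\<rho> r (\<iota> (x \<otimes> z)) \<le> a + b + 4 * inverse (real (Suc n))" for n
    proof -
      have "\<rho> r (\<iota> (x \<otimes> z)) \<le> \<rho> r (\<iota> (X n \<otimes> Z n)) + \<rho> (\<iota> (X n \<otimes> Z n)) (\<iota> (x \<otimes> z))"
        using r(1) XZ xz by (intro K.triangle \<iota>_in m_closed)
      also have "\<rho> (\<iota> (X n \<otimes> Z n)) (\<iota> (x \<otimes> z)) = D (X n \<otimes> Z n) (x \<otimes> z)"
        using XZ xz by (intro \<iota>_iso m_closed)
      finally show ?thesis
        using D_mult[OF XZ(1) XZ(2) xz, of n n] appr_dist(2)[OF X x, of n] appr_dist(2)[OF Z z, of n] pp r(2)[of n]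
        by linarith
    qed
    then have "\<rho> r (\<iota> (x \<otimes> z)) \<le> a + b"
      by (rule le_if_le_all_inverse)
    then show ?thesis
      using r(1) xz by (simp add: appr_def)
  qed
  then show ?thesis
    using r(1) by blast
qed

lemma inv_ex:
  assumes "p \<in> K"
  shows "\<exists>r\<in>K. \<forall>x a. appr p x a \<longrightarrow> appr r (inv x) a"
proof -
  obtain X where X: "\<And>n. appr p (X n) (inverse (real (Suc n)))"
    using appr_seq[OF assms(1)] by blast
  have XC: "X n \<in> carrier G" for n
    using X by (auto simp: appr_def)
  have pp: "\<rho> p p = 0"
    using assms by auto
  have "D (inv (X n)) (inv (X m)) \<le> 1 * inverse (real (Suc n)) + 1 * inverse (real (Suc m))" for n m
    using D_inv[OF XC XC, of n m] appr_dist(2)[OF X X, of n m] pp by linarith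
  then obtain r where r: "r \<in> K" "\<And>n. \<rho> r (\<iota> (inv (X n))) \<le> 1 * inverse (real (Suc n))"
    using appr_limit[of "\<lambda>n. inv (X n)" 1] XC by auto
  have "appr r (inv x) a" if x: "appr p x a" for x a
  proof -
    have xc: "x \<in> carrier G"
      using x by (auto simp: appr_def)
    have "\<rho> r (\<iota> (inv x)) \<le> a + 2 * inverse (real (Suc n))" for n
    proof -
      have "\<rho> r (\<iota> (inv x)) \<le> \<rho> r (\<iota> (inv (X n))) + \<rho> (\<iota> (inv (X n))) (\<iota> (inv x))"
        using r(1) XC xc by (intro K.triangle \<iota>_in inv_closed)
      also have "\<rho> (\<iota> (inv (X n))) (\<iota> (inv x)) = D (X n) x"
        using XC xc by (simp add: \<iota>_iso D_inv)
      finally show ?thesis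
        using appr_dist(2)[OF X x, of n] pp r(2)[of n] by linarith
    qed
    then have "\<rho> r (\<iota> (inv x)) \<le> a"
      by (rule le_if_le_all_inverse)
    then show ?thesis
      using r(1) xc by (simp add: appr_def)
  qed
  then show ?thesis
    using r(1) by blast
qed

definition kmult :: "'k \<Rightarrow> 'k \<Rightarrow> 'k" where
  "kmult p q = (SOME r. r \<in> K \<and> (\<forall>x z a b. appr p x a \<longrightarrow> appr q z b \<longrightarrow> appr r (x \<otimes> z) (a + b)))"

definition kinv :: "'k \<Rightarrow> 'k" where
  "kinv p = (SOME r. r \<in> K \<and> (\<forall>x a. appr p x a \<longrightarrow> appr r (inv x) a))"

definition kgroup :: "'k monoid" where
  "kgroup = \<lparr>carrier = K, mult = kmult, one = \<iota> \<one>\<rparr>"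

lemma kmult_in: "p \<in> K \<Longrightarrow> q \<in> K \<Longrightarrow> kmult p q \<in> K"
  and kmult_appr: "appr p x a \<Longrightarrow> appr q z b \<Longrightarrow> appr (kmult p q) (x \<otimes> z) (a + b)"
proof -
  have *: "kmult p q \<in> K \<and> (\<forall>x z a b. appr p x a \<longrightarrow> appr q z b \<longrightarrow> appr (kmult p q) (x \<otimes> z) (a + b))"
    if "p \<in> K" "q \<in> K" for p q
    unfolding kmult_def by (rule someI_ex) (use mult_ex[OF that] in blast)
  show "p \<in> K \<Longrightarrow> q \<in> K \<Longrightarrow> kmult p q \<in> K"
    using * by blast
  show "appr p x a \<Longrightarrow> appr q z b \<Longrightarrow> appr (kmult p q) (x \<otimes> z) (a + b)"
    using *[of p q] by (simp add: appr_def)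
qed

lemma kinv_in: "p \<in> K \<Longrightarrow> kinv p \<in> K"
  and kinv_appr: "appr p x a \<Longrightarrow> appr (kinv p) (inv x) a"
proof -
  have *: "kinv p \<in> K \<and> (\<forall>x a. appr p x a \<longrightarrow> appr (kinv p) (inv x) a)" if "p \<in> K" for p
    unfolding kinv_def by (rule someI_ex) (use inv_ex[OF that] in blast)
  show "p \<in> K \<Longrightarrow> kinv p \<in> K"
    using * by blast
  show "appr p x a \<Longrightarrow> appr (kinv p) (inv x) a"
    using *[of p] by (simp add: appr_def)
qed

lemma appr_mono: "appr p x a \<Longrightarrow> a \<le> b \<Longrightarrow> appr p x b"
  by (simp add: appr_def)

lemma kmult_left_inv:
  assumes "p \<in> K"
  shows "kmult (kinv p) p = \<iota> \<one>"
proof (rule appr_unique)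
  fix \<epsilon> :: real assume "\<epsilon> > 0"
  then obtain x where x: "appr p x (\<epsilon> / 2)"
    using appr_ex[OF assms, of "\<epsilon> / 2"] by auto
  then have "appr (kmult (kinv p) p) \<one> \<epsilon>"
    using kmult_appr[OF kinv_appr[OF x] x] by (simp add: appr_def)
  then show "\<exists>x. appr (kmult (kinv p) p) x \<epsilon> \<and> appr (\<iota> \<one>) x \<epsilon>"
    using appr_mono[OF appr_\<iota>[OF one_closed], of \<epsilon>] \<open>\<epsilon> > 0\<close> by auto
qed (use assms in \<open>auto intro: kmult_in kinv_in \<iota>_in\<close>)

lemma group_kgroup: "group kgroup"
proof (rule groupI)
  show "x \<otimes>\<^bsub>kgroup\<^esub> y \<in> carrier kgroup" if "x \<in> carrier kgroup" "y \<in> carrier kgroup" for x y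
    using that by (simp add: kgroup_def kmult_in)
  show "\<one>\<^bsub>kgroup\<^esub> \<in> carrier kgroup"
    by (simp add: kgroup_def \<iota>_in)
  show "x \<otimes>\<^bsub>kgroup\<^esub> y \<otimes>\<^bsub>kgroup\<^esub> z = x \<otimes>\<^bsub>kgroup\<^esub> (y \<otimes>\<^bsub>kgroup\<^esub> z)"
    if "x \<in> carrier kgroup" "y \<in> carrier kgroup" "z \<in> carrier kgroup" for x y z
  proof -
    have K: "x \<in> K" "y \<in> K" "z \<in> K"
      using that by (simp_all add: kgroup_def)
    have "kmult (kmult x y) z = kmult x (kmult y z)"
    proof (rule appr_unique)
      fix \<epsilon> :: real assume "\<epsilon> > 0"
      then have e: "\<epsilon> / 3 > 0"
        by simp
      obtain u v w where uvw: "appr x u (\<epsilon> / 3)" "appr y v (\<epsilon> / 3)" "appr z w (\<epsilon> / 3)"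
        using appr_ex[OF K(1) e] appr_ex[OF K(2) e] appr_ex[OF K(3) e] by blast
      then have C: "u \<in> carrier G" "v \<in> carrier G" "w \<in> carrier G"
        by (auto simp: appr_def)
      have "appr (kmult (kmult x y) z) (u \<otimes> v \<otimes> w) \<epsilon>"
        using kmult_appr[OF kmult_appr[OF uvw(1,2)] uvw(3)] by simp
      moreover have "appr (kmult x (kmult y z)) (u \<otimes> v \<otimes> w) \<epsilon>"
        using kmult_appr[OF uvw(1) kmult_appr[OF uvw(2,3)]] C by (simp add: m_assoc)
      ultimately show "\<exists>t. appr (kmult (kmult x y) z) t \<epsilon> \<and> appr (kmult x (kmult y z)) t \<epsilon>"
        by blast
    qed (use K in \<open>auto intro: kmult_in\<close>)
    then show ?thesis
      by (simp add: kgroup_def)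
  qed
  show "\<one>\<^bsub>kgroup\<^esub> \<otimes>\<^bsub>kgroup\<^esub> x = x" if "x \<in> carrier kgroup" for x
  proof -
    have K: "x \<in> K"
      using that by (simp add: kgroup_def)
    have "kmult (\<iota> \<one>) x = x"
    proof (rule appr_unique)
      fix \<epsilon> :: real assume "\<epsilon> > 0"
      then obtain u where u: "appr x u \<epsilon>"
        using appr_ex[OF K] by blast
      then have "appr (kmult (\<iota> \<one>) x) u \<epsilon>"
        using kmult_appr[OF appr_\<iota>[OF one_closed] u] by (simp add: appr_def)
      then show "\<exists>t. appr (kmult (\<iota> \<one>) x) t \<epsilon> \<and> appr x t \<epsilon>"
        using u by blast
    qed (use K in \<open>auto intro: kmult_in \<iota>_in\<close>)
    then show ?thesis
      by (simp add: kgroup_def)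
  qed
  show "\<exists>y\<in>carrier kgroup. y \<otimes>\<^bsub>kgroup\<^esub> x = \<one>\<^bsub>kgroup\<^esub>" if "x \<in> carrier kgroup" for x
    using that kmult_left_inv kinv_in by (auto simp: kgroup_def)
qed

lemma inv_kgroup: "p \<in> K \<Longrightarrow> inv\<^bsub>kgroup\<^esub> p = kinv p"
  using group.inv_equality[OF group_kgroup, of "kinv p" p] kmult_left_inv[of p] kinv_in[of p]
  by (simp add: kgroup_def)

lemma \<iota>_hom: "\<iota> \<in> hom G kgroup"
proof (rule homI)
  fix x y assume xy: "x \<in> carrier G" "y \<in> carrier G"
  have "\<iota> (x \<otimes> y) = kmult (\<iota> x) (\<iota> y)"
  proof (rule appr_unique)
    fix \<epsilon> :: real assume "\<epsilon> > 0"
    then have "appr (\<iota> (x \<otimes> y)) (x \<otimes> y) \<epsilon>" "appr (kmult (\<iota> x) (\<iota> y)) (x \<otimes> y) \<epsilon>"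
      using appr_mono[OF appr_\<iota>, of "x \<otimes> y" \<epsilon>] appr_mono[OF kmult_appr[OF appr_\<iota> appr_\<iota>], of x y \<epsilon>] xy
      by simp_all
    then show "\<exists>t. appr (\<iota> (x \<otimes> y)) t \<epsilon> \<and> appr (kmult (\<iota> x) (\<iota> y)) t \<epsilon>"
      by blast
  qed (use xy in \<open>auto intro: kmult_in \<iota>_in\<close>)
  then show "\<iota> (x \<otimes> y) = \<iota> x \<otimes>\<^bsub>kgroup\<^esub> \<iota> y"
    by (simp add: kgroup_def)
qed (simp add: kgroup_def \<iota>_in)

lemma kmult_lipschitz:
  assumes "p \<in> K" "q \<in> K" "p' \<in> K" "q' \<in> K"
  shows "\<rho> (kmult p q) (kmult p' q') \<le> \<rho> p p' + \<rho> q q'"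
proof (rule field_le_epsilon)
  fix \<epsilon> :: real assume "\<epsilon> > 0"
  then have e: "\<epsilon> / 8 > 0"
    by simp
  \<comment> \<open>Each of the four approximations is used twice, once for the products and once
    for the factors, hence \<open>\<epsilon> / 8\<close>.\<close>
  obtain x z x' z' where a: "appr p x (\<epsilon> / 8)" "appr q z (\<epsilon> / 8)" "appr p' x' (\<epsilon> / 8)" "appr q' z' (\<epsilon> / 8)"
    using appr_ex[OF assms(1) e] appr_ex[OF assms(2) e] appr_ex[OF assms(3) e] appr_ex[OF assms(4) e]
    by blast
  then have C: "x \<in> carrier G" "z \<in> carrier G" "x' \<in> carrier G" "z' \<in> carrier G"
    by (auto simp: appr_def)
  show "\<rho> (kmult p q) (kmult p' q') \<le> \<rho> p p' + \<rho> q q' + \<epsilon>"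
    using appr_dist(1)[OF kmult_appr[OF a(1,2)] kmult_appr[OF a(3,4)]] D_mult[OF C]
      appr_dist(2)[OF a(1,3)] appr_dist(2)[OF a(2,4)] by linarith
qed

lemma kinv_lipschitz:
  assumes "p \<in> K" "q \<in> K"
  shows "\<rho> (kinv p) (kinv q) \<le> \<rho> p q"
proof (rule field_le_epsilon)
  fix \<epsilon> :: real assume "\<epsilon> > 0"
  then have e: "\<epsilon> / 4 > 0"
    by simp
  obtain x z where a: "appr p x (\<epsilon> / 4)" "appr q z (\<epsilon> / 4)"
    using appr_ex[OF assms(1) e] appr_ex[OF assms(2) e] by blast
  then have C: "x \<in> carrier G" "z \<in> carrier G"
    by (auto simp: appr_def)
  show "\<rho> (kinv p) (kinv q) \<le> \<rho> p q + \<epsilon>"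
    using appr_dist(1)[OF kinv_appr[OF a(1)] kinv_appr[OF a(2)]] D_inv[OF C]
      appr_dist(2)[OF a] by linarith
qed

text \<open>The Lipschitz bounds give continuity of the operations. Compactness is completeness
  together with total boundedness, and a finite net of \<open>(G, D)\<close> maps to one of the
  completion by density.\<close>

lemma compact_Hausdorff_kgroup: "compact_Hausdorff_group kgroup K.mtopology"
  unfolding compact_Hausdorff_group_def
proof (intro conjI)
  show "topspace K.mtopology = carrier kgroup"
    by (simp add: kgroup_def)
  show "continuous_map (prod_topology K.mtopology K.mtopology) K.mtopology (\<lambda>(x, y). x \<otimes>\<^bsub>kgroup\<^esub> y)"
    unfolding K.continuous_map_to_metric
  proof (intro ballI allI impI)
    fix pq and \<epsilon> :: real assume "pq \<in> topspace (prod_topology K.mtopology K.mtopology)" and "\<epsilon> > 0"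
    then obtain p q where pq: "pq = (p, q)" "p \<in> K" "q \<in> K"
      by auto
    let ?U = "K.mball p (\<epsilon> / 2) \<times> K.mball q (\<epsilon> / 2)"
    have "(case y of (x, y) \<Rightarrow> x \<otimes>\<^bsub>kgroup\<^esub> y) \<in> K.mball (case pq of (x, y) \<Rightarrow> x \<otimes>\<^bsub>kgroup\<^esub> y) \<epsilon>"
      if "y \<in> ?U" for y
    proof -
      define p' q' where "p' = fst y" and "q' = snd y"
      have y: "y = (p', q')" "p' \<in> K" "q' \<in> K" "\<rho> p p' < \<epsilon> / 2" "\<rho> q q' < \<epsilon> / 2"
        using that by (auto simp: p'_def q'_def)
      have "\<rho> (kmult p q) (kmult p' q') < \<epsilon>"
        using kmult_lipschitz[OF pq(2,3) y(2,3)] y(4,5) by linarith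
      then show ?thesis
        using kmult_in[OF pq(2,3)] kmult_in[OF y(2,3)] by (simp add: kgroup_def pq(1) y(1))
    qed
    moreover have "openin (prod_topology K.mtopology K.mtopology) ?U"
      by (simp add: openin_prod_Times_iff)
    moreover have "pq \<in> ?U"
      using pq \<open>\<epsilon> > 0\<close> by simp
    ultimately show "\<exists>U. openin (prod_topology K.mtopology K.mtopology) U \<and> pq \<in> U \<and>
        (\<forall>y\<in>U. (case y of (x, y) \<Rightarrow> x \<otimes>\<^bsub>kgroup\<^esub> y) \<in> K.mball (case pq of (x, y) \<Rightarrow> x \<otimes>\<^bsub>kgroup\<^esub> y) \<epsilon>)"
      by blast
  qed
  show "continuous_map K.mtopology K.mtopology (\<lambda>x. inv\<^bsub>kgroup\<^esub> x)"
    unfolding K.continuous_map_to_metric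
  proof (intro ballI allI impI)
    fix p and \<epsilon> :: real assume p: "p \<in> topspace K.mtopology" and "\<epsilon> > 0"
    have "inv\<^bsub>kgroup\<^esub> q \<in> K.mball (inv\<^bsub>kgroup\<^esub> p) \<epsilon>" if "q \<in> K.mball p \<epsilon>" for q
      using that p kinv_lipschitz[of p q] kinv_in by (auto simp: inv_kgroup)
    then show "\<exists>U. openin K.mtopology U \<and> p \<in> U \<and> (\<forall>y\<in>U. inv\<^bsub>kgroup\<^esub> y \<in> K.mball (inv\<^bsub>kgroup\<^esub> p) \<epsilon>)"
      using p \<open>\<epsilon> > 0\<close> by (intro exI[of _ "K.mball p \<epsilon>"]) auto
  qed
  have "K.mtotally_bounded K"
    unfolding K.mtotally_bounded_def
  proof (intro allI impI)
    fix \<epsilon> :: real assume "\<epsilon> > 0"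
    then have e: "\<epsilon> / 3 > 0"
      by simp
    obtain F where F: "finite F" "F \<subseteq> carrier G" "\<And>x. x \<in> carrier G \<Longrightarrow> \<exists>y\<in>F. D x y \<le> \<epsilon> / 3"
      using pm_net[OF D_pm e] by blast
    have "p \<in> (\<Union>x\<in>\<iota> ` F. K.mball x \<epsilon>)" if p: "p \<in> K" for p
    proof -
      obtain x where x: "appr p x (\<epsilon> / 3)"
        using appr_ex[OF p e] by blast
      then obtain y where y: "y \<in> F" "D x y \<le> \<epsilon> / 3"
        using F(3) by (auto simp: appr_def)
      then have "\<rho> p (\<iota> y) \<le> \<epsilon> / 3 + D x y + 0"
        using appr_dist(1)[OF x appr_\<iota>] F(2) by blast
      then have "\<rho> (\<iota> y) p < \<epsilon>"
        using y(2) \<open>\<epsilon> > 0\<close> K.commute[of p "\<iota> y"] by simp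
      then show ?thesis
        using y p F(2) \<iota>_in by auto
    qed
    then show "\<exists>F. finite F \<and> F \<subseteq> K \<and> K \<subseteq> (\<Union>x\<in>F. K.mball x \<epsilon>)"
      using F \<iota>_in by (intro exI[of _ "\<iota> ` F"]) auto
  qed
  then show "compact_space K.mtopology"
    using complete by (simp add: K.compact_space_eq_mcomplete_mtotally_bounded)
qed (rule group_kgroup K.Hausdorff_space_mtopology)+

end

section \<open>Construction of the completion on the type of the test groups\<close>

lemma Metric_space_injective_image:
  assumes "Metric_space M d" "inj_on e M"
  defines "d' \<equiv> \<lambda>p q. d (inv_into M e p) (inv_into M e q)"
  shows "Metric_space (e ` M) d'"
    and "Metric_space.mcomplete M d \<Longrightarrow> Metric_space.mcomplete (e ` M) d'"
proof -
  interpret M: Metric_space M d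
    by fact
  have inv_in: "inv_into M e p \<in> M" "e (inv_into M e p) = p" if "p \<in> e ` M" for p
    using that by (auto intro: inv_into_into f_inv_into_f)
  show *: "Metric_space (e ` M) d'"
  proof
    fix x y z assume "x \<in> e ` M" "y \<in> e ` M" "z \<in> e ` M"
    then show "d' x z \<le> d' x y + d' y z"
      unfolding d'_def by (intro M.triangle inv_in)
  next
    fix x y assume "x \<in> e ` M" "y \<in> e ` M"
    then show "(d' x y = 0) = (x = y)"
      unfolding d'_def using M.zero inv_in by metis
  qed (auto simp: d'_def M.commute)
  interpret I: Metric_space "e ` M" d'
    by (rule *)
  show "I.mcomplete" if c: "M.mcomplete"
    unfolding I.mcomplete_def
  proof (intro allI impI)
    fix \<sigma> assume \<sigma>: "I.MCauchy \<sigma>"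
    then have \<sigma>_in: "\<sigma> n \<in> e ` M" for n
      by (auto simp: I.MCauchy_def)
    have "M.MCauchy (\<lambda>n. inv_into M e (\<sigma> n))"
      using \<sigma> inv_in(1)[OF \<sigma>_in] unfolding M.MCauchy_def I.MCauchy_def unfolding d'_def by blast
    then obtain x where "limitin M.mtopology (\<lambda>n. inv_into M e (\<sigma> n)) x sequentially"
      using c by (auto simp: M.mcomplete_def)
    then have x: "x \<in> M" "\<forall>\<epsilon>>0. \<exists>N. \<forall>n\<ge>N. inv_into M e (\<sigma> n) \<in> M \<and> d (inv_into M e (\<sigma> n)) x < \<epsilon>"
      unfolding M.limit_metric_sequentially by blast+
    have "limitin I.mtopology \<sigma> (e x) sequentially"
      unfolding I.limit_metric_sequentially
    proof (intro conjI allI impI)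
      fix \<epsilon> :: real assume "\<epsilon> > 0"
      then obtain N where "\<forall>n\<ge>N. inv_into M e (\<sigma> n) \<in> M \<and> d (inv_into M e (\<sigma> n)) x < \<epsilon>"
        using x(2) by blast
      then show "\<exists>N. \<forall>n\<ge>N. \<sigma> n \<in> e ` M \<and> d' (\<sigma> n) (e x) < \<epsilon>"
        using \<sigma>_in inv_into_f_f[OF assms(2) x(1)] unfolding d'_def by auto
    qed (use x(1) in blast)
    then show "\<exists>x. limitin I.mtopology \<sigma> x sequentially"
      by blast
  qed
qed

text \<open>The encoding moves the completion to the type of the test groups in
  \<^const>\<open>Bohr_compactification\<close>.\<close>

definition subgraph_code :: "'a set \<Rightarrow> ('a \<Rightarrow> real) \<Rightarrow> ('a + nat) set set" where
  "subgraph_code C \<phi> = {{Inl y, Inr n} |y n. y \<in> C \<and> of_rat (nat_to_rat_surj n) < \<phi> y}"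

lemma subgraph_code_iff:
  "{Inl y, Inr n} \<in> subgraph_code C \<phi> \<longleftrightarrow> y \<in> C \<and> of_rat (nat_to_rat_surj n) < \<phi> y"
  by (auto simp: subgraph_code_def doubleton_eq_iff)

text \<open>A real number is determined by the rationals below it, and the tags \<open>Inl\<close>
  and \<open>Inr\<close> make the doubletons decodable as pairs. Off C the functions agree by
  extensionality.\<close>

lemma inj_on_subgraph_code: "inj_on (subgraph_code C) (extensional C)"
proof (rule inj_onI)
  fix \<phi> \<psi> :: "'a \<Rightarrow> real"
  assume ext: "\<phi> \<in> extensional C" "\<psi> \<in> extensional C" and eq: "subgraph_code C \<phi> = subgraph_code C \<psi>"
  have le: "\<not> \<phi> y < \<psi> y" if y: "y \<in> C" and eq: "subgraph_code C \<phi> = subgraph_code C \<psi>" for \<phi> \<psi> y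
  proof
    assume "\<phi> y < \<psi> y"
    then obtain q where q: "\<phi> y < of_rat q" "of_rat q < \<psi> y"
      using of_rat_dense by blast
    obtain n where "q = nat_to_rat_surj n"
      using surjD[OF surj_nat_to_rat_surj] by blast
    then have "of_rat q < \<phi> y"
      using subgraph_code_iff[of y n C \<phi>] subgraph_code_iff[of y n C \<psi>] eq q y by simp
    then show False
      using q by simp
  qed
  show "\<phi> = \<psi>"
  proof (rule extensionalityI[OF ext])
    fix y assume "y \<in> C"
    then show "\<phi> y = \<psi> y"
      using le[OF _ eq, of y] le[OF _ eq[symmetric], of y] by simp
  qed
qed

text \<open>Kuratowski's embedding \<open>x \<mapsto> D x\<close>.\<close>

lemma pseudometric_completion:
  fixes D :: "'a \<Rightarrow> 'a \<Rightarrow> real"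
  assumes ne: "C \<noteq> {}"
    and refl: "\<And>x. x \<in> C \<Longrightarrow> D x x = 0"
    and tri: "\<And>x y z. x \<in> C \<Longrightarrow> y \<in> C \<Longrightarrow> z \<in> C \<Longrightarrow> D x z \<le> D x y + D y z"
    and sym: "\<And>x y. x \<in> C \<Longrightarrow> y \<in> C \<Longrightarrow> D x y = D y x"
    and bd: "\<And>x y. x \<in> C \<Longrightarrow> y \<in> C \<Longrightarrow> \<bar>D x y\<bar> \<le> B"
  shows "\<exists>(K :: ('a \<Rightarrow> real) set) \<rho> \<iota>. Metric_space K \<rho> \<and> Metric_space.mcomplete K \<rho> \<and> K \<subseteq> extensional C \<and>
    (\<forall>x\<in>C. \<iota> x \<in> K) \<and> (\<forall>x\<in>C. \<forall>z\<in>C. \<rho> (\<iota> x) (\<iota> z) = D x z) \<and>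
    (\<forall>p\<in>K. \<forall>\<epsilon>>0. \<exists>x\<in>C. \<rho> p (\<iota> x) \<le> \<epsilon>)"
proof -
  \<comment> \<open>The uniform closure of the functions \<open>D x\<close> on C; no separate
    closure operation on an ambient function space is formed.\<close>
  define K where "K = {\<phi> \<in> extensional C. \<forall>\<epsilon>>0. \<exists>x\<in>C. \<forall>y\<in>C. \<bar>\<phi> y - D x y\<bar> \<le> \<epsilon>}"
  define \<rho> :: "('a \<Rightarrow> real) \<Rightarrow> ('a \<Rightarrow> real) \<Rightarrow> real" where "\<rho> \<phi> \<psi> = (SUP y\<in>C. \<bar>\<phi> y - \<psi> y\<bar>)" for \<phi> \<psi>
  define \<iota> where "\<iota> x = restrict (D x) C" for x
  have K_bd: "\<bar>\<phi> y\<bar> \<le> B + 1" if \<phi>: "\<phi> \<in> K" and y: "y \<in> C" for \<phi> y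
  proof -
    have "\<exists>x\<in>C. \<forall>y\<in>C. \<bar>\<phi> y - D x y\<bar> \<le> 1"
      using \<phi> zero_less_one unfolding K_def by blast
    then obtain x where "x \<in> C" "\<bar>\<phi> y - D x y\<bar> \<le> 1"
      using y by blast
    then show ?thesis
      using bd[of x y] y by linarith
  qed
  have up: "\<bar>\<phi> y - \<psi> y\<bar> \<le> \<rho> \<phi> \<psi>" if "\<phi> \<in> K" "\<psi> \<in> K" "y \<in> C" for \<phi> \<psi> y
  proof -
    have "\<bar>\<phi> z - \<psi> z\<bar> \<le> (B + 1) + (B + 1)" if "z \<in> C" for z
      using K_bd[OF \<open>\<phi> \<in> K\<close> that] K_bd[OF \<open>\<psi> \<in> K\<close> that]
      by (intro order.trans[OF abs_triangle_ineq4 add_mono])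
    then show ?thesis
      unfolding \<rho>_def using that(3) by (intro cSUP_upper bdd_aboveI2)
  qed
  have least: "\<rho> \<phi> \<psi> \<le> c" if "\<And>y. y \<in> C \<Longrightarrow> \<bar>\<phi> y - \<psi> y\<bar> \<le> c" for \<phi> \<psi> c
    unfolding \<rho>_def using ne that by (intro cSUP_least)
  have nonneg: "\<rho> \<phi> \<psi> \<ge> 0" if "\<phi> \<in> K" "\<psi> \<in> K" for \<phi> \<psi>
  proof -
    obtain y where "y \<in> C"
      using ne by blast
    then show ?thesis
      using up[OF that, of y] by linarith
  qed
  have D_lip: "\<bar>D x y - D z y\<bar> \<le> D x z" if "x \<in> C" "y \<in> C" "z \<in> C" for x y z
    using tri[of x z y] tri[of z x y] sym[of x z] that by (simp add: abs_le_iff)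
  have \<iota>_K: "\<iota> x \<in> K" if "x \<in> C" for x
    using that by (auto simp: K_def \<iota>_def intro!: bexI[of _ x])
  \<comment> \<open>\<open>Metric_space\<close> demands nonnegativity and symmetry on the whole
    type, while a supremum over an unbounded set may be any number; hence the value 0 off K.\<close>
  have metric: "Metric_space K (\<lambda>\<phi> \<psi>. if \<phi> \<in> K \<and> \<psi> \<in> K then \<rho> \<phi> \<psi> else 0)"
  proof
    fix \<phi> \<psi> :: "'a \<Rightarrow> real"
    show "0 \<le> (if \<phi> \<in> K \<and> \<psi> \<in> K then \<rho> \<phi> \<psi> else 0)"
      using nonneg by simp
    show "(if \<phi> \<in> K \<and> \<psi> \<in> K then \<rho> \<phi> \<psi> else 0) = (if \<psi> \<in> K \<and> \<phi> \<in> K then \<rho> \<psi> \<phi> else 0)"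
      by (simp add: \<rho>_def abs_minus_commute)
  next
    fix \<phi> \<psi> assume K: "\<phi> \<in> K" "\<psi> \<in> K"
    have "\<phi> = \<psi>" if "\<rho> \<phi> \<psi> = 0"
    proof (rule extensionalityI[of _ C])
      show "\<phi> y = \<psi> y" if "y \<in> C" for y
        using up[OF K that] \<open>\<rho> \<phi> \<psi> = 0\<close> by simp
    qed (use K in \<open>auto simp: K_def\<close>)
    moreover have "\<rho> \<phi> \<phi> = 0"
      using ne by (simp add: \<rho>_def)
    ultimately show "((if \<phi> \<in> K \<and> \<psi> \<in> K then \<rho> \<phi> \<psi> else 0) = 0) = (\<phi> = \<psi>)"
      using K by auto
  next
    fix \<phi> \<psi> \<theta> assume K: "\<phi> \<in> K" "\<psi> \<in> K" "\<theta> \<in> K"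
    have "\<rho> \<phi> \<theta> \<le> \<rho> \<phi> \<psi> + \<rho> \<psi> \<theta>"
    proof (rule least)
      fix y assume y: "y \<in> C"
      show "\<bar>\<phi> y - \<theta> y\<bar> \<le> \<rho> \<phi> \<psi> + \<rho> \<psi> \<theta>"
        using up[OF K(1,2) y] up[OF K(2,3) y] by linarith
    qed
    then show "(if \<phi> \<in> K \<and> \<theta> \<in> K then \<rho> \<phi> \<theta> else 0)
        \<le> (if \<phi> \<in> K \<and> \<psi> \<in> K then \<rho> \<phi> \<psi> else 0) + (if \<psi> \<in> K \<and> \<theta> \<in> K then \<rho> \<psi> \<theta> else 0)"
      using K by simp
  qed
  define d where "d = (\<lambda>\<phi> \<psi>. if \<phi> \<in> K \<and> \<psi> \<in> K then \<rho> \<phi> \<psi> else 0)"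
  interpret K: Metric_space K d
    unfolding d_def by (rule metric)
  have d_eq: "d \<phi> \<psi> = \<rho> \<phi> \<psi>" if "\<phi> \<in> K" "\<psi> \<in> K" for \<phi> \<psi>
    using that by (simp add: d_def)
  have iso: "d (\<iota> x) (\<iota> z) = D x z" if xz: "x \<in> C" "z \<in> C" for x z
  proof (rule antisym)
    have "\<rho> (\<iota> x) (\<iota> z) \<le> D x z"
      using D_lip xz by (intro least) (simp add: \<iota>_def)
    then show "d (\<iota> x) (\<iota> z) \<le> D x z"
      using xz \<iota>_K by (simp add: d_eq)
    \<comment> \<open>The supremum is attained at the point z, where
      \<open>D z z = 0\<close>.\<close>
    have "\<bar>\<iota> x z - \<iota> z z\<bar> \<le> \<rho> (\<iota> x) (\<iota> z)"
      using xz \<iota>_K by (intro up)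
    then show "D x z \<le> d (\<iota> x) (\<iota> z)"
      using xz \<iota>_K refl by (simp add: d_eq \<iota>_def)
  qed
  have dense: "\<exists>x\<in>C. d p (\<iota> x) \<le> \<epsilon>" if p: "p \<in> K" and "\<epsilon> > 0" for p \<epsilon>
  proof -
    obtain x where x: "x \<in> C" "\<forall>y\<in>C. \<bar>p y - D x y\<bar> \<le> \<epsilon>"
      using p \<open>\<epsilon> > 0\<close> unfolding K_def by blast
    then have "\<rho> p (\<iota> x) \<le> \<epsilon>"
      by (intro least) (simp add: \<iota>_def)
    then show ?thesis
      using x(1) p \<iota>_K by (intro bexI[of _ x]) (simp_all add: d_eq)
  qed
  have "K.mcomplete"
    unfolding K.mcomplete_def
  proof (intro allI impI)
    fix \<sigma> assume \<sigma>: "K.MCauchy \<sigma>"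
    then have \<sigma>_K: "\<sigma> n \<in> K" for n
      by (auto simp: K.MCauchy_def)
    have cauchy: "\<exists>N. \<forall>n\<ge>N. \<forall>m\<ge>N. \<forall>y\<in>C. \<bar>\<sigma> n y - \<sigma> m y\<bar> \<le> \<epsilon>" if \<epsilon>: "\<epsilon> > 0" for \<epsilon>
    proof -
      obtain N where N: "\<And>n m. N \<le> n \<Longrightarrow> N \<le> m \<Longrightarrow> d (\<sigma> n) (\<sigma> m) < \<epsilon>"
        using \<sigma> \<epsilon> unfolding K.MCauchy_def by blast
      have "\<bar>\<sigma> n y - \<sigma> m y\<bar> \<le> \<epsilon>" if "N \<le> n" "N \<le> m" "y \<in> C" for n m y
        using N[OF that(1,2)] up[OF \<sigma>_K \<sigma>_K that(3), of n m] d_eq[OF \<sigma>_K \<sigma>_K, of n m] by linarith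
      then show ?thesis
        by blast
    qed
    have "convergent (\<lambda>n. \<sigma> n y)" if y: "y \<in> C" for y
    proof (rule Cauchy_convergent, rule metric_CauchyI)
      fix \<epsilon> :: real assume "\<epsilon> > 0"
      then obtain N where "\<forall>n\<ge>N. \<forall>m\<ge>N. \<forall>y\<in>C. \<bar>\<sigma> n y - \<sigma> m y\<bar> \<le> \<epsilon> / 2"
        using cauchy[of "\<epsilon> / 2"] by auto
      then have "dist (\<sigma> n y) (\<sigma> m y) < \<epsilon>" if "N \<le> n" "N \<le> m" for n m
        using that y \<open>\<epsilon> > 0\<close> by (force simp: dist_real_def)
      then show "\<exists>N. \<forall>n\<ge>N. \<forall>m\<ge>N. dist (\<sigma> n y) (\<sigma> m y) < \<epsilon>"
        by blast
    qed
    then have lim: "(\<lambda>n. \<sigma> n y) \<longlonglongrightarrow> lim (\<lambda>n. \<sigma> n y)" if "y \<in> C" for y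
      using that by (simp add: convergent_LIMSEQ_iff)
    define \<phi> where "\<phi> = restrict (\<lambda>y. lim (\<lambda>n. \<sigma> n y)) C"
    have close: "\<exists>N. \<forall>n\<ge>N. \<forall>y\<in>C. \<bar>\<sigma> n y - \<phi> y\<bar> \<le> \<epsilon>" if \<epsilon>: "\<epsilon> > 0" for \<epsilon>
    proof -
      obtain N where N: "\<forall>n\<ge>N. \<forall>m\<ge>N. \<forall>y\<in>C. \<bar>\<sigma> n y - \<sigma> m y\<bar> \<le> \<epsilon>"
        using cauchy[OF \<epsilon>] by blast
      have "\<bar>\<sigma> n y - \<phi> y\<bar> \<le> \<epsilon>" if "n \<ge> N" "y \<in> C" for n y
      proof (rule LIMSEQ_le_const2)
        show "(\<lambda>m. \<bar>\<sigma> n y - \<sigma> m y\<bar>) \<longlonglongrightarrow> \<bar>\<sigma> n y - \<phi> y\<bar>"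
          using lim[OF that(2)] that(2) by (auto simp: \<phi>_def intro!: tendsto_intros)
      qed (use N that in blast)
      then show ?thesis
        by blast
    qed
    have \<phi>_K: "\<phi> \<in> K"
      unfolding K_def
    proof (intro CollectI conjI allI impI)
      show "\<phi> \<in> extensional C"
        by (simp add: \<phi>_def)
      fix \<epsilon> :: real assume "\<epsilon> > 0"
      then obtain N where N: "\<forall>n\<ge>N. \<forall>y\<in>C. \<bar>\<sigma> n y - \<phi> y\<bar> \<le> \<epsilon> / 2"
        using close[of "\<epsilon> / 2"] by auto
      obtain x where x: "x \<in> C" "\<forall>y\<in>C. \<bar>\<sigma> N y - D x y\<bar> \<le> \<epsilon> / 2"
        using \<sigma>_K[of N] \<open>\<epsilon> > 0\<close> half_gt_zero[of \<epsilon>] unfolding K_def by blast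
      have "\<bar>\<phi> y - D x y\<bar> \<le> \<epsilon>" if "y \<in> C" for y
      proof -
        have "\<bar>\<sigma> N y - \<phi> y\<bar> \<le> \<epsilon> / 2" "\<bar>\<sigma> N y - D x y\<bar> \<le> \<epsilon> / 2"
          using N x(2) that by auto
        then show ?thesis
          by linarith
      qed
      then show "\<exists>x\<in>C. \<forall>y\<in>C. \<bar>\<phi> y - D x y\<bar> \<le> \<epsilon>"
        using x(1) by blast
    qed
    have "limitin K.mtopology \<sigma> \<phi> sequentially"
      unfolding K.limit_metric_sequentially
    proof (intro conjI allI impI \<phi>_K)
      fix \<epsilon> :: real assume "\<epsilon> > 0"
      then obtain N where N: "\<forall>n\<ge>N. \<forall>y\<in>C. \<bar>\<sigma> n y - \<phi> y\<bar> \<le> \<epsilon> / 2"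
        using close[of "\<epsilon> / 2"] by auto
      have "d (\<sigma> n) \<phi> < \<epsilon>" if "n \<ge> N" for n
      proof -
        have "\<rho> (\<sigma> n) \<phi> \<le> \<epsilon> / 2"
          using N that by (intro least) blast
        then show ?thesis
          using \<open>\<epsilon> > 0\<close> \<sigma>_K \<phi>_K by (simp add: d_eq)
      qed
      then show "\<exists>N. \<forall>n\<ge>N. \<sigma> n \<in> K \<and> d (\<sigma> n) \<phi> < \<epsilon>"
        using \<sigma>_K by blast
    qed
    then show "\<exists>x. limitin K.mtopology \<sigma> x sequentially"
      by blast
  qed
  moreover have "K \<subseteq> extensional C"
    by (auto simp: K_def)
  ultimately show ?thesis
    using K.Metric_space_axioms \<iota>_K iso dense by (intro exI[of _ K] exI[of _ d] exI[of _ \<iota>] conjI ballI allI impI)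
qed

text \<open>D is a pseudometric, so \<open>\<iota>\<close> identifies points at distance 0; K is a
  compact group with a dense image of that quotient.\<close>

lemma compact_group_completion:
  fixes G :: "('a, 'm) monoid_scheme" (structure)
  assumes G: "group G" and bi: "bi_precompact_pm G D"
  shows "\<exists>(K :: ('a + nat) set set monoid) \<rho> \<iota>. Metric_space (carrier K) \<rho> \<and>
    compact_Hausdorff_group K (Metric_space.mtopology (carrier K) \<rho>) \<and> \<iota> \<in> hom G K \<and>
    (\<forall>x\<in>carrier G. \<forall>z\<in>carrier G. \<rho> (\<iota> x) (\<iota> z) = D x z)"
proof -
  interpret group G
    by (rule G)
  have pm: "precompact_pm G D"
    using bi by (simp add: bi_precompact_pm_def)
  obtain B where B: "\<And>x y. x \<in> carrier G \<Longrightarrow> y \<in> carrier G \<Longrightarrow> D x y \<le> B"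
    using pm_bounded[OF pm] by blast
  have B': "\<bar>D x y\<bar> \<le> B" if "x \<in> carrier G" "y \<in> carrier G" for x y
    using B[OF that] pm_nonneg[OF pm that] by simp
  have "carrier G \<noteq> {}"
    using one_closed by blast
  then have "\<exists>(L :: ('a \<Rightarrow> real) set) d j. Metric_space L d \<and> Metric_space.mcomplete L d \<and> L \<subseteq> extensional (carrier G) \<and>
      (\<forall>x\<in>carrier G. j x \<in> L) \<and> (\<forall>x\<in>carrier G. \<forall>z\<in>carrier G. d (j x) (j z) = D x z) \<and>
      (\<forall>p\<in>L. \<forall>\<epsilon>>0. \<exists>x\<in>carrier G. d p (j x) \<le> \<epsilon>)"
    by (rule pseudometric_completion[where B = B])
      (assumption | rule pm_refl[OF pm] pm_triangle[OF pm] pm_sym[OF pm] B')+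
  then obtain L :: "('a \<Rightarrow> real) set" and d j
    where L: "Metric_space L d" "Metric_space.mcomplete L d" "L \<subseteq> extensional (carrier G)"
      "\<forall>x\<in>carrier G. j x \<in> L" "\<forall>x\<in>carrier G. \<forall>z\<in>carrier G. d (j x) (j z) = D x z"
      "\<forall>p\<in>L. \<forall>\<epsilon>>0. \<exists>x\<in>carrier G. d p (j x) \<le> \<epsilon>"
    by (elim exE conjE)
  define e where "e = subgraph_code (carrier G)"
  have inj: "inj_on e L"
    unfolding e_def by (rule inj_on_subset[OF inj_on_subgraph_code L(3)])
  define \<rho> where "\<rho> = (\<lambda>p q. d (inv_into L e p) (inv_into L e q))"
  define \<iota> where "\<iota> x = e (j x)" for x
  have 1: "Metric_space (e ` L) \<rho>" "Metric_space.mcomplete (e ` L) \<rho>"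
    unfolding \<rho>_def using Metric_space_injective_image[OF L(1) inj] L(2) by auto
  have 2: "\<And>x. x \<in> carrier G \<Longrightarrow> \<iota> x \<in> e ` L"
    using L(4) by (auto simp: \<iota>_def)
  have 3: "\<And>x z. x \<in> carrier G \<Longrightarrow> z \<in> carrier G \<Longrightarrow> \<rho> (\<iota> x) (\<iota> z) = D x z"
    using L(4,5) inj by (simp add: \<rho>_def \<iota>_def)
  have 4: "\<And>p \<epsilon>. p \<in> e ` L \<Longrightarrow> \<epsilon> > 0 \<Longrightarrow> \<exists>x\<in>carrier G. \<rho> p (\<iota> x) \<le> \<epsilon>"
    using L(4,6) inj by (auto simp: \<rho>_def \<iota>_def)
  note facts = G bi 1 2 3 4
  show ?thesis
    using compact_Hausdorff_kgroup[OF facts] \<iota>_hom[OF facts] 1(1) 3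
    by (intro exI[of _ "kgroup G \<rho> \<iota> (e ` L)"] exI[of _ \<rho>] exI[of _ \<iota>]) (simp add: kgroup_def[OF facts])
qed

text \<open>The homomorphism \<open>\<iota>\<close> into the compact completion factors through
  \<open>\<eta>\<close> by a continuous h. As \<open>\<iota>\<close> is isometric, the D-ball is the
  preimage under \<open>\<eta>\<close> of the open set where h lands in a metric ball.\<close>

lemma openin_Bohr_ball:
  fixes G :: "('a, 'm) monoid_scheme" (structure)
  assumes G: "group G" and bohr: "Bohr_compactification G bG T \<eta>"
    and bi: "bi_precompact_pm G D" and z: "z \<in> carrier G"
  shows "openin (Bohr_topology G T \<eta>) {x \<in> carrier G. D x z < r}"
proof -
  obtain K :: "('a + nat) set set monoid" and \<rho> \<iota> where K: "Metric_space (carrier K) \<rho>"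
    "compact_Hausdorff_group K (Metric_space.mtopology (carrier K) \<rho>)" "\<iota> \<in> hom G K"
    "\<forall>x\<in>carrier G. \<forall>z\<in>carrier G. \<rho> (\<iota> x) (\<iota> z) = D x z"
    using compact_group_completion[OF G bi] by (elim exE conjE)
  interpret K: Metric_space "carrier K" \<rho>
    by (rule K(1))
  have "\<exists>!h. h \<in> hom bG K \<and> h \<in> extensional (carrier bG) \<and> continuous_map T K.mtopology h \<and>
      (\<forall>x\<in>carrier G. h (\<eta> x) = \<iota> x)"
    using bohr K(2,3) unfolding Bohr_compactification_def by blast
  then obtain h where h: "continuous_map T K.mtopology h" "\<And>x. x \<in> carrier G \<Longrightarrow> h (\<eta> x) = \<iota> x"
    by blast
  have \<eta>: "\<eta> x \<in> topspace T" if "x \<in> carrier G" for x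
    using bohr that by (auto simp: Bohr_compactification_def compact_Hausdorff_group_def hom_def)
  define V where "V = {b \<in> topspace T. h b \<in> K.mball (\<iota> z) r}"
  have "openin T V"
    unfolding V_def using h(1) by (rule openin_continuous_map_preimage) simp
  moreover have "\<eta> -` V \<inter> carrier G = {x \<in> carrier G. D x z < r}"
  proof -
    have "h (\<eta> x) \<in> K.mball (\<iota> z) r \<longleftrightarrow> D x z < r" if "x \<in> carrier G" for x
      using K(3) K(4) K.commute[of "\<iota> z" "\<iota> x"] that z by (simp add: h(2) hom_def Pi_iff)
    then show ?thesis
      using \<eta> by (auto simp: V_def)
  qed
  ultimately show ?thesis
    unfolding Bohr_topology_def openin_pullback_topology by auto
qed

section \<open>Product sets\<close>

context two_means
begin

lemma conv_cong:
  assumes "\<mu>.bf g" "t \<in> carrier G" "\<And>z. z \<in> carrier G \<Longrightarrow> g z = g' z"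
  shows "conv g t = conv g' t"
  unfolding conv_def using assms by (intro \<nu>.cong bfun_mult bfun_b) auto

lemma conv_sum:
  assumes "\<And>i. i \<in> I \<Longrightarrow> \<mu>.bf (g i)" "t \<in> carrier G"
  shows "conv (\<lambda>z. \<Sum>i\<in>I. g i z) t = (\<Sum>i\<in>I. conv (g i) t)"
  unfolding conv_def sum_distrib_left using assms by (intro \<nu>.sum bfun_mult bfun_b) auto

lemma conv_one:
  assumes "t \<in> carrier G"
  shows "conv (\<lambda>_. 1) t = \<nu> b"
proof -
  have "\<mu>.bf b"
    using b_le by (rule bfunI)
  then show ?thesis
    unfolding conv_def using \<nu>.invariant[of "inv t" b] assms by simp
qed

end

text \<open>If no translate \<open>F y\<close> lies in \<open>AB\<close>, then \<open>G\<close> is the disjoint union of sets \<open>S\<^sub>x\<close> (\<open>x \<in> F\<close>) with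
  \<open>x S\<^sub>x \<inter> AB = \<emptyset>\<close>, so that \<open>\<lambda>(S\<^sub>x) \<le> \<epsilon> \<nu>(S\<^sub>x)\<close> by almost invariance.\<close>

lemma translates_in_product_set:
  fixes G :: "('a, 'm) monoid_scheme" (structure)
  assumes amen: "amenable_group G" and A: "A \<subseteq> carrier G" and B: "B \<subseteq> carrier G"
    and pos: "sigma_R G A > 0" "sigma_R G B > 0"
  shows "\<exists>D. bi_precompact_pm G D \<and>
    (\<forall>F. finite F \<and> F \<subseteq> {x \<in> carrier G. D x \<one> < 1} \<longrightarrow> (\<exists>y\<in>carrier G. F #> y \<subseteq> A <#> B))"
proof -
  obtain \<mu> where \<mu>: "invariant_mean G \<mu>" "\<mu> (indicator A) > 0"
    using invariant_mean_positive_density[OF amen A pos(1)] by blast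
  obtain \<nu> where \<nu>: "invariant_mean G \<nu>" "\<nu> (indicator B) > 0"
    using invariant_mean_positive_density[OF amen B pos(2)] by blast
  interpret two_means G \<mu> \<nu> "indicator B"
    using \<mu>(1) \<nu>(1) by (intro two_means.intro two_means_axioms.intro) auto
  let ?C = "carrier G" and ?a = "indicator A :: 'a \<Rightarrow> real"
  \<comment> \<open>This is the total mass \<open>\<lambda>(1)\<close>; almost invariance is used
    with error c / 2.\<close>
  define c where "c = \<mu> ?a * \<nu> (indicator B)"
  have c: "c > 0"
    using \<mu>(2) \<nu>(2) by (simp add: c_def)
  have a: "\<mu>.bf ?a" "\<mu>.ip ?a ?a \<le> 1"
    using \<mu>.ip_bound[of ?a 1 ?a 1] by (auto simp: bfun_indicator)
  obtain D where D: "bi_precompact_pm G D"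
    "\<And>x g. x \<in> ?C \<Longrightarrow> D x \<one> < 1 \<Longrightarrow> \<mu>.bf g \<Longrightarrow>
      \<bar>\<mu>.ip ?a (conv (\<lambda>z. g (x \<otimes> z))) - \<mu>.ip ?a (conv g)\<bar> \<le> c / 2 * \<nu> (\<lambda>z. \<bar>g z\<bar>)"
    by (rule almost_invariance[OF a half_gt_zero[OF c]]) blast
  have total: "\<mu>.ip ?a (conv (\<lambda>_. 1)) = c"
  proof -
    have "\<mu>.ip ?a (conv (\<lambda>_. 1)) = \<mu>.ip ?a (\<lambda>_. \<nu> (indicator B))"
      using a by (intro \<mu>.ip_cong bfun_conv bfun_const) (auto simp: conv_one)
    also have "\<dots> = c"
      using \<mu>.scale[OF a(1), of "\<nu> (indicator B)"] by (simp add: \<mu>.ip_def c_def mult.commute)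
    finally show ?thesis .
  qed
  have vanish: "\<mu>.ip ?a (conv g) = 0"
    if g: "\<mu>.bf g" "\<And>z. z \<in> A <#> B \<Longrightarrow> g z = 0" for g
  proof -
    have "?a t * conv g t = 0" if t: "t \<in> ?C" for t
    proof (cases "t \<in> A")
      case True
      have "indicator B (inv t \<otimes> z) * g z = 0" if z: "z \<in> ?C" for z
      proof (cases "inv t \<otimes> z \<in> B")
        case inB: True
        have "z = t \<otimes> (inv t \<otimes> z)"
          using t z by (simp flip: \<mu>.m_assoc)
        then have "z \<in> A <#> B"
          using True inB unfolding set_mult_def by blast
        then show ?thesis
          using g(2) by simp
      qed simp
      then have "conv g t = \<nu> (\<lambda>_. 0)"
        unfolding conv_def using g(1) t by (intro \<nu>.cong bfun_mult bfun_b) auto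
      then show ?thesis
        by simp
    qed simp
    then have "\<mu>.ip ?a (conv g) = \<mu> (\<lambda>_. 0)"
      unfolding \<mu>.ip_def using a g by (intro \<mu>.cong bfun_mult bfun_conv)
    then show ?thesis
      by simp
  qed
  have "\<exists>y\<in>?C. F #> y \<subseteq> A <#> B" if F: "finite F" "F \<subseteq> {x \<in> ?C. D x \<one> < 1}" for F
  proof (rule ccontr)
    assume neg: "\<not> ?thesis"
    have "\<forall>y\<in>?C. \<exists>x\<in>F. x \<otimes> y \<notin> A <#> B"
      using neg by (auto simp: r_coset_def)
    then obtain s where s: "\<And>y. y \<in> ?C \<Longrightarrow> s y \<in> F" "\<And>y. y \<in> ?C \<Longrightarrow> s y \<otimes> y \<notin> A <#> B"
      by metis
    \<comment> \<open>The function s chooses, for each y, an element of F that moves y out of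
      \<open>A <#> B\<close>; \<open>g x\<close> is the indicator of the piece on which x is
      chosen.\<close>
    define g where "g x = (indicator {y. s y = x} :: 'a \<Rightarrow> real)" for x
    have bg: "\<mu>.bf (g x)" for x
      by (simp add: g_def bfun_indicator)
    have g_sum: "(\<Sum>x\<in>F. g x y) = 1" if "y \<in> ?C" for y
      using s(1)[OF that] F(1) by (simp add: g_def indicator_def)
    have part: "\<mu>.ip ?a (conv (g x)) \<le> c / 2 * \<nu> (g x)" if x: "x \<in> F" for x
    proof -
      have xC: "x \<in> ?C" "D x \<one> < 1"
        using x F(2) by auto
      \<comment> \<open>The indicator of the piece moved by x, which is disjoint from
        \<open>A <#> B\<close> and so has \<open>\<lambda>\<close> equal to 0. Translating h back by
        x recovers \<open>g x\<close>, and almost invariance compares the two.\<close>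
      define h where "h = \<mu>.tr x (g x)"
      have bh: "\<mu>.bf h"
        unfolding h_def using xC bg by (intro \<mu>.bfun_tr)
      have "\<mu>.ip ?a (conv h) = 0"
      proof (rule vanish[OF bh])
        fix z assume z: "z \<in> A <#> B"
        then have zC: "z \<in> ?C"
          using A B \<mu>.set_mult_closed by blast
        have "s (inv x \<otimes> z) \<noteq> x"
        proof
          assume "s (inv x \<otimes> z) = x"
          then have "x \<otimes> (inv x \<otimes> z) \<notin> A <#> B"
            using s(2)[of "inv x \<otimes> z"] xC zC by simp
          moreover have "x \<otimes> (inv x \<otimes> z) = z"
            using xC zC by (simp flip: \<mu>.m_assoc)
          ultimately show False
            using z by simp
        qed
        then show "h z = 0"
          by (simp add: h_def \<mu>.tr_def g_def)
      qed
      moreover have "\<mu>.ip ?a (conv (\<lambda>z. h (x \<otimes> z))) = \<mu>.ip ?a (conv (g x))"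
      proof (rule \<mu>.ip_cong)
        have eq: "h (x \<otimes> z) = g x z" if "z \<in> ?C" for z
          using xC that by (simp add: h_def \<mu>.tr_def flip: \<mu>.m_assoc)
        show bt: "\<mu>.bf (conv (\<lambda>z. h (x \<otimes> z)))"
          using bh xC by (intro bfun_conv \<mu>.bfun_translate)
        show "conv (\<lambda>z. h (x \<otimes> z)) t = conv (g x) t" if "t \<in> ?C" for t
          using bh xC that eq by (intro conv_cong \<mu>.bfun_translate)
      qed (use a in auto)
      moreover have "\<nu> (\<lambda>z. \<bar>h z\<bar>) = \<nu> (g x)"
      proof -
        have "\<nu> (\<lambda>z. \<bar>h z\<bar>) = \<nu> (\<lambda>z. \<bar>g x z\<bar>)"
          unfolding h_def \<mu>.tr_def using xC bg by (intro \<nu>.invariant[of "inv x" "\<lambda>z. \<bar>g x z\<bar>"] bfun_abs) auto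
        then show ?thesis
          by (simp add: g_def)
      qed
      ultimately show ?thesis
        using D(2)[OF xC bh] by simp
    qed
    have "c = \<mu>.ip ?a (\<lambda>t. \<Sum>x\<in>F. conv (g x) t)"
    proof -
      have "conv (\<lambda>_. 1) t = (\<Sum>x\<in>F. conv (g x) t)" if t: "t \<in> ?C" for t
      proof -
        have "conv (\<lambda>z. \<Sum>x\<in>F. g x z) t = conv (\<lambda>_. 1) t"
          using t bg g_sum by (intro conv_cong bfun_sum)
        then show ?thesis
          using conv_sum[of F g t] bg t by simp
      qed
      then have "\<mu>.ip ?a (conv (\<lambda>_. 1)) = \<mu>.ip ?a (\<lambda>t. \<Sum>x\<in>F. conv (g x) t)"
        using a by (intro \<mu>.ip_cong bfun_conv bfun_const) auto
      then show ?thesis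
        by (simp add: total)
    qed
    also have "\<dots> = (\<Sum>x\<in>F. \<mu>.ip ?a (conv (g x)))"
      using a bg by (intro \<mu>.ip_sum_right bfun_conv)
    \<comment> \<open>The pieces have total \<open>\<nu>\<close>-mass 1, so the sum is c / 2
      whatever the size of F, and \<open>c \<le> c / 2\<close> contradicts
      \<open>c > 0\<close>.\<close>
    also have "\<dots> \<le> (\<Sum>x\<in>F. c / 2 * \<nu> (g x))"
      using part by (rule sum_mono)
    also have "\<dots> = c / 2 * \<nu> (\<lambda>y. \<Sum>x\<in>F. g x y)"
      using bg by (simp add: \<nu>.sum sum_distrib_left)
    also have "\<nu> (\<lambda>y. \<Sum>x\<in>F. g x y) = \<nu> (\<lambda>_. 1)"
      using bg g_sum by (intro \<nu>.cong bfun_sum)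
    finally show False
      using c by simp
  qed
  then show ?thesis
    using D(1) by blast
qed

text \<open>The translating element y varies with F, but the Bohr open set must be fixed. A
  pigeonhole over a finite net places suitable y for all F near one point z. A small ball around z
  is the open set, and the union of the translates \<open>F #> y F\<close> is the thick set.\<close>

lemma piecewise_Bohr_if_translates:
  fixes G :: "('a, 'm) monoid_scheme" (structure)
  assumes G: "group G" and bohr: "Bohr_compactification G bG T \<eta>" and D: "bi_precompact_pm G D"
    and C: "C \<subseteq> carrier G"
    and trans: "\<And>F. finite F \<Longrightarrow> F \<subseteq> {x \<in> carrier G. D x \<one> < 1} \<Longrightarrow> \<exists>y\<in>carrier G. F #> y \<subseteq> C"
  shows "piecewise_Bohr G T \<eta> C"
proof -
  interpret group G
    by (rule G)
  have pm: "precompact_pm G D"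
    and right: "\<And>x y z. x \<in> carrier G \<Longrightarrow> y \<in> carrier G \<Longrightarrow> z \<in> carrier G \<Longrightarrow> D (x \<otimes> z) (y \<otimes> z) = D x y"
    using D by (simp_all add: bi_precompact_pm_def)
  \<comment> \<open>Only those points of F that lie in the unit ball are required to land in C, so
    that F may be any finite subset of G, as thickness demands.\<close>
  define good where "good F y \<longleftrightarrow> y \<in> carrier G \<and> (\<forall>x\<in>F. D x \<one> < 1 \<longrightarrow> x \<otimes> y \<in> C)" for F y
  have good: "\<exists>y. good F y" if "finite F" "F \<subseteq> carrier G" for F
  proof -
    obtain y where "y \<in> carrier G" "{x \<in> F. D x \<one> < 1} #> y \<subseteq> C"
      using trans[of "{x \<in> F. D x \<one> < 1}"] \<open>finite F\<close> \<open>F \<subseteq> carrier G\<close> by auto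
    then show ?thesis
      by (auto simp: good_def r_coset_def)
  qed
  have "(1 :: real) / 3 > 0"
    by simp
  then obtain Z where Z: "finite Z" "Z \<subseteq> carrier G" "\<And>x. x \<in> carrier G \<Longrightarrow> \<exists>z\<in>Z. D x z \<le> 1 / 3"
    using pm_net[OF pm, of "1 / 3"] by blast
  \<comment> \<open>Otherwise each net point z has a finite counterexample \<open>E z\<close>. An
    element good for their union is good for each of them, and lies near some net point.\<close>
  have "\<exists>z\<in>Z. \<forall>F. finite F \<and> F \<subseteq> carrier G \<longrightarrow> (\<exists>y. good F y \<and> D y z \<le> 1 / 3)"
  proof (rule ccontr)
    assume "\<not> ?thesis"
    then have "\<forall>z\<in>Z. \<exists>F. (finite F \<and> F \<subseteq> carrier G) \<and> \<not> (\<exists>y. good F y \<and> D y z \<le> 1 / 3)"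
      by blast
    then obtain E where E: "\<forall>z\<in>Z. (finite (E z) \<and> E z \<subseteq> carrier G) \<and> \<not> (\<exists>y. good (E z) y \<and> D y z \<le> 1 / 3)"
      by (rule bchoice[THEN exE])
    have "finite (\<Union>(E ` Z))" "\<Union>(E ` Z) \<subseteq> carrier G"
      using E Z(1) by auto
    then obtain y where y: "good (\<Union>(E ` Z)) y"
      using good by blast
    then have "y \<in> carrier G"
      by (simp add: good_def)
    then obtain z where z: "z \<in> Z" "D y z \<le> 1 / 3"
      using Z(3) by blast
    have "good (E z) y"
      using y z(1) by (auto simp: good_def)
    then show False
      using E z by blast
  qed
  then obtain z where z: "z \<in> Z" "\<forall>F. finite F \<and> F \<subseteq> carrier G \<longrightarrow> (\<exists>y. good F y \<and> D y z \<le> 1 / 3)"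
    by blast
  then obtain y where y: "\<And>F. finite F \<Longrightarrow> F \<subseteq> carrier G \<Longrightarrow> good F (y F) \<and> D (y F) z \<le> 1 / 3"
    by metis
  have zC: "z \<in> carrier G"
    using z(1) Z(2) by blast
  define U where "U = {x \<in> carrier G. D x z < 1 / 3}"
  define S where "S = (\<Union>F \<in> {F. finite F \<and> F \<subseteq> carrier G}. F #> y F)"
  have "openin (Bohr_topology G T \<eta>) U"
    unfolding U_def by (rule openin_Bohr_ball[OF G bohr D zC])
  moreover have "U \<noteq> {}"
    using zC pm_refl[OF pm zC] by (auto simp: U_def)
  moreover have "thick G S"
    unfolding thick_def
  proof (intro conjI allI impI)
    show "S \<subseteq> carrier G"
      using y by (auto simp: S_def r_coset_def good_def)
    show "\<exists>y\<in>carrier G. F #> y \<subseteq> S" if "finite F \<and> F \<subseteq> carrier G" for F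
      using y[of F] that by (intro bexI[of _ "y F"]) (auto simp: S_def good_def)
  qed
  moreover have "U \<inter> S \<subseteq> C"
  proof
    fix u assume u: "u \<in> U \<inter> S"
    then obtain F x where F: "finite F" "F \<subseteq> carrier G" "x \<in> F" "u = x \<otimes> y F"
      by (auto simp: S_def r_coset_def)
    have yF: "y F \<in> carrier G" "D (y F) z \<le> 1 / 3" "good F (y F)"
      using y[OF F(1,2)] by (auto simp: good_def)
    have x: "x \<in> carrier G"
      using F by blast
    \<comment> \<open>Right invariance recovers the size of x from the position of u: both u and
      \<open>y F\<close> are within 1/3 of z, which gives a distance below 2/3 and so places x in
      the unit ball.\<close>
    have "D x \<one> = D u (y F)"
      using right[OF x one_closed yF(1)] F(4) yF(1) by simp
    also have "\<dots> \<le> D u z + D z (y F)"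
      using u zC yF(1) by (intro pm_triangle[OF pm]) (auto simp: U_def)
    also have "D z (y F) = D (y F) z"
      using zC yF(1) by (rule pm_sym[OF pm])
    finally have "D x \<one> < 1"
      using u yF(2) by (simp add: U_def)
    then show "u \<in> C"
      using yF(3) F by (simp add: good_def)
  qed
  ultimately show ?thesis
    unfolding piecewise_Bohr_def using C by blast
qed

text \<open>The neighbourhood in the second claim is the unit ball of D itself, whose finite subsets
  have right translates in the product set; it is not derived from the piecewise Bohr
  structure.\<close>

theorem theorem16p8:
  fixes G :: "('a, 'm) monoid_scheme"
    and bG :: "('b, 'n) monoid_scheme"
    and T :: "'b topology"
    and \<eta> :: "'a \<Rightarrow> 'b"
    and A B :: "'a set"
  assumes "group G" and "amenable_group G"
    and "Bohr_compactification G bG T \<eta>"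
    and "A \<subseteq> carrier G" and "B \<subseteq> carrier G"
    and "sigma_R G A > 0" and "sigma_R G B > 0"
  shows "piecewise_Bohr G T \<eta> (A <#>\<^bsub>G\<^esub> B) \<and>
    (\<exists>U. openin (Bohr_topology G T \<eta>) U \<and> \<one>\<^bsub>G\<^esub> \<in> U \<and>
         finitely_embeddable G U (A <#>\<^bsub>G\<^esub> B))"
proof -
  interpret group G
    by fact
  obtain D where D: "bi_precompact_pm G D" and trans: "\<forall>F. finite F \<and> F \<subseteq> {x \<in> carrier G. D x \<one>\<^bsub>G\<^esub> < 1} \<longrightarrow>
      (\<exists>y\<in>carrier G. F #>\<^bsub>G\<^esub> y \<subseteq> A <#>\<^bsub>G\<^esub> B)"
    using translates_in_product_set[OF assms(2,4-7)] by (elim exE conjE)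
  have AB: "A <#>\<^bsub>G\<^esub> B \<subseteq> carrier G"
    using assms(4,5) by (rule set_mult_closed)
  define U where "U = {x \<in> carrier G. D x \<one>\<^bsub>G\<^esub> < 1}"
  have "openin (Bohr_topology G T \<eta>) U"
    unfolding U_def by (rule openin_Bohr_ball[OF assms(1,3) D one_closed])
  moreover have "\<one>\<^bsub>G\<^esub> \<in> U"
    using D pm_refl[of G D "\<one>\<^bsub>G\<^esub>"] by (simp add: U_def bi_precompact_pm_def)
  moreover have "finitely_embeddable G U (A <#>\<^bsub>G\<^esub> B)"
    unfolding finitely_embeddable_def using AB trans by (auto simp: U_def)
  moreover have "piecewise_Bohr G T \<eta> (A <#>\<^bsub>G\<^esub> B)"
    using trans by (intro piecewise_Bohr_if_translates[OF assms(1,3) D AB]) blast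
  ultimately show ?thesis
    by blast
qed

end
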